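(* Consider the stable ($\rho<1$) $M/G/1$ retrial queue with Bernoulli schedule in steady state, and suppose that the service time $T_\beta$ satisfies $P\{T_\beta>t\}\sim t^{-a}L(t)$ as $t\to\infty$, where $a>1$ and $L$ is slowly varying at $\infty$. Then, as $j\to\infty$, $$P\{R_{orb}>j\mid I_{ser}=1,\ R_{que}=0\}\;\sim\;\frac{\lambda_2^{a}}{(1-\rho)(a-1)(1-\rho_1)^{a}}\; j^{-a+1}L(j).$$
   Context: Model ($M/G/1$ retrial queue with Bernoulli schedule). Customers arrive according to a Poisson process with rate $\lambda>0$ at a single-server system that has a (priority) queue of infinite capacity and an orbit. A customer who finds the server idle on arrival is served immediately. A customer who finds the server busy joins the queue (first-in-first-out) with probability $q$, or the orbit with probability $p=1-q$, where $0<q<1$. At a service completion, if the queue is non-empty the customer at its head starts service; otherwise the server becomes idle. Each customer in the orbit independently retries according to a Poisson process with rate $\mu>0$ until finding the server idle, and is then served immediately. Customers leave after service. All service times are i.i.d. copies of $T_\beta$ with distribution function $F_\beta$, $F_\beta(0)=0$, finite mean $\beta_1$, and Laplace-Stieltjes transform (LST) $\beta(s)=E(e^{-sT_\beta})$; arrivals, services, routing choices and retrials are independent. Parameters: $\lambda_1=\lambda q$, $\lambda_2=\lambda p$, $\rho_1=\lambda_1\beta_1$, $\rho_2=\lambda_2\beta_1$, $\rho=\rho_1+\rho_2=\lambda\beta_1$. The system is stable if and only if $\rho<1$, which is assumed. In steady state, $R_{que}$ is the number of customers in the queue (excluding the one in service), $R_{orb}$ is the number of customers in the orbit, and $I_{ser}=1$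 or $0$ according to whether the server is busy or idle. Known facts taken as the starting point (Choi and Park): $P\{I_{ser}=1\}=\rho$ and $$E(z_1^{R_{que}}z_2^{R_{orb}}\mid I_{ser}=1)=M_a(z_1,z_2)\,M_b(z_1,z_2)\,M_c(z_2)\,R_0(z_2),$$ where $$M_a(z_1,z_2)=\frac1\rho\cdot\frac{1-\beta(\lambda-\lambda_1z_1-\lambda_2z_2)}{1-pz_2-qz_1},\qquad M_b(z_1,z_2)=(1-\rho_1)\frac{h(z_2)-z_1}{\beta(\lambda-\lambda_1z_1-\lambda_2z_2)-z_1},$$ $$M_c(z_2)=\frac{1-\rho}{1-\rho_1}\cdot\frac{1-z_2}{h(z_2)-z_2},\qquad R_0(z_2)=\exp\Big\{-\frac{\lambda}{\mu}\int_{z_2}^1\frac{1-h(u)}{h(u)-u}\,du\Big\},$$ with removable singularities filled by continuity, and $h(z)$ is uniquely determined by $h(z)=\beta(\lambda-\lambda_1h(z)-\lambda_2z)$. Equivalently, $h(z)=\alpha(\lambda_2-\lambda_2z)$, where $\alpha$ is the LST of the busy period of the standard $M/G/1$ queue with arrival rate $\lambda_1$ and service time $T_\beta$, satisfying $\alpha(s)=\beta(s+\lambda_1-\lambda_1\alpha(s))$. A measurable $L:(0,\infty)\to(0,\infty)$ is slowly varying at $\infty$ if $\lim_{t\to\infty}L(xt)/L(t)=1$ for all $x>0$. The notation $f\sim g$ means $f/g\to1$. *)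

theory Defs
  imports "HOL-Probability.Probability" "HOL-Library.Landau_Symbols"
begin

section \<open>The queueing model\<close>

text \<open>
  The random inputs of the system: the times between successive arrivals, the service
  time of customer \<open>n\<close>, the routing coin of customer \<open>n\<close> (\<open>1\<close> for the priority queue,
  \<open>0\<close> for the orbit; only used if customer \<open>n\<close> finds the server busy), and the times
  between successive retrials of customer \<open>n\<close> (only used if customer \<open>n\<close> joins the orbit).
\<close>

datatype input = Interarrival nat | Service nat | Routing nat | Retrial nat nat

definition arrival_time :: "(input \<Rightarrow> real) \<Rightarrow> nat \<Rightarrow> real" where
  "arrival_time v n = (\<Sum>k\<le>n. v (Interarrival k))"

definition retrial_time :: "(input \<Rightarrow> real) \<Rightarrow> nat \<Rightarrow> nat \<Rightarrow> real" where
  "retrial_time v n k = arrival_time v n + (\<Sum>i\<le>k. v (Retrial n i))"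

text \<open>
  In the following, \<open>v\<close> is a realisation of the inputs and \<open>s n\<close> is the time at which the
  service of customer \<open>n\<close> starts.
\<close>

definition completion_time :: "(input \<Rightarrow> real) \<Rightarrow> (nat \<Rightarrow> real) \<Rightarrow> nat \<Rightarrow> real" where
  "completion_time v s n = s n + v (Service n)"

definition busy :: "(input \<Rightarrow> real) \<Rightarrow> (nat \<Rightarrow> real) \<Rightarrow> real \<Rightarrow> bool" where
  "busy v s t \<longleftrightarrow> (\<exists>m. s m \<le> t \<and> t < completion_time v s m)"

text \<open>The left limit of \<^const>\<open>busy\<close>, i.e. what an arrival or a retrial at time \<open>t\<close> finds.\<close>

definition busy_before :: "(input \<Rightarrow> real) \<Rightarrow> (nat \<Rightarrow> real) \<Rightarrow> real \<Rightarrow> bool" where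
  "busy_before v s t \<longleftrightarrow> (\<exists>m. s m < t \<and> t \<le> completion_time v s m)"

definition joins_queue :: "(input \<Rightarrow> real) \<Rightarrow> (nat \<Rightarrow> real) \<Rightarrow> nat \<Rightarrow> bool" where
  "joins_queue v s n \<longleftrightarrow> busy_before v s (arrival_time v n) \<and> v (Routing n) = 1"

definition joins_orbit :: "(input \<Rightarrow> real) \<Rightarrow> (nat \<Rightarrow> real) \<Rightarrow> nat \<Rightarrow> bool" where
  "joins_orbit v s n \<longleftrightarrow> busy_before v s (arrival_time v n) \<and> v (Routing n) \<noteq> 1"

text \<open>
  The service completions after the arrival of customer \<open>n\<close> at which no earlier customer
  is waiting in the queue any more. The first of them is the first service completion at
  which customer \<open>n\<close> is at the head of the queue.
\<close>

definition queue_opportunities :: "(input \<Rightarrow> real) \<Rightarrow> (nat \<Rightarrow> real) \<Rightarrow> nat \<Rightarrow> real set" where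
  "queue_opportunities v s n =
     {c \<in> range (completion_time v s). arrival_time v n < c \<and>
        (\<forall>k<n. joins_queue v s k \<longrightarrow> s k < c)}"

definition orbit_opportunities :: "(input \<Rightarrow> real) \<Rightarrow> (nat \<Rightarrow> real) \<Rightarrow> nat \<Rightarrow> real set" where
  "orbit_opportunities v s n = {r \<in> range (retrial_time v n). \<not> busy_before v s r}"

definition is_first :: "real set \<Rightarrow> real \<Rightarrow> bool" where
  "is_first A x \<longleftrightarrow> x \<in> A \<and> (\<forall>y\<in>A. x \<le> y)"

text \<open>
  The dynamics of the system, which is empty at time \<open>0\<close>. Outside a null set (simultaneous
  events, an orbit customer that is never served) these conditions determine \<open>s\<close> from \<open>v\<close>.
\<close>

definition retrial_dynamics :: "(input \<Rightarrow> real) \<Rightarrow> (nat \<Rightarrow> real) \<Rightarrow> bool" where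
  "retrial_dynamics v s \<longleftrightarrow> (\<forall>n.
     (\<not> busy_before v s (arrival_time v n) \<longrightarrow> s n = arrival_time v n) \<and>
     (joins_queue v s n \<longrightarrow> is_first (queue_opportunities v s n) (s n)) \<and>
     (joins_orbit v s n \<longrightarrow> is_first (orbit_opportunities v s n) (s n)))"

definition server_state :: "(input \<Rightarrow> real) \<Rightarrow> (nat \<Rightarrow> real) \<Rightarrow> real \<Rightarrow> nat" where
  "server_state v s t = (if busy v s t then 1 else 0)"

definition queue_length :: "(input \<Rightarrow> real) \<Rightarrow> (nat \<Rightarrow> real) \<Rightarrow> real \<Rightarrow> nat" where
  "queue_length v s t = card {n. joins_queue v s n \<and> arrival_time v n \<le> t \<and> t < s n}"

definition orbit_length :: "(input \<Rightarrow> real) \<Rightarrow> (nat \<Rightarrow> real) \<Rightarrow> real \<Rightarrow> nat" where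
  "orbit_length v s t = card {n. joins_orbit v s n \<and> arrival_time v n \<le> t \<and> t < s n}"

text \<open>The triple (server state, number in queue, number in orbit) at time \<open>t\<close>.\<close>

definition system_state :: "(input \<Rightarrow> real) \<Rightarrow> (nat \<Rightarrow> real) \<Rightarrow> real \<Rightarrow> nat \<times> nat \<times> nat" where
  "system_state v s t = (server_state v s t, queue_length v s t, orbit_length v s t)"

text \<open>
  \<open>B\<close> is the law of the service time, so that \<^term>\<open>cdf B\<close> is its distribution function.
\<close>

locale bernoulli_retrial_queue = prob_space M + serv: real_distribution B
  for M :: "'w measure" and B :: "real measure" +
  fixes lam mu q :: real
    and V :: "input \<Rightarrow> 'w \<Rightarrow> real"
    and st :: "nat \<Rightarrow> 'w \<Rightarrow> real"
  assumes lam_pos: "0 < lam"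
    and mu_pos: "0 < mu"
    and q_pos: "0 < q"
    and q_less_1: "q < 1"
    and service_pos: "cdf B 0 = 0"
    and service_mean: "integrable B (\<lambda>x. x)"
    and indep: "indep_vars (\<lambda>_. borel) V UNIV"
    and interarrival: "\<And>n. distributed M lborel (V (Interarrival n)) (exponential_density lam)"
    and service: "\<And>n. distr M borel (V (Service n)) = B"
    and routing_queue: "\<And>n. \<P>(\<omega> in M. V (Routing n) \<omega> = 1) = q"
    and routing_orbit: "\<And>n. \<P>(\<omega> in M. V (Routing n) \<omega> = 0) = 1 - q"
    and retrial: "\<And>n k. distributed M lborel (V (Retrial n k)) (exponential_density mu)"
    and start: "\<And>n. random_variable borel (st n)"
    and dynamics: "AE \<omega> in M. retrial_dynamics (\<lambda>i. V i \<omega>) (\<lambda>n. st n \<omega>)"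

text \<open>
  The steady-state law of \<open>(I_ser, R_que, R_orb)\<close> is the limiting law of the system state.
\<close>

definition steady_state ::
  "'w measure \<Rightarrow> (input \<Rightarrow> 'w \<Rightarrow> real) \<Rightarrow> (nat \<Rightarrow> 'w \<Rightarrow> real) \<Rightarrow> (nat \<times> nat \<times> nat) pmf \<Rightarrow> bool" where
  "steady_state M V st \<pi> \<longleftrightarrow>
     (\<forall>x. ((\<lambda>t. \<P>(\<omega> in M. system_state (\<lambda>i. V i \<omega>) (\<lambda>n. st n \<omega>) t = x))
             \<longlongrightarrow> pmf \<pi> x) at_top)"


section \<open>Parameters and the Choi--Park generating function\<close>

definition mean1 :: "real measure \<Rightarrow> real" where
  "mean1 B = (\<integral>x. x \<partial>B)"

definition LST :: "real measure \<Rightarrow> real \<Rightarrow> real" where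
  "LST B u = (\<integral>x. exp (- u * x) \<partial>B)"

definition lam1 :: "real \<Rightarrow> real \<Rightarrow> real" where "lam1 lam q = lam * q"
definition lam2 :: "real \<Rightarrow> real \<Rightarrow> real" where "lam2 lam q = lam * (1 - q)"

definition rho1 :: "real \<Rightarrow> real \<Rightarrow> real measure \<Rightarrow> real" where
  "rho1 lam q B = lam1 lam q * mean1 B"

definition rho :: "real \<Rightarrow> real measure \<Rightarrow> real" where
  "rho lam B = lam * mean1 B"

text \<open>
  For \<open>0 \<le> z \<le> 1\<close> and \<^term>\<open>rho1 lam q B < 1\<close>, the equation has exactly one solution in
  \<open>[0, 1]\<close>.
\<close>

definition h_fun :: "real \<Rightarrow> real \<Rightarrow> real measure \<Rightarrow> real \<Rightarrow> real" where
  "h_fun lam q B z =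
     (THE y. 0 \<le> y \<and> y \<le> 1 \<and> y = LST B (lam - lam1 lam q * y - lam2 lam q * z))"

definition M_a :: "real \<Rightarrow> real \<Rightarrow> real measure \<Rightarrow> real \<Rightarrow> real \<Rightarrow> real" where
  "M_a lam q B z1 z2 =
     1 / rho lam B *
     ((1 - LST B (lam - lam1 lam q * z1 - lam2 lam q * z2)) / (1 - (1 - q) * z2 - q * z1))"

definition M_b :: "real \<Rightarrow> real \<Rightarrow> real measure \<Rightarrow> real \<Rightarrow> real \<Rightarrow> real" where
  "M_b lam q B z1 z2 =
     (1 - rho1 lam q B) *
     ((h_fun lam q B z2 - z1) / (LST B (lam - lam1 lam q * z1 - lam2 lam q * z2) - z1))"

definition M_c :: "real \<Rightarrow> real \<Rightarrow> real measure \<Rightarrow> real \<Rightarrow> real" where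
  "M_c lam q B z2 =
     (1 - rho lam B) / (1 - rho1 lam q B) * ((1 - z2) / (h_fun lam q B z2 - z2))"

definition R_0 :: "real \<Rightarrow> real \<Rightarrow> real \<Rightarrow> real measure \<Rightarrow> real \<Rightarrow> real" where
  "R_0 lam mu q B z2 =
     exp (- (lam / mu) *
       integral {z2..1} (\<lambda>u. (1 - h_fun lam q B u) / (h_fun lam q B u - u)))"

text \<open>
  The theorem of Choi and Park. The denominators vanish on \<open>[0, 1]\<^sup>2\<close> only for
  \<open>z2 = 1\<close> and for \<open>z1 = h z2\<close>. These are the removable singularities, and the values there
  are determined by continuity of the generating function.
\<close>

definition choi_park ::
  "real \<Rightarrow> real \<Rightarrow> real \<Rightarrow> real measure \<Rightarrow> (nat \<times> nat \<times> nat) pmf \<Rightarrow> bool" where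
  "choi_park lam mu q B \<pi> \<longleftrightarrow>
     \<P>((i, k, j) in measure_pmf \<pi>. i = 1) = rho lam B \<and>
     (\<forall>z1\<in>{0..1}. \<forall>z2\<in>{0..<1}. z1 \<noteq> h_fun lam q B z2 \<longrightarrow>
        measure_pmf.expectation (cond_pmf \<pi> {(i, k, j). i = 1}) (\<lambda>(i, k, j). z1 ^ k * z2 ^ j) =
        M_a lam q B z1 z2 * M_b lam q B z1 z2 * M_c lam q B z2 * R_0 lam mu q B z2)"


section \<open>Slow variation\<close>

definition slowly_varying :: "(real \<Rightarrow> real) \<Rightarrow> bool" where
  "slowly_varying L \<longleftrightarrow>
     L \<in> borel_measurable (restrict_space borel {0<..}) \<and>
     (\<forall>t>0. L t > 0) \<and>
     (\<forall>x>0. ((\<lambda>t. L (x * t) / L t) \<longlongrightarrow> 1) at_top)"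

end

theory Submission
  imports Defs "HOL-Real_Asymp.Real_Asymp"
begin

text \<open>
  Let \<open>K\<close> be the number of arrivals during a service time. As generating functions,
  \<open>h = K(g)\<close> with \<open>g(z) = q h(z) + (1 - q) z\<close>, so \<open>h\<close> belongs to the total orbit progeny \<open>N\<close> of
  a subcritical branching process. Let \<open>K\<^sub>e\<close> have the integrated tail of \<open>K\<close> and put
  \<open>E = K\<^sub>e(g)\<close>. Eliminating \<open>h\<close> gives
  \<open>M\<^sub>c = (1 - \<rho>) (1 - \<rho>\<^sub>1 E) / ((1 - \<rho>\<^sub>1) (1 - \<rho> E))\<close> and
  \<open>(1 - h(z)) / (h(z) - z) = \<rho>\<^sub>2 E / (1 - \<rho> E)\<close>. So \<open>M\<^sub>c\<close> is the law of a geometric sum of copies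
  of \<open>E\<close>, and \<open>R\<^sub>0\<close> is compound Poisson with jumps of a lighter tail.

  As \<open>K\<^sub>e\<close> has a heavier tail than \<open>N\<close>, the law of large numbers suffices for
  \<open>P(E > x) \<sim> P(K\<^sub>e > x / g'(1))\<close>. About \<open>N\<close> only the bound \<open>P(N > x) = O(P(K > x))\<close> is needed;
  it follows, uniformly over the generations of the branching process, from the
  Hoffmann--Jorgensen inequality. The factor \<open>M\<^sub>b(0, z) = (1 - \<rho>\<^sub>1) h(z) / K((1 - q) z)\<close> is never
  expanded: its denominator, an exponentially light law up to a constant, is moved to the other
  side, where the convolution with it does not change the tail.
\<close>


subsection \<open>Regular variation of monotone functions\<close>

text \<open>For a < 2 the law K has a mean but no variance, so neither the law of large numbers nor
  the bounds for sums may use second moments. Moreover N is given only by N = K(g), where g contains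
  N again: nothing about its tail can be assumed while it is being bounded. Hence the bound runs
  along iterates, with one constant for all generations; the induction closes because rho q, the
  mean number of queue children, is below 1. Identities of generating functions serve only to
  identify laws. Every asymptotic statement is about tails, so no Tauberian step occurs. Origin of
  the constant: Poisson concentration gives P(K > x) \<sim> lam^a P(T > x), Karamata's theorem gives
  P(K_e > x) \<sim> x P(K > x) / ((a - 1) rho). Passing to E replaces x by x / m with m = g'(1) = (1
  - q) / (1 - rho_1), a factor m^(a - 1), and M_c contributes rho_2 / ((1 - rho) (1 - rho_1)). All
  other factors are lighter, by the order of 1 / x or exponentially, and leave no trace.\<close>

text \<open>The index of variation is \<open>- al\<close>. Monotonicity makes Potter-type bounds elementary.\<close>

definition rv :: "(real \<Rightarrow> real) \<Rightarrow> real \<Rightarrow> bool" where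
  "rv f al \<longleftrightarrow> antimono f \<and> (\<forall>x. 0 < f x) \<and>
     (\<forall>c>0. ((\<lambda>x. f (c * x) / f x) \<longlongrightarrow> c powr (- al)) at_top)"

lemma rv_antimono: "rv f al \<Longrightarrow> x \<le> y \<Longrightarrow> f y \<le> f x"
  by (auto simp: rv_def antimono_def)

lemma rv_pos: "rv f al \<Longrightarrow> 0 < f x"
  by (auto simp: rv_def)

lemma rv_lim: "rv f al \<Longrightarrow> 0 < c \<Longrightarrow> ((\<lambda>x. f (c * x) / f x) \<longlongrightarrow> c powr (- al)) at_top"
  by (auto simp: rv_def)

lemma filterlim_mult_at_top: "0 < (c::real) \<Longrightarrow> filterlim (\<lambda>x. c * x) at_top at_top"
  by real_asymp

lemma rv_asymp:
  assumes g: "rv g al" and "antimono f" "\<And>x. 0 < f x"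
    and lim: "((\<lambda>x. f x / g x) \<longlongrightarrow> c) at_top" and "0 < c"
  shows "rv f al"
  unfolding rv_def
proof (intro conjI allI impI)
  fix b :: real assume b: "0 < b"
  have 1: "((\<lambda>x. f (b * x) / g (b * x)) \<longlongrightarrow> c) at_top"
    using filterlim_compose[OF lim filterlim_mult_at_top[OF b]] .
  have "((\<lambda>x. (f (b * x) / g (b * x)) * (g (b * x) / g x) / (f x / g x)) \<longlongrightarrow> c * b powr (- al) / c) at_top"
    by (intro tendsto_intros 1 lim rv_lim[OF g b]) (use \<open>0 < c\<close> in auto)
  moreover have "(f (b * x) / g (b * x)) * (g (b * x) / g x) / (f x / g x) = f (b * x) / f x" for x
    using rv_pos[OF g, of x] rv_pos[OF g, of "b * x"] assms(3)[of x] by (simp add: field_simps)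
  ultimately show "((\<lambda>x. f (b * x) / f x) \<longlongrightarrow> b powr (- al)) at_top"
    using \<open>0 < c\<close> by (simp only:) simp
qed (use assms in auto)

lemma at_right_0_witness:
  assumes "\<forall>\<^sub>F d in at_right (0::real). P d"
  obtains d where "0 < d" "d < 1" "P d"
proof -
  have "\<forall>\<^sub>F d in at_right 0. (0::real) < d \<and> d < 1"
    by (intro eventually_conj eventually_at_right_less eventually_at_rightI[of 0 1]) auto
  from eventually_happens'[OF trivial_limit_at_right_real eventually_conj[OF assms this]] that
  show ?thesis by blast
qed

text \<open>Divide by \<open>u x\<close>, let x grow with d fixed, then let d tend to 0: both bounds
  tend to \<open>b powr (- al)\<close>. The additive error \<open>d * u x\<close> has room for
  exceptional events, the factor \<open>1 - d\<close> for the probability of typical ones;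
  concentration arguments produce exactly this form.\<close>

lemma rv_sandwich:
  assumes u: "rv u al" and b: "0 < b"
    and upper: "\<And>d. 0 < d \<Longrightarrow> d < 1 \<Longrightarrow> \<forall>\<^sub>F x in at_top. f x \<le> u ((1 - d) * b * x) + d * u x"
    and lower: "\<And>d. 0 < d \<Longrightarrow> d < 1 \<Longrightarrow> \<forall>\<^sub>F x in at_top. (1 - d) * u ((1 + d) * b * x) \<le> f x"
  shows "((\<lambda>x. f x / u x) \<longlongrightarrow> b powr (- al)) at_top"
proof (rule order_tendstoI)
  fix y assume y: "b powr (- al) < y"
  have "((\<lambda>d. ((1 - d) * b) powr (- al) + d) \<longlongrightarrow> ((1 - 0) * b) powr (- al) + 0) (at_right 0)"
    by (intro tendsto_intros) (use b in auto)
  then have "\<forall>\<^sub>F d in at_right 0. ((1 - d) * b) powr (- al) + d < y"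
    using y by (intro order_tendstoD(2)) auto
  then obtain d where d: "((1 - d) * b) powr (- al) + d < y" "0 < d" "d < 1" using at_right_0_witness by blast
  have "((\<lambda>x. u ((1 - d) * b * x) / u x + d) \<longlongrightarrow> ((1 - d) * b) powr (- al) + d) at_top"
    by (intro tendsto_intros rv_lim[OF u]) (use b d in auto)
  then have "\<forall>\<^sub>F x in at_top. u ((1 - d) * b * x) / u x + d < y"
    using d(1) by (rule order_tendstoD(2))
  then show "\<forall>\<^sub>F x in at_top. f x / u x < y"
    using upper[OF d(2,3)]
  proof eventually_elim
    case (elim x)
    have "f x / u x \<le> (u ((1 - d) * b * x) + d * u x) / u x"
      using elim rv_pos[OF u, of x] by (intro divide_right_mono) auto
    also have "\<dots> = u ((1 - d) * b * x) / u x + d"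
      using rv_pos[OF u, of x] by (simp add: field_simps)
    finally show ?case using elim by simp
  qed
next
  fix y assume y: "y < b powr (- al)"
  have "((\<lambda>d. (1 - d) * ((1 + d) * b) powr (- al)) \<longlongrightarrow> (1 - 0) * ((1 + 0) * b) powr (- al)) (at_right 0)"
    by (intro tendsto_intros) (use b in auto)
  then have "\<forall>\<^sub>F d in at_right 0. y < (1 - d) * ((1 + d) * b) powr (- al)"
    using y by (intro order_tendstoD(1)) auto
  then obtain d where d: "y < (1 - d) * ((1 + d) * b) powr (- al)" "0 < d" "d < 1" using at_right_0_witness by blast
  have "((\<lambda>x. (1 - d) * (u ((1 + d) * b * x) / u x)) \<longlongrightarrow> (1 - d) * ((1 + d) * b) powr (- al)) at_top"
    by (intro tendsto_intros rv_lim[OF u]) (use b d in auto)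
  then have "\<forall>\<^sub>F x in at_top. y < (1 - d) * (u ((1 + d) * b * x) / u x)"
    using d(1) by (rule order_tendstoD(1))
  then show "\<forall>\<^sub>F x in at_top. y < f x / u x"
    using lower[OF d(2,3)]
  proof eventually_elim
    case (elim x)
    have "(1 - d) * (u ((1 + d) * b * x) / u x) \<le> f x / u x"
      using divide_right_mono[OF elim(2), of "u x"] rv_pos[OF u, of x] by simp
    then show ?case using elim by simp
  qed
qed

text \<open>Monotonicity takes the place of the uniform convergence theorem, since
  \<open>y x\<close> lies between \<open>(1 - d) * b * x\<close> and \<open>(1 + d) * b * x\<close>.
  It will absorb the rounding in the integrated tail.\<close>

lemma rv_arg_asymp:
  assumes u: "rv u al" and b: "0 < b" and y: "((\<lambda>x. y x / x) \<longlongrightarrow> b) at_top"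
  shows "((\<lambda>x. u (y x) / u x) \<longlongrightarrow> b powr (- al)) at_top"
proof (rule rv_sandwich[OF u b])
  fix d :: real assume d: "0 < d" "d < 1"
  have "\<forall>\<^sub>F x in at_top. (1 - d) * b < y x / x" "\<forall>\<^sub>F x in at_top. y x / x < (1 + d) * b"
    using b d by (auto intro: order_tendstoD[OF y])
  then have *: "\<forall>\<^sub>F x in at_top. (1 - d) * b * x \<le> y x \<and> y x \<le> (1 + d) * b * x"
    using eventually_gt_at_top[of 0] by eventually_elim (auto simp: field_simps)
  show "\<forall>\<^sub>F x in at_top. u (y x) \<le> u ((1 - d) * b * x) + d * u x"
    using * 
  proof eventually_elim
    case (elim x)
    then show ?case using rv_antimono[OF u, of "(1 - d) * b * x" "y x"] rv_pos[OF u, of x] d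
      by (smt (verit) mult_pos_pos)
  qed
  show "\<forall>\<^sub>F x in at_top. (1 - d) * u ((1 + d) * b * x) \<le> u (y x)"
    using * 
  proof eventually_elim
    case (elim x)
    have "(1 - d) * u ((1 + d) * b * x) \<le> 1 * u ((1 + d) * b * x)"
      using d rv_pos[OF u] by (intro mult_right_mono) (auto intro: less_imp_le)
    then show ?case using rv_antimono[OF u, of "y x" "(1 + d) * b * x"] elim by simp
  qed
qed

text \<open>Far out, \<open>f (2 * x) / f x\<close> exceeds half its limit; on the remaining bounded
  range \<open>f x\<close> is at most \<open>f 0\<close> and \<open>f (2 * x)\<close> at least
  \<open>f (2 * Y)\<close>. One constant for all nonnegative x is what the later inductions
  require.\<close>

lemma rv_doubling:
  assumes f: "rv f al"
  obtains D where "1 \<le> D" "\<And>x. 0 \<le> x \<Longrightarrow> f x \<le> D * f (2 * x)"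
proof -
  let ?e = "2 powr (- al) / 2 :: real"
  have "\<forall>\<^sub>F x in at_top. ?e < f (2 * x) / f x"
    by (rule order_tendstoD(1)[OF rv_lim[OF f]]) auto
  then obtain X where X: "\<And>x. x \<ge> X \<Longrightarrow> ?e < f (2 * x) / f x"
    by (auto simp: eventually_at_top_linorder)
  define Y where "Y = max X 0"
  define D where "D = max 1 (max (1 / ?e) (f 0 / f (2 * Y)))"
  have "f x \<le> D * f (2 * x)" if x: "0 \<le> x" for x
  proof (cases "x \<ge> Y")
    case True
    then have "?e < f (2 * x) / f x" by (intro X) (auto simp: Y_def)
    then have "f x \<le> (1 / ?e) * f (2 * x)" using rv_pos[OF f, of x] by (simp add: field_simps)
    also have "\<dots> \<le> D * f (2 * x)"
      by (intro mult_right_mono) (auto simp: D_def intro: less_imp_le rv_pos[OF f])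
    finally show ?thesis .
  next
    case False
    have "f x \<le> f 0" using rv_antimono[OF f x] .
    also have "f 0 = (f 0 / f (2 * Y)) * f (2 * Y)" using rv_pos[OF f, of "2 * Y"] by simp
    also have "\<dots> \<le> (f 0 / f (2 * Y)) * f (2 * x)"
      using False by (intro mult_left_mono rv_antimono[OF f] divide_nonneg_nonneg)
        (auto intro: less_imp_le rv_pos[OF f])
    also have "\<dots> \<le> D * f (2 * x)"
      by (intro mult_right_mono) (auto simp: D_def intro: less_imp_le rv_pos[OF f])
    finally show ?thesis .
  qed
  then show ?thesis by (intro that[of D]) (auto simp: D_def)
qed

text \<open>A Potter-type bound by iterated doubling: with \<open>2 ^ j\<close> between k and 2 k,
  the cost \<open>D ^ j\<close> is at most \<open>(2 ^ j) ^ p\<close>, hence polynomial in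
  k.\<close>

lemma rv_div_bound:
  assumes f: "rv f al"
  obtains C p where "0 < C" "\<And>x k. 0 \<le> x \<Longrightarrow> 1 \<le> k \<Longrightarrow> f (x / real k) \<le> C * real k ^ p * f x"
proof -
  obtain D where D: "1 \<le> D" "\<And>x. 0 \<le> x \<Longrightarrow> f x \<le> D * f (2 * x)"
    using rv_doubling[OF f] by blast
  have it: "f (x / 2 ^ j) \<le> D ^ j * f x" if "0 \<le> x" for x j
  proof (induction j)
    case (Suc j)
    have "f (x / 2 ^ Suc j) \<le> D * f (2 * (x / 2 ^ Suc j))" using that by (intro D) auto
    also have "\<dots> = D * f (x / 2 ^ j)" by simp
    also have "\<dots> \<le> D * (D ^ j * f x)" using Suc D(1) by (intro mult_left_mono) auto
    finally show ?case by simp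
  qed simp
  obtain p where p: "D \<le> 2 ^ p" using real_arch_pow[of 2 D] by (auto intro: less_imp_le)
  have "f (x / real k) \<le> 2 ^ p * real k ^ p * f x" if x: "0 \<le> x" and k: "1 \<le> k" for x k
  proof -
    obtain j where j: "k \<le> 2 ^ j" "2 ^ j \<le> 2 * k"
    proof -
      obtain n where "2 ^ n \<le> k" "k < 2 ^ (n + 1)" using ex_power_ivl1[of 2 k] k by auto
      then show ?thesis by (intro that[of "n + 1"]) auto
    qed
    have j1: "real k \<le> 2 ^ j" using j(1) by (metis of_nat_le_iff of_nat_numeral of_nat_power)
    have j2: "2 ^ j \<le> 2 * real k" using j(2) by (metis of_nat_le_iff of_nat_numeral of_nat_power of_nat_mult)
    have "f (x / real k) \<le> f (x / 2 ^ j)"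
      using j1 k x by (intro rv_antimono[OF f] divide_left_mono) auto
    also have "\<dots> \<le> D ^ j * f x" by (rule it[OF x])
    also have "\<dots> \<le> (2 ^ p) ^ j * f x"
      using p D rv_pos[OF f, of x] by (intro mult_right_mono power_mono) auto
    also have "(2 ^ p) ^ j = ((2::real) ^ j) ^ p" by (simp add: power_mult[symmetric] mult.commute)
    also have "(2 ^ j) ^ p * f x \<le> (2 * real k) ^ p * f x"
      using j2 rv_pos[OF f, of x] by (intro mult_right_mono power_mono) auto
    finally show ?thesis by (simp add: power_mult_distrib)
  qed
  then show ?thesis by (intro that[of "2 ^ p" p]) auto
qed

lemma rv_scale_bound:
  assumes f: "rv f al" and c: "0 < c"
  obtains C where "0 < C" "\<And>x. 0 \<le> x \<Longrightarrow> f (c * x) \<le> C * f x"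
proof -
  obtain C p where C: "0 < C" "\<And>x k. 0 \<le> x \<Longrightarrow> 1 \<le> k \<Longrightarrow> f (x / real k) \<le> C * real k ^ p * f x"
    using rv_div_bound[OF f] by blast
  obtain k where k: "1 / c < real k" using reals_Archimedean2 by blast
  then have k1: "1 \<le> k" using c by (cases k) (auto simp: divide_less_0_iff)
  have "f (c * x) \<le> C * real k ^ p * f x" if "0 \<le> x" for x
  proof -
    have "x / real k \<le> c * x" 
    proof -
      have "1 * x \<le> (c * real k) * x" using k c that by (intro mult_right_mono) (auto simp: field_simps)
      then show ?thesis using k1 by (simp add: field_simps)
    qed
    then have "f (c * x) \<le> f (x / real k)" by (rule rv_antimono[OF f])
    also have "\<dots> \<le> C * real k ^ p * f x" by (rule C(2)[OF that k1])
    finally show ?thesis .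
  qed
  then show ?thesis using C k1 by (intro that[of "C * real k ^ p"]) auto
qed

text \<open>Dividing x by x rounded up leaves an argument of at most 1, so the division bound
  compares \<open>f 1\<close> with a power of x times \<open>f x\<close>.\<close>

lemma rv_polynomial_lower:
  assumes f: "rv f al"
  obtains c p where "0 < c" "\<And>x. 1 \<le> x \<Longrightarrow> c \<le> x ^ p * f x"
proof -
  obtain C p where C: "0 < C" "\<And>x k. 0 \<le> x \<Longrightarrow> 1 \<le> k \<Longrightarrow> f (x / real k) \<le> C * real k ^ p * f x"
    using rv_div_bound[OF f] by blast
  have "f 1 / (C * 2 ^ p) \<le> x ^ p * f x" if x: "1 \<le> x" for x
  proof -
    define k where "k = nat \<lceil>x\<rceil>"
    have k: "1 \<le> k" "x \<le> real k" "real k \<le> 2 * x" using x unfolding k_def by linarith+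
    have "f 1 \<le> f (x / real k)" using k by (intro rv_antimono[OF f]) auto
    also have "\<dots> \<le> C * real k ^ p * f x" using k x by (intro C) auto
    also have "\<dots> \<le> C * (2 * x) ^ p * f x"
      using k C rv_pos[OF f, of x] by (intro mult_right_mono mult_left_mono power_mono) auto
    finally show ?thesis using C(1) by (simp add: field_simps power_mult_distrib)
  qed
  then show ?thesis using C rv_pos[OF f, of 1] by (intro that[of "f 1 / (C * 2 ^ p)" p]) auto
qed

lemma rv_exponential_negligible:
  assumes f: "rv f al" and r: "0 < r" "r < 1"
  shows "((\<lambda>x. r powr x / f x) \<longlongrightarrow> 0) at_top"
proof -
  obtain c p where c: "0 < c" "\<And>x. 1 \<le> x \<Longrightarrow> c \<le> x ^ p * f x"
    using rv_polynomial_lower[OF f] by blast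
  have *: "((\<lambda>x. x ^ p * r powr x / c) \<longlongrightarrow> 0) at_top"
    using r c(1) by real_asymp
  show ?thesis
  proof (rule tendsto_sandwich[OF _ _ tendsto_const *])
    show "\<forall>\<^sub>F x in at_top. 0 \<le> r powr x / f x"
      using rv_pos[OF f] by (auto intro!: always_eventually divide_nonneg_pos)
    show "\<forall>\<^sub>F x in at_top. r powr x / f x \<le> x ^ p * r powr x / c"
      using eventually_ge_at_top[of 1]
    proof eventually_elim
      case (elim x)
      have "r powr x * c \<le> r powr x * (x ^ p * f x)" using c(2)[OF elim] by (intro mult_left_mono) auto
      then show ?case using rv_pos[OF f, of x] c(1) by (simp add: field_simps)
    qed
  qed
qed

text \<open>\<open>U\<close> plays the integral of \<open>f\<close> over the half-line beyond its
  argument, and only the bounds by monotonicity over an interval are assumed. Cut the half-line at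
  the points \<open>c ^ j * x\<close>: by regular variation the contributions of consecutive blocks
  shrink by a factor between \<open>c powr (1 - a) - e\<close> and
  \<open>c powr (1 - a) + e\<close>, so geometric series bound the total. The lower bound has the
  extra factor because a block is estimated there by its right endpoint.\<close>

lemma karamata_block:
  assumes f: "rv f a"
    and U: "\<And>x y. 0 \<le> x \<Longrightarrow> x \<le> y \<Longrightarrow> (y - x) * f y \<le> U x - U y"
      "\<And>x y. 0 \<le> x \<Longrightarrow> x \<le> y \<Longrightarrow> U x - U y \<le> (y - x) * f x"
    and U0: "(U \<longlongrightarrow> 0) at_top"
    and c: "1 < c" and e: "0 < e" "e < c powr (1 - a)" "c powr (1 - a) + e < 1"
  shows "\<forall>\<^sub>F x in at_top. (c - 1) / c * (c powr (1 - a) - e) / (1 - (c powr (1 - a) - e)) \<le> U x / (x * f x) \<and>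
            U x / (x * f x) \<le> (c - 1) / (1 - (c powr (1 - a) + e))"
proof -
  define s where "s = c powr (1 - a) + e"
  define s' where "s' = c powr (1 - a) - e"
  have s: "0 < s" "s < 1" "0 < s'" "s' < 1" using e c unfolding s_def s'_def by auto
  have cc: "c * c powr (- a) = c powr (1 - a)" using c by (simp add: powr_diff powr_minus field_simps)
  have lim: "((\<lambda>x. c * (f (c * x) / f x)) \<longlongrightarrow> c powr (1 - a)) at_top"
    unfolding cc[symmetric] using c by (intro tendsto_intros rv_lim[OF f]) auto
  have "\<forall>\<^sub>F x in at_top. c * (f (c * x) / f x) < s" "\<forall>\<^sub>F x in at_top. s' < c * (f (c * x) / f x)"
    using order_tendstoD(2)[OF lim, of s] order_tendstoD(1)[OF lim, of s'] e by (auto simp: s_def s'_def)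
  then have "\<forall>\<^sub>F x in at_top. c * (f (c * x) / f x) < s \<and> s' < c * (f (c * x) / f x)"
    by eventually_elim auto
  then obtain X where X: "\<And>x. x \<ge> X \<Longrightarrow> c * (f (c * x) / f x) < s \<and> s' < c * (f (c * x) / f x)"
    by (auto simp: eventually_at_top_linorder)
  have X': "c * f (c * x) \<le> s * f x" "s' * f x \<le> c * f (c * x)" if "x \<ge> X" for x
    using X[OF that] rv_pos[OF f, of x] by (auto simp: field_simps)
  show ?thesis
    using eventually_ge_at_top[of X] eventually_gt_at_top[of 0]
  proof eventually_elim
    case (elim x)
    have ge: "c ^ j * x \<ge> X" for j
    proof -
      have "1 * x \<le> c ^ j * x" using c elim by (intro mult_right_mono one_le_power) auto
      then show ?thesis using elim by linarith
    qed
    have it: "c ^ j * f (c ^ j * x) \<le> s ^ j * f x \<and> s' ^ j * f x \<le> c ^ j * f (c ^ j * x)" for j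
    proof (induction j)
      case (Suc j)
      have "c ^ Suc j * f (c ^ Suc j * x) = c ^ j * (c * f (c * (c ^ j * x)))" by (simp add: mult_ac)
      also have "\<dots> \<le> c ^ j * (s * f (c ^ j * x))" using c by (intro mult_left_mono X' ge) auto
      also have "\<dots> = s * (c ^ j * f (c ^ j * x))" by simp
      also have "\<dots> \<le> s * (s ^ j * f x)" using Suc s by (intro mult_left_mono) auto
      finally have 1: "c ^ Suc j * f (c ^ Suc j * x) \<le> s ^ Suc j * f x" by simp
      have "s' ^ Suc j * f x = s' * (s' ^ j * f x)" by simp
      also have "\<dots> \<le> s' * (c ^ j * f (c ^ j * x))" using Suc s by (intro mult_left_mono) auto
      also have "\<dots> = c ^ j * (s' * f (c ^ j * x))" by simp
      also have "\<dots> \<le> c ^ j * (c * f (c * (c ^ j * x)))" using c by (intro mult_left_mono X' ge) auto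
      also have "\<dots> = c ^ Suc j * f (c ^ Suc j * x)" by (simp add: mult_ac)
      finally show ?case using 1 by simp
    qed simp
    have mono: "c ^ j * x \<le> c ^ Suc j * x" for j
      using c elim by (intro mult_right_mono power_increasing) auto
    have tele: "U x - U (c ^ J * x) = (\<Sum>j<J. U (c ^ j * x) - U (c ^ Suc j * x))" for J
      by (subst sum_lessThan_telescope') simp
    have xf: "0 < x * f x" using elim rv_pos[OF f, of x] by simp
    have up: "U x - U (c ^ J * x) \<le> (c - 1) * (x * f x) * (\<Sum>j<J. s ^ j)" for J
    proof -
      have "U (c ^ j * x) - U (c ^ Suc j * x) \<le> (c - 1) * (x * f x) * s ^ j" for j
      proof -
        have "U (c ^ j * x) - U (c ^ Suc j * x) \<le> (c ^ Suc j * x - c ^ j * x) * f (c ^ j * x)"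
          using c elim mono by (intro U) auto
        also have "\<dots> = (c - 1) * x * (c ^ j * f (c ^ j * x))" by (simp add: algebra_simps)
        also have "\<dots> \<le> (c - 1) * x * (s ^ j * f x)" using it c elim by (intro mult_left_mono) auto
        finally show ?thesis by (simp add: mult_ac)
      qed
      then show ?thesis unfolding tele sum_distrib_left by (intro sum_mono) auto
    qed
    have lo: "(c - 1) / c * s' * (x * f x) * (\<Sum>j<J. s' ^ j) \<le> U x - U (c ^ J * x)" for J
    proof -
      have "(c - 1) / c * s' * (x * f x) * s' ^ j \<le> U (c ^ j * x) - U (c ^ Suc j * x)" for j
      proof -
        have "(c - 1) / c * s' * (x * f x) * s' ^ j = (c - 1) / c * x * (s' ^ Suc j * f x)" by (simp add: mult_ac)
        also have "\<dots> \<le> (c - 1) / c * x * (c ^ Suc j * f (c ^ Suc j * x))"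
          using it[of "Suc j"] c elim by (intro mult_left_mono) auto
        also have "\<dots> = (c ^ Suc j * x - c ^ j * x) * f (c ^ Suc j * x)"
          using c by (simp add: field_simps)
        also have "\<dots> \<le> U (c ^ j * x) - U (c ^ Suc j * x)" using c elim mono by (intro U) auto
        finally show ?thesis .
      qed
      then show ?thesis unfolding tele sum_distrib_left by (intro sum_mono) auto
    qed
    have "filterlim (\<lambda>J. c ^ J * x) at_top sequentially"
      using c elim by real_asymp
    then have "((\<lambda>J. U (c ^ J * x)) \<longlonglongrightarrow> 0)" by (rule filterlim_compose[OF U0])
    then have L: "(\<lambda>J. U x - U (c ^ J * x)) \<longlonglongrightarrow> U x - 0" by (intro tendsto_intros)
    have g: "(\<lambda>J. \<Sum>j<J. s ^ j) \<longlonglongrightarrow> 1 / (1 - s)" "(\<lambda>J. \<Sum>j<J. s' ^ j) \<longlonglongrightarrow> 1 / (1 - s')"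
      using geometric_sums[of s] geometric_sums[of s'] s by (auto simp: sums_def)
    have "U x - 0 \<le> (c - 1) * (x * f x) * (1 / (1 - s))"
      by (rule LIMSEQ_le[OF L tendsto_mult[OF tendsto_const g(1)]]) (use up in auto)
    moreover have "(c - 1) / c * s' * (x * f x) * (1 / (1 - s')) \<le> U x - 0"
      by (rule LIMSEQ_le[OF tendsto_mult[OF tendsto_const g(2)] L]) (use lo in auto)
    ultimately show ?case using xf s c unfolding s_def[symmetric] s'_def[symmetric]
      by (simp add: divide_simps mult_ac)
  qed
qed

text \<open>Let c decrease to 1. As \<open>1 - c powr (1 - a)\<close> is of order
  \<open>(a - 1) * (c - 1)\<close>, the tolerance \<open>e = (c - 1)^2\<close> is of smaller order
  and both block bounds tend to \<open>1 / (a - 1)\<close>.\<close>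

theorem karamata:
  assumes f: "rv f a" and a: "1 < a"
    and U: "\<And>x y. 0 \<le> x \<Longrightarrow> x \<le> y \<Longrightarrow> (y - x) * f y \<le> U x - U y"
      "\<And>x y. 0 \<le> x \<Longrightarrow> x \<le> y \<Longrightarrow> U x - U y \<le> (y - x) * f x"
    and U0: "(U \<longlongrightarrow> 0) at_top"
  shows "((\<lambda>x. U x / (x * f x)) \<longlongrightarrow> 1 / (a - 1)) at_top"
proof -
  define lo where "lo = (\<lambda>c. (c - 1) / c * (c powr (1 - a) - (c - 1)\<^sup>2) / (1 - (c powr (1 - a) - (c - 1)\<^sup>2)))"
  define hi where "hi = (\<lambda>c. (c - 1) / (1 - (c powr (1 - a) + (c - 1)\<^sup>2)))"
  have "\<forall>\<^sub>F c in at_right 1. (c - 1)\<^sup>2 < c powr (1 - a) \<and> c powr (1 - a) + (c - 1)\<^sup>2 < 1 \<and> 1 < c \<and> 0 < (c - 1)\<^sup>2"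
    using a by (intro eventually_conj) real_asymp+
  then have block: "\<forall>\<^sub>F c in at_right 1. \<forall>\<^sub>F x in at_top. lo c \<le> U x / (x * f x) \<and> U x / (x * f x) \<le> hi c"
  proof eventually_elim
    case (elim c)
    show ?case unfolding lo_def hi_def by (rule karamata_block[OF f _ _ U0]) (use U elim in auto)
  qed
  have inv: "inverse (a - 1) = 1 / (a - 1)" by (simp add: divide_inverse)
  have lim: "(lo \<longlongrightarrow> 1 / (a - 1)) (at_right 1)" "(hi \<longlongrightarrow> 1 / (a - 1)) (at_right 1)"
    unfolding inv[symmetric] lo_def hi_def using a by real_asymp+
  show ?thesis
  proof (rule order_tendstoI)
    fix y assume "1 / (a - 1) < y"
    then have "\<forall>\<^sub>F c in at_right 1. hi c < y" by (rule order_tendstoD(2)[OF lim(2)])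
    from eventually_happens'[OF trivial_limit_at_right_real eventually_conj[OF this block]]
    show "\<forall>\<^sub>F x in at_top. U x / (x * f x) < y" by (auto elim!: eventually_mono)
  next
    fix y assume "y < 1 / (a - 1)"
    then have "\<forall>\<^sub>F c in at_right 1. y < lo c" by (rule order_tendstoD(1)[OF lim(1)])
    from eventually_happens'[OF trivial_limit_at_right_real eventually_conj[OF this block]]
    show "\<forall>\<^sub>F x in at_top. y < U x / (x * f x)" by (auto elim!: eventually_mono)
  qed
qed


subsection \<open>Expectations\<close>

abbreviation expect :: "'a pmf \<Rightarrow> ('a \<Rightarrow> real) \<Rightarrow> real" where
  "expect p f \<equiv> measure_pmf.expectation p f"

abbreviation prb :: "'a pmf \<Rightarrow> 'a set \<Rightarrow> real" where
  "prb p A \<equiv> measure_pmf.prob p A"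

lemma integrable_pmf_bdd:
  fixes f :: "'a \<Rightarrow> real"
  assumes "\<And>x. \<bar>f x\<bar> \<le> c"
  shows "integrable (measure_pmf p) f"
  by (rule measure_pmf.integrable_const_bound[where B = c]) (use assms in auto)

text \<open>Transferred from the nonnegative integral, where the bind rule is unconditional. Values
  in [0, 1] make every integrability condition automatic and suffice for probabilities and
  generating functions.\<close>

lemma expectation_bind_pmf:
  fixes f :: "'b \<Rightarrow> real"
  assumes "\<And>x. 0 \<le> f x" "\<And>x. f x \<le> 1"
  shows "expect (bind_pmf p k) f = expect p (\<lambda>x. expect (k x) f)"
proof -
  have i: "integrable (measure_pmf r) f" for r :: "'b pmf"
    using assms by (intro integrable_pmf_bdd[of _ 1]) auto
  have b: "0 \<le> expect r f" "expect r f \<le> 1" for r :: "'b pmf"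
    using assms measure_pmf.integral_le_const[OF i, of 1] by (auto intro!: Bochner_Integration.integral_nonneg)
  have j: "integrable (measure_pmf p) (\<lambda>x. expect (k x) f)"
    using b by (intro integrable_pmf_bdd[of _ 1]) auto
  have "ennreal (expect (bind_pmf p k) f) = (\<integral>\<^sup>+x. f x \<partial>bind_pmf p k)"
    by (rule nn_integral_eq_integral[OF i, symmetric]) (use assms in auto)
  also have "\<dots> = (\<integral>\<^sup>+x. (\<integral>\<^sup>+y. f y \<partial>k x) \<partial>p)" by simp
  also have "\<dots> = (\<integral>\<^sup>+x. ennreal (expect (k x) f) \<partial>p)"
    by (intro nn_integral_cong nn_integral_eq_integral i) (use assms in auto)
  also have "\<dots> = ennreal (expect p (\<lambda>x. expect (k x) f))"
    by (rule nn_integral_eq_integral[OF j]) (use b in auto)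
  finally show ?thesis
    using b by (subst (asm) ennreal_inj) (auto intro!: Bochner_Integration.integral_nonneg)
qed

lemma measure_bind_pmf:
  "prb (bind_pmf p k) A = expect p (\<lambda>x. prb (k x) A)"
  using expectation_bind_pmf[of "indicator A" p k] by (simp add: indicator_le_1)

subsection \<open>Tails and sums\<close>

text \<open>The argument is real so that it can be scaled, shifted below 0 and compared with
  regularly varying functions.\<close>

definition tail :: "nat pmf \<Rightarrow> real \<Rightarrow> real" where
  "tail p x = prb p {n. x < real n}"

definition conv :: "nat pmf \<Rightarrow> nat pmf \<Rightarrow> nat pmf" where
  "conv p r = bind_pmf p (\<lambda>m. map_pmf ((+) m) r)"

primrec isum :: "nat \<Rightarrow> nat pmf \<Rightarrow> nat pmf" where
  "isum 0 p = return_pmf 0"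
| "isum (Suc k) p = conv p (isum k p)"

definition compound :: "nat pmf \<Rightarrow> nat pmf \<Rightarrow> nat pmf" where
  "compound K p = bind_pmf K (\<lambda>k. isum k p)"

lemma tail_nonneg [simp]: "0 \<le> tail p x" and tail_le_1 [simp]: "tail p x \<le> 1"
  by (auto simp: tail_def)

lemma tail_antimono: "x \<le> y \<Longrightarrow> tail p y \<le> tail p x"
  unfolding tail_def by (intro measure_pmf.finite_measure_mono) auto

lemma tail_neg: "x < 0 \<Longrightarrow> tail p x = 1"
proof -
  assume "x < 0"
  then have "{n. x < real n} = UNIV" by auto
  then show ?thesis by (simp add: tail_def)
qed

lemma tail_return_0: "0 \<le> x \<Longrightarrow> tail (return_pmf 0) x = 0"
  by (simp add: tail_def indicator_def)

lemma tail_altdef: "tail p x = expect p (\<lambda>n. if x < real n then 1 else 0)"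
proof -
  have "(\<lambda>n. if x < real n then 1 else 0) = (indicator {n. x < real n} :: nat \<Rightarrow> real)"
    by (auto simp: indicator_def)
  then show ?thesis by (simp add: tail_def)
qed

lemma tail_conv: "tail (conv p r) x = expect p (\<lambda>m. tail r (x - real m))"
proof -
  have "((+) m) -` {n. x < real n} = {n. x - real m < real n}" for m by auto
  then show ?thesis unfolding tail_def conv_def measure_bind_pmf by simp
qed

lemma integrable_if [simp]:
  "integrable (measure_pmf p) (\<lambda>n. if P n then c else d :: real)"
  by (auto intro!: integrable_pmf_bdd[of _ "max \<bar>c\<bar> \<bar>d\<bar>"])

lemma integrable_tail [simp]: "integrable (measure_pmf p) (\<lambda>m. tail (r m) (f m))"
  by (auto intro!: integrable_pmf_bdd[of _ 1])

lemma conv_commute: "conv p r = conv r p"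
proof -
  have "conv p r = bind_pmf p (\<lambda>m. bind_pmf r (\<lambda>n. return_pmf (m + n)))" for p r
    by (simp add: conv_def map_pmf_def)
  then show ?thesis using bind_commute_pmf[of p r "\<lambda>m n. return_pmf (m + n)"] by (simp add: add.commute)
qed

lemma tail_conv_ge: "tail r x \<le> tail (conv p r) x"
proof -
  have "expect p (\<lambda>m. tail r x) \<le> expect p (\<lambda>m. tail r (x - real m))"
    by (rule integral_mono) (auto intro: tail_antimono)
  then show ?thesis by (simp add: tail_conv)
qed

lemma tail_conv_union: "tail (conv p r) (x + y) \<le> tail p x + tail r y"
proof -
  have "tail (conv p r) (x + y) \<le> expect p (\<lambda>m. (if x < real m then 1 else 0) + tail r y)"
    unfolding tail_conv by (rule integral_mono) (auto intro: tail_antimono intro: order_trans[OF tail_le_1])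
  then show ?thesis by (simp add: tail_altdef[symmetric])
qed

text \<open>Inclusion and exclusion: the sum exceeds x as soon as one of the two independent
  summands does.\<close>

lemma tail_conv_lower:
  assumes "0 \<le> x" shows "tail p x + tail r x - tail p x * tail r x \<le> tail (conv p r) x"
proof -
  have "expect p (\<lambda>m. (1 - tail r x) * (if x < real m then 1 else 0) + tail r x) \<le> tail (conv p r) x"
    unfolding tail_conv
  proof (rule integral_mono)
    fix m show "(1 - tail r x) * (if x < real m then 1 else 0) + tail r x \<le> tail r (x - real m)"
      by (auto simp: tail_neg intro: tail_antimono)
  qed auto
  then show ?thesis by (simp add: tail_altdef[symmetric] algebra_simps)
qed

text \<open>If neither summand exceeds \<open>(1 - d) * x\<close> but the sum exceeds x, then both
  exceed \<open>d * x\<close>. The product term is of second order.\<close>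

lemma tail_conv_upper:
  "tail (conv p r) x \<le> tail p ((1 - d) * x) + tail r ((1 - d) * x) + tail p (d * x) * tail r (d * x)"
proof -
  have "tail (conv p r) x \<le> expect p (\<lambda>m. (if (1 - d) * x < real m then 1 else 0)
     + tail r ((1 - d) * x) + (if d * x < real m then 1 else 0) * tail r (d * x))"
    unfolding tail_conv
  proof (rule integral_mono)
    fix m
    consider "(1 - d) * x < real m" | "real m \<le> (1 - d) * x" "real m \<le> d * x"
      | "real m \<le> (1 - d) * x" "d * x < real m" by linarith
    then show "tail r (x - real m) \<le> (if (1 - d) * x < real m then 1 else 0)
     + tail r ((1 - d) * x) + (if d * x < real m then 1 else 0) * tail r (d * x)"
    proof cases
      case 1
      have "0 \<le> (if d * x < real m then 1 else 0) * tail r (d * x)" by simp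
      moreover have "(if (1 - d) * x < real m then 1 else 0) = (1::real)" using 1 by simp
      ultimately show ?thesis using tail_le_1[of r "x - real m"] tail_nonneg[of r "(1 - d) * x"] by linarith
    next
      case 2
      then have "tail r (x - real m) \<le> tail r ((1 - d) * x)" by (intro tail_antimono) (auto simp: algebra_simps)
      then show ?thesis using 2 by auto
    next
      case 3
      then have "tail r (x - real m) \<le> tail r (d * x)" by (intro tail_antimono) (auto simp: algebra_simps)
      then show ?thesis using 3 by (simp add: add_increasing)
    qed
  qed auto
  also have "\<dots> = tail p ((1 - d) * x) + tail r ((1 - d) * x) + tail p (d * x) * tail r (d * x)"
    by (simp add: tail_altdef[symmetric])
  finally show ?thesis .
qed

lemma tail_isum_mono: "k \<le> l \<Longrightarrow> tail (isum k p) x \<le> tail (isum l p) x"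
  by (induction l rule: dec_induct) (auto intro: order_trans tail_conv_ge)

lemma tail_isum_union: "0 \<le> x \<Longrightarrow> tail (isum k p) (real k * x) \<le> real k * tail p x"
proof (induction k)
  case (Suc k)
  have "tail (isum (Suc k) p) (real (Suc k) * x) \<le> tail p x + tail (isum k p) (real k * x)"
    using tail_conv_union[of p "isum k p" x "real k * x"] by (simp add: algebra_simps)
  also have "\<dots> \<le> tail p x + real k * tail p x" using Suc by simp
  finally show ?case by (simp add: algebra_simps)
qed (simp add: tail_return_0)

text \<open>
  The offset \<open>b\<close>, the part of the sum already seen, makes the induction over the number of
  summands go through.
\<close>

lemma hoffmann_jorgensen_offset:
  assumes "0 \<le> y" "real b \<le> x"
  shows "tail (isum k p) (2 * x + y - real b) \<le>
           real k * tail p y + tail (isum k p) (x - real b) * tail (isum k p) x"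
  using assms(2)
proof (induction k arbitrary: b)
  case 0
  then show ?case using assms by (simp add: tail_return_0)
next
  case (Suc k)
  have "tail (isum (Suc k) p) (2 * x + y - real b) \<le> expect p (\<lambda>j. real k * tail p y
     + (if y < real j then 1 else 0) + tail (isum k p) (x - real b - real j) * tail (isum k p) x)"
    unfolding isum.simps tail_conv
  proof (rule integral_mono)
    fix j :: nat
    have nn: "0 \<le> tail (isum k p) (x - real b - real j) * tail (isum k p) x" "0 \<le> real k * tail p y" by auto
    \<comment> \<open>Either the partial sum stays below x and the induction hypothesis applies with
      the larger offset, or the new summand is large, or level x is crossed with an overshoot of at
      most y. In the last case the remaining summands must still exceed \<open>2 * x - b\<close>,
      which is at least x.\<close>
    consider "b + j \<le> x" | "y < real j" | "x < b + j" "real j \<le> y" by linarith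
    then show "tail (isum k p) (2 * x + y - real b - real j) \<le> real k * tail p y
     + (if y < real j then 1 else 0) + tail (isum k p) (x - real b - real j) * tail (isum k p) x"
    proof cases
      case 1
      then show ?thesis using Suc.IH[of "b + j"] by (simp add: algebra_simps)
    next
      case 2
      then have "(if y < real j then 1 else 0) = (1::real)" by simp
      then show ?thesis using nn tail_le_1[of "isum k p" "2 * x + y - real b - real j"] by linarith
    next
      case 3
      then have "tail (isum k p) (x - real b - real j) = 1" by (intro tail_neg) auto
      moreover have "tail (isum k p) (2 * x + y - real b - real j) \<le> tail (isum k p) x"
        using 3 Suc.prems by (intro tail_antimono) auto
      ultimately show ?thesis by (simp add: add_increasing)
    qed
  qed auto
  also have "\<dots> = real (Suc k) * tail p y + tail (isum (Suc k) p) (x - real b) * tail (isum k p) x"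
    by (simp add: tail_altdef[symmetric] tail_conv algebra_simps)
  also have "\<dots> \<le> real (Suc k) * tail p y + tail (isum (Suc k) p) (x - real b) * tail (isum (Suc k) p) x"
    using tail_isum_mono[of k "Suc k" p x] by (intro add_left_mono mult_left_mono) (auto simp del: isum.simps)
  finally show ?case .
qed

text \<open>Without a summand above y, the sum must climb x twice, over disjoint groups of summands;
  the resulting square is what improves a weak bound on sums to a better one.\<close>

lemma hoffmann_jorgensen:
  assumes "0 \<le> y" "0 \<le> x"
  shows "tail (isum k p) (2 * x + y) \<le> real k * tail p y + (tail (isum k p) x)\<^sup>2"
  using hoffmann_jorgensen_offset[of y 0 x k p] assms by (simp add: power2_eq_square)


subsection \<open>Means\<close>

text \<open>Extended real values, because the mean of the progeny law \<open>N\<close> is known to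
  be finite only after its tail has been bounded.\<close>

definition nnmean :: "nat pmf \<Rightarrow> ennreal" where
  "nnmean p = (\<integral>\<^sup>+n. ennreal (real n) \<partial>p)"

lemma nnmean_conv: "nnmean (conv p r) = nnmean p + nnmean r"
proof -
  have "nnmean (conv p r) = (\<integral>\<^sup>+m. (\<integral>\<^sup>+n. ennreal (real m) + ennreal (real n) \<partial>r) \<partial>p)"
    by (simp add: nnmean_def conv_def)
  also have "\<dots> = nnmean p + nnmean r"
    by (simp add: nn_integral_add nnmean_def)
  finally show ?thesis .
qed

lemma nnmean_isum: "nnmean (isum k p) = of_nat k * nnmean p"
  by (induction k) (auto simp: nnmean_conv nnmean_def[of "return_pmf 0"] algebra_simps)

lemma nnmean_compound: "nnmean (compound K p) = nnmean K * nnmean p"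
proof -
  have "nnmean (compound K p) = (\<integral>\<^sup>+k. nnmean (isum k p) \<partial>K)" by (simp add: nnmean_def compound_def)
  also have "\<dots> = (\<integral>\<^sup>+k. ennreal (real k) * nnmean p \<partial>K)" by (simp add: nnmean_isum ennreal_of_nat_eq_real_of_nat)
  also have "\<dots> = nnmean K * nnmean p" by (simp add: nn_integral_multc nnmean_def)
  finally show ?thesis .
qed

lemma nnmean_eq_ennreal:
  assumes "nnmean p = ennreal m" "0 \<le> m"
  shows "integrable (measure_pmf p) real" "expect p real = m"
  using assms nn_integral_eq_integrable[of real "measure_pmf p" m] by (auto simp: nnmean_def)

lemma tail_markov:
  assumes "nnmean p \<le> ennreal B" "0 < x" "0 \<le> B"
  shows "tail p x \<le> B / x"
proof -
  have "ennreal (x * tail p x) = (\<integral>\<^sup>+n. ennreal (x * (if x < real n then 1 else 0)) \<partial>p)"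
    unfolding tail_altdef using assms
    by (subst nn_integral_eq_integral) (auto intro!: integrable_pmf_bdd[of _ x])
  also have "\<dots> \<le> nnmean p" unfolding nnmean_def by (intro nn_integral_mono) auto
  also have "\<dots> \<le> ennreal B" by fact
  finally have "x * tail p x \<le> B" using assms by (simp add: ennreal_le_iff)
  then show ?thesis using assms by (simp add: field_simps)
qed

lemma tail_isum_markov:
  assumes "nnmean p \<le> 1" "0 < x" shows "tail (isum k p) x \<le> real k / x"
proof (rule tail_markov)
  have "nnmean (isum k p) \<le> of_nat k * 1" unfolding nnmean_isum using assms by (intro mult_left_mono) auto
  then show "nnmean (isum k p) \<le> ennreal (real k)" by (simp add: ennreal_of_nat_eq_real_of_nat)
qed (use assms in auto)

text \<open>By induction on r: in the square from \<open>hoffmann_jorgensen\<close> one factor is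
  estimated by Markov's inequality, of order k / s, the other by the induction hypothesis, so the
  power of k / s rises by one. The constants do not depend on the law p; this uniformity is needed
  when p runs through the generations of the branching process.\<close>

lemma tail_isum_polynomial:
  obtains D c where "0 \<le> D" "0 < c" "c \<le> 1"
    "\<And>p k s. nnmean p \<le> 1 \<Longrightarrow> 0 < s \<Longrightarrow> tail (isum k p) s \<le> D * (real k * tail p (c * s) + (real k / s) ^ r)"
proof -
  have "\<exists>D c. 0 \<le> D \<and> 0 < c \<and> c \<le> 1 \<and> (\<forall>p k s. nnmean p \<le> 1 \<longrightarrow> 0 < s \<longrightarrow>
     tail (isum k p) s \<le> D * (real k * tail p (c * s) + (real k / s) ^ r))"
  proof (induction r)
    case 0
    show ?case
    proof (intro exI[of _ 1] conjI allI impI)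
      fix p :: "nat pmf" and k :: nat and s :: real
      show "tail (isum k p) s \<le> 1 * (real k * tail p (1 * s) + (real k / s) ^ 0)"
        by (rule order_trans[OF tail_le_1]) simp
    qed auto
  next
    case (Suc r)
    then obtain D c where D: "0 \<le> D" "0 < c" "c \<le> 1"
      and b: "\<And>p k s. nnmean p \<le> 1 \<Longrightarrow> 0 < s \<Longrightarrow> tail (isum k p) s \<le> D * (real k * tail p (c * s) + (real k / s) ^ r)"
      by blast
    show ?case
    proof (rule exI[of _ "1 + 3 * D + D * 3 ^ Suc r"], rule exI[of _ "c / 3"], intro conjI allI impI)
      fix p :: "nat pmf" and k :: nat and s :: real
      assume p: "nnmean p \<le> 1" and s: "0 < s"
      let ?D = "1 + 3 * D + D * 3 ^ Suc r"
      show "tail (isum k p) s \<le> ?D * (real k * tail p (c / 3 * s) + (real k / s) ^ Suc r)"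
      \<comment> \<open>For k > s the right-hand side is at least 1. For k \<le> s the Markov factor
        is at most 3 and is absorbed into the constant of the single-summand term.\<close>
      proof (cases "real k \<le> s")
        case False
        then have "1 \<le> (real k / s) ^ Suc r" using s by (intro one_le_power) (auto simp: field_simps)
        then have "1 \<le> real k * tail p (c / 3 * s) + (real k / s) ^ Suc r"
          by (intro add_increasing) simp_all
        moreover have "1 \<le> ?D" using D by simp
        ultimately have "1 * 1 \<le> ?D * (real k * tail p (c / 3 * s) + (real k / s) ^ Suc r)"
          by (intro mult_mono) linarith+
        then show ?thesis using tail_le_1[of "isum k p" s] by linarith
      next
        case True
        have "(tail (isum k p) (s / 3))\<^sup>2 \<le> (real k / (s / 3)) * (D * (real k * tail p (c * (s / 3)) + (real k / (s / 3)) ^ r))"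
          unfolding power2_eq_square using p s by (intro mult_mono tail_isum_markov b) auto
        also have "\<dots> = D * (3 * (real k / s)) * (real k * tail p (c / 3 * s)) + D * 3 ^ Suc r * (real k / s) ^ Suc r"
          using s by (simp add: field_simps power_mult_distrib)
        also have "\<dots> \<le> D * (3 * 1) * (real k * tail p (c / 3 * s)) + D * 3 ^ Suc r * (real k / s) ^ Suc r"
          using True s D by (intro add_right_mono mult_right_mono mult_left_mono) auto
        finally have 1: "(tail (isum k p) (s / 3))\<^sup>2 \<le> 3 * D * (real k * tail p (c / 3 * s)) + D * 3 ^ Suc r * (real k / s) ^ Suc r"
          by simp
        have "tail p (s / 3) \<le> tail p (c / 3 * s)" using D s by (intro tail_antimono) auto
        then have 2: "real k * tail p (s / 3) \<le> real k * tail p (c / 3 * s)" by (intro mult_left_mono) auto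
        have DD: "1 + 3 * D \<le> ?D" "D * 3 ^ Suc r \<le> ?D" using D by simp_all
        have "tail (isum k p) s \<le> real k * tail p (s / 3) + (tail (isum k p) (s / 3))\<^sup>2"
          using hoffmann_jorgensen[of "s / 3" "s / 3" k p] s by simp
        also have "\<dots> \<le> (1 + 3 * D) * (real k * tail p (c / 3 * s)) + D * 3 ^ Suc r * (real k / s) ^ Suc r"
          using 1 2 by (simp add: algebra_simps)
        also have "\<dots> \<le> ?D * (real k * tail p (c / 3 * s)) + ?D * (real k / s) ^ Suc r"
          using s DD by (intro add_mono[OF mult_right_mono mult_right_mono]) simp_all
        finally show ?thesis by (simp add: distrib_left)
      qed
    qed (use D in \<open>auto intro!: add_nonneg_nonneg\<close>)
  qed
  then show ?thesis using that by blast
qed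


subsection \<open>Generating functions\<close>

definition pgf :: "nat pmf \<Rightarrow> real \<Rightarrow> real" where
  "pgf p z = expect p (\<lambda>n. z ^ n)"

lemma pgf_integrable [simp]: "0 \<le> z \<Longrightarrow> z \<le> 1 \<Longrightarrow> integrable (measure_pmf p) (\<lambda>n. z ^ n :: real)"
  by (intro integrable_pmf_bdd[of _ 1]) (auto simp: power_le_one)

lemma pgf_nonneg: "0 \<le> z \<Longrightarrow> 0 \<le> pgf p z"
  unfolding pgf_def by (intro Bochner_Integration.integral_nonneg) auto

lemma pgf_le_1: "0 \<le> z \<Longrightarrow> z \<le> 1 \<Longrightarrow> pgf p z \<le> 1"
  unfolding pgf_def by (intro measure_pmf.integral_le_const) (auto simp: power_le_one)

lemma pgf_1 [simp]: "pgf p 1 = 1"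
  by (simp add: pgf_def)

lemma pgf_return [simp]: "pgf (return_pmf k) z = z ^ k"
  by (simp add: pgf_def)

lemma pgf_bind:
  "0 \<le> z \<Longrightarrow> z \<le> 1 \<Longrightarrow> pgf (bind_pmf p k) z = expect p (\<lambda>x. pgf (k x) z)"
  unfolding pgf_def by (intro expectation_bind_pmf) (auto simp: power_le_one)

lemma pgf_conv: "0 \<le> z \<Longrightarrow> z \<le> 1 \<Longrightarrow> pgf (conv p r) z = pgf p z * pgf r z"
  unfolding conv_def by (subst pgf_bind) (auto simp: pgf_def power_add)

lemma pgf_isum: "0 \<le> z \<Longrightarrow> z \<le> 1 \<Longrightarrow> pgf (isum k p) z = pgf p z ^ k"
  by (induction k) (auto simp: pgf_conv)

lemma pgf_compound: "0 \<le> z \<Longrightarrow> z \<le> 1 \<Longrightarrow> pgf (compound K p) z = pgf K (pgf p z)"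
  unfolding compound_def by (subst pgf_bind) (auto simp: pgf_isum pgf_def[of K])

lemma expectation_sums:
  fixes f :: "nat \<Rightarrow> real"
  assumes "\<And>n. \<bar>f n\<bar> \<le> c"
  shows "(\<lambda>n. pmf p n * f n) sums expect p f"
proof -
  have i: "integrable (count_space UNIV) (\<lambda>n. pmf p n * f n)"
    using integrable_pmf_bdd[OF assms, of p] by (subst (asm) measure_pmf_eq_density, subst (asm) integrable_density) auto
  have "expect p f = integral\<^sup>L (count_space UNIV) (\<lambda>n. pmf p n * f n)"
    by (subst measure_pmf_eq_density, subst integral_density) auto
  then show ?thesis using sums_integral_count_space_nat[OF i] by simp
qed

lemma pgf_sums: "0 \<le> z \<Longrightarrow> z \<le> 1 \<Longrightarrow> (\<lambda>n. pmf p n * z ^ n) sums pgf p z"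
  unfolding pgf_def by (rule expectation_sums[of _ 1]) (auto simp: power_le_one)

text \<open>The generating functions are compared on [0, 1) only, so the coefficients are recovered
  from the right of 0: with the lower ones known to vanish, divide by \<open>z ^ n\<close> and let z
  tend to 0.\<close>

lemma powser_eq_0_right:
  fixes a :: "nat \<Rightarrow> real"
  assumes "\<And>z. 0 \<le> z \<Longrightarrow> z < 1 \<Longrightarrow> (\<lambda>n. a n * z ^ n) sums 0"
  shows "a n = 0"
proof (induction n rule: less_induct)
  case (less n)
  have s: "(\<lambda>k. a (k + n) * z ^ k) sums 0" if "0 < z" "z < 1" for z
  proof -
    have "(\<lambda>k. a (k + n) * z ^ (k + n)) sums (0 - (\<Sum>i<n. a i * z ^ i))"
      using assms[of z] that by (subst sums_iff_shift') auto
    then have "(\<lambda>k. a (k + n) * z ^ (k + n)) sums 0" using less by simp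
    then have "(\<lambda>k. a (k + n) * z ^ (k + n) / z ^ n) sums (0 / z ^ n)" by (rule sums_divide)
    then show ?thesis using that by (simp add: power_add)
  qed
  have sm: "summable (\<lambda>k. a (k + n) * (1/2) ^ k)" using s[of "1/2"] by (auto simp: sums_iff)
  have "isCont (\<lambda>x. \<Sum>k. a (k + n) * x ^ k) 0"
    by (rule isCont_powser[OF sm]) auto
  then have "((\<lambda>x. \<Sum>k. a (k + n) * x ^ k) \<longlongrightarrow> (\<Sum>k. a (k + n) * 0 ^ k)) (at_right 0)"
    unfolding isCont_def by (rule filterlim_mono) (auto simp: at_le)
  moreover have "\<forall>\<^sub>F x in at_right 0. (\<Sum>k. a (k + n) * x ^ k) = 0"
    by (rule eventually_at_rightI[of 0 1]) (use s in \<open>auto simp: sums_iff\<close>)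
  ultimately have "((\<lambda>x::real. 0::real) \<longlongrightarrow> (\<Sum>k. a (k + n) * 0 ^ k)) (at_right 0)"
    by (rule Lim_transform_eventually)
  then have "(\<Sum>k. a (k + n) * 0 ^ k) = 0"
    by (rule tendsto_unique[OF trivial_limit_at_right_real _ tendsto_const])
  then show ?case by simp
qed

lemma pgf_pos: assumes "0 < z" "z \<le> 1" shows "0 < pgf p z"
proof -
  obtain n where n: "pmf p n > 0" using set_pmf_not_empty[of p] by (metis all_not_in_conv pmf_positive)
  have "0 < pmf p n * z ^ n" using n assms by simp
  also have "pmf p n * z ^ n = (\<Sum>i\<in>{n}. pmf p i * z ^ i)" by simp
  also have "\<dots> \<le> (\<Sum>i. pmf p i * z ^ i)"
    by (rule sum_le_suminf) (use pgf_sums[of z p] assms in \<open>auto simp: sums_iff\<close>)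
  also have "\<dots> = pgf p z" using pgf_sums[of z p] assms by (auto simp: sums_iff)
  finally show ?thesis .
qed


subsection \<open>The weak law of large numbers\<close>

lemma pgf_derivative_1:
  assumes m: "nnmean p = ennreal m" "0 \<le> m"
    and z: "z \<longlonglongrightarrow> 1" "\<And>i. 0 \<le> z i" "\<And>i. z i < 1"
  shows "(\<lambda>i. (1 - pgf p (z i)) / (1 - z i)) \<longlonglongrightarrow> m"
proof -
  note E = nnmean_eq_ennreal[OF m]
  have eq: "(1 - pgf p (z i)) / (1 - z i) = expect p (\<lambda>n. \<Sum>j<n. z i ^ j)" for i
  proof -
    have "(1 - pgf p (z i)) / (1 - z i) = expect p (\<lambda>n. (1 - z i ^ n) / (1 - z i))"
      unfolding pgf_def using z(2,3)[of i] by (simp add: less_imp_le)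
    also have "(\<lambda>n. (1 - z i ^ n) / (1 - z i)) = (\<lambda>n. \<Sum>j<n. z i ^ j)"
      using z(3)[of i] by (auto simp: one_diff_power_eq)
    finally show ?thesis .
  qed
  have "(\<lambda>i. expect p (\<lambda>n. \<Sum>j<n. z i ^ j)) \<longlonglongrightarrow> expect p real"
  proof (rule integral_dominated_convergence[where w = real])
    show "AE n in measure_pmf p. (\<lambda>i. \<Sum>j<n. z i ^ j) \<longlonglongrightarrow> real n"
    proof (rule AE_I2)
      fix n
      have "(\<lambda>i. \<Sum>j<n. z i ^ j) \<longlonglongrightarrow> (\<Sum>j<n. 1 ^ j)" by (intro tendsto_intros z)
      then show "(\<lambda>i. \<Sum>j<n. z i ^ j) \<longlonglongrightarrow> real n" by simp
    qed
    show "AE n in measure_pmf p. norm (\<Sum>j<n. z i ^ j) \<le> real n" for i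
    proof (rule AE_I2)
      fix n
      have "\<bar>\<Sum>j<n. z i ^ j\<bar> \<le> (\<Sum>j<n. 1)"
        by (rule order_trans[OF sum_abs]) (intro sum_mono, use z(2,3)[of i] in \<open>auto simp: power_le_one\<close>)
      then show "norm (\<Sum>j<n. z i ^ j) \<le> real n" by simp
    qed
  qed (use E in auto)
  then show ?thesis unfolding eq using E by simp
qed

text \<open>A Chernoff bound from a first moment alone. At 1 the generating function has slope m and
  \<open>w powr y\<close> the smaller slope y, so some w below 1 satisfies
  \<open>pgf p w < w powr y\<close>; the deviation probability is then at most the k-th power of
  their ratio.\<close>

lemma lln_lower:
  assumes m: "nnmean p = ennreal m" and y: "0 < y" "y < m"
  shows "(\<lambda>k. tail (isum k p) (y * real k)) \<longlonglongrightarrow> 1"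
proof -
  define z where "z = (\<lambda>i::nat. 1 - 1 / (real i + 2))"
  have z: "z \<longlonglongrightarrow> 1" "\<And>i. 0 < z i" "\<And>i. z i < 1"
    unfolding z_def by real_asymp (auto simp: field_simps)
  have "(\<lambda>i. (1 - pgf p (z i)) / (1 - z i)) \<longlonglongrightarrow> m"
    using m y z by (intro pgf_derivative_1) (auto intro: less_imp_le)
  moreover have "(\<lambda>i. (1 - z i powr y) / (1 - z i)) \<longlonglongrightarrow> y"
    unfolding z_def using y by real_asymp
  ultimately have "(\<lambda>i. (1 - pgf p (z i)) / (1 - z i) - (1 - z i powr y) / (1 - z i)) \<longlonglongrightarrow> m - y"
    by (rule tendsto_diff)
  then have "\<forall>\<^sub>F i in sequentially. 0 < (1 - pgf p (z i)) / (1 - z i) - (1 - z i powr y) / (1 - z i)"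
    by (rule order_tendstoD(1)) (use y in auto)
  then obtain i where i: "0 < (1 - pgf p (z i)) / (1 - z i) - (1 - z i powr y) / (1 - z i)"
    by (auto simp: eventually_sequentially)
  define w where "w = z i"
  have w: "0 < w" "w < 1" using z by (auto simp: w_def)
  have "(1 - pgf p w) / (1 - w) - (1 - w powr y) / (1 - w) = (w powr y - pgf p w) / (1 - w)"
    by (simp add: diff_divide_distrib)
  then have "pgf p w < w powr y" using i w unfolding w_def[symmetric] by (simp add: zero_less_divide_iff)
  then have q: "0 \<le> pgf p w / w powr y" "pgf p w / w powr y < 1" using w by (auto simp: pgf_nonneg)
  have b: "1 - tail (isum k p) (y * real k) \<le> (pgf p w / w powr y) ^ k" for k
  proof -
    have "(1 - tail (isum k p) (y * real k)) * w powr (y * real k)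
        = expect (isum k p) (\<lambda>n. (1 - (if y * real k < real n then 1 else 0)) * w powr (y * real k))"
      by (simp add: tail_altdef)
    also have "\<dots> \<le> pgf (isum k p) w"
      unfolding pgf_def
    proof (rule integral_mono)
      fix n show "(1 - (if y * real k < real n then 1 else 0)) * w powr (y * real k) \<le> w ^ n"
      proof (cases "y * real k < real n")
        case False
        then have "w powr (y * real k) \<le> w powr (real n)" using w by (intro powr_mono') auto
        then show ?thesis using False w by (simp add: powr_realpow)
      qed (use w in auto)
    qed (use w in \<open>auto intro!: integrable_pmf_bdd[of _ "w powr (y * real k)"]\<close>)
    also have "\<dots> = pgf p w ^ k" using w by (simp add: pgf_isum)
    finally show ?thesis using w by (simp add: field_simps powr_powr[symmetric] powr_realpow power_divide)
  qed
  have "(\<lambda>k. 1 - (pgf p w / w powr y) ^ k) \<longlonglongrightarrow> 1 - 0"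
    by (intro tendsto_intros LIMSEQ_realpow_zero q)
  then have L: "(\<lambda>k. 1 - (pgf p w / w powr y) ^ k) \<longlonglongrightarrow> 1" by simp
  show ?thesis
  proof (rule tendsto_sandwich[OF _ _ L tendsto_const])
    show "\<forall>\<^sub>F k in sequentially. 1 - (pgf p w / w powr y) ^ k \<le> tail (isum k p) (y * real k)"
      using b by (intro always_eventually allI) (auto simp: algebra_simps)
  qed auto
qed

text \<open>Heavy-tailed summands have no exponential moments, so the upper deviation is deduced
  from the lower one: the mean of the sum is fixed at k m and low values are rare, so there is
  little expectation left for values above k y.\<close>

lemma lln_upper:
  assumes m: "nnmean p = ennreal m" and y: "0 < m" "m < y"
  shows "(\<lambda>k. tail (isum k p) (y * real k)) \<longlonglongrightarrow> 0"
proof (rule order_tendstoI)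
  fix e :: real assume e: "0 < e"
  \<comment> \<open>The allowed deficit per summand: below m, so that \<open>lln_lower\<close>
    applies at the level m - d, and at most half of the final tolerance e (y - m).\<close>
  define d where "d = min (m / 2) (e * (y - m) / 2)"
  have d: "0 < d" "d < m" "d \<le> e * (y - m) / 2" using y e by (auto simp: d_def)
  have b: "(y - m) * tail (isum k p) (y * real k) \<le> d + m * (1 - tail (isum k p) ((m - d) * real k))" if k: "0 < k" for k
  proof -
    have "nnmean (isum k p) = ennreal (real k * m)"
      unfolding nnmean_isum m using y by (simp add: ennreal_mult ennreal_of_nat_eq_real_of_nat)
    note E = nnmean_eq_ennreal[OF this]
    have "expect (isum k p) (\<lambda>n. (y - m) * real k * (if y * real k < real n then 1 else 0)) \<le>
       expect (isum k p) (\<lambda>n. real n - m * real k + d * real k +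
          m * real k * (1 - (if (m - d) * real k < real n then 1 else 0)))"
    proof (rule integral_mono)
      fix n show "(y - m) * real k * (if y * real k < real n then 1 else 0) \<le> real n - m * real k + d * real k +
          m * real k * (1 - (if (m - d) * real k < real n then 1 else 0))"
      proof (cases "y * real k < real n")
        case True
        moreover have "(m - d) * real k < y * real k" using d y k by (intro mult_strict_right_mono) auto
        moreover have "0 \<le> d * real k" using d by simp
        ultimately show ?thesis by (simp add: algebra_simps)
      next
        case False
        moreover have "0 \<le> m * real k" using y by simp
        ultimately show ?thesis using d by (simp add: algebra_simps)
      qed
    qed (use E y in \<open>auto intro!: integrable_pmf_bdd[of _ "(y - m) * real k"]\<close>)
    also have "\<dots> = d * real k + m * real k * (1 - tail (isum k p) ((m - d) * real k))"
      using E y by (simp add: tail_altdef)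
    finally have "real k * ((y - m) * tail (isum k p) (y * real k)) \<le> real k * (d + m * (1 - tail (isum k p) ((m - d) * real k)))"
      by (simp add: tail_altdef algebra_simps)
    then show ?thesis using k by simp
  qed
  have "(\<lambda>k. d + m * (1 - tail (isum k p) ((m - d) * real k))) \<longlonglongrightarrow> d + m * (1 - 1)"
    using d by (intro tendsto_intros lln_lower[OF m]) auto
  moreover have "d + m * (1 - 1) < e * (y - m)"
  proof -
    have "0 < e * (y - m)" using e y by simp
    then show ?thesis using d by simp
  qed
  ultimately have "\<forall>\<^sub>F k in sequentially. d + m * (1 - tail (isum k p) ((m - d) * real k)) < e * (y - m)"
    by (rule order_tendstoD(2))
  then show "\<forall>\<^sub>F k in sequentially. tail (isum k p) (y * real k) < e"
    using eventually_gt_at_top[of 0]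
  proof eventually_elim
    case (elim k)
    then have "(y - m) * tail (isum k p) (y * real k) < (y - m) * e" using b[of k] by (simp add: mult.commute)
    then show ?case using y by simp
  qed
qed (auto intro!: always_eventually less_le_trans[OF _ tail_nonneg])


section \<open>Tails measured against a regularly varying function\<close>

lemma tail_tendsto_0: "(tail p \<longlongrightarrow> 0) at_top"
proof -
  have "((\<lambda>x. expect p (\<lambda>n. if x < real n then 1 else 0 :: real)) \<longlongrightarrow>
     expect p (\<lambda>n. 0)) at_top"
  proof (rule integral_dominated_convergence_at_top[where w = "\<lambda>_. 1"])
    show "AE n in measure_pmf p. ((\<lambda>x. if x < real n then 1 else 0) \<longlongrightarrow> (0::real)) at_top"
    proof (rule AE_I2)
      fix n
      have "\<forall>\<^sub>F x in at_top. (if x < real n then 1 else 0) = (0::real)"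
        using eventually_ge_at_top[of "real n"] by eventually_elim auto
      then show "((\<lambda>x. if x < real n then 1 else 0) \<longlongrightarrow> (0::real)) at_top" by (rule tendsto_eventually)
    qed
  qed auto
  then show ?thesis unfolding tail_altdef[abs_def] by simp
qed

lemma tail_scaled_tendsto_0: "0 < c \<Longrightarrow> ((\<lambda>x. tail p (c * x)) \<longlongrightarrow> 0) at_top"
  by (rule filterlim_compose[OF tail_tendsto_0 filterlim_mult_at_top])

lemma tail_ratio_scale:
  assumes u: "rv u al" and lim: "((\<lambda>x. tail p x / u x) \<longlongrightarrow> g) at_top" and c: "0 < c"
  shows "((\<lambda>x. tail p (c * x) / u x) \<longlongrightarrow> g * c powr (- al)) at_top"
proof -
  have "((\<lambda>x. tail p (c * x) / u (c * x) * (u (c * x) / u x)) \<longlongrightarrow> g * c powr (- al)) at_top"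
    by (intro tendsto_mult rv_lim[OF u c] filterlim_compose[OF lim filterlim_mult_at_top[OF c]])
  moreover have "tail p (c * x) / u (c * x) * (u (c * x) / u x) = tail p (c * x) / u x" for x
    using rv_pos[OF u, of "c * x"] by simp
  ultimately show ?thesis by (simp only:)
qed

text \<open>The limit controls large x; below X a tail is at most 1 while \<open>u\<close> is at
  least \<open>u X\<close>.\<close>

lemma tail_ratio_bounded:
  assumes u: "rv u al" and lim: "((\<lambda>x. tail p x / u x) \<longlongrightarrow> g) at_top"
  obtains C where "0 < C" "\<And>x. 0 \<le> x \<Longrightarrow> tail p x \<le> C * u x"
proof -
  have "\<forall>\<^sub>F x in at_top. tail p x / u x < g + 1" by (rule order_tendstoD(2)[OF lim]) auto
  then obtain X where X: "\<And>x. x \<ge> X \<Longrightarrow> tail p x / u x < g + 1" by (auto simp: eventually_at_top_linorder)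
  define C where "C = max 1 (max (g + 1) (1 / u X))"
  have "tail p x \<le> C * u x" for x
  proof (cases "x \<ge> X")
    case True
    then have "tail p x \<le> (g + 1) * u x" using X[OF True] rv_pos[OF u, of x] by (simp add: field_simps)
    also have "\<dots> \<le> C * u x" using rv_pos[OF u, of x] by (intro mult_right_mono) (auto simp: C_def)
    finally show ?thesis .
  next
    case False
    have "tail p x \<le> 1" by simp
    also have "1 = (1 / u X) * u X" using rv_pos[OF u, of X] by simp
    also have "\<dots> \<le> C * u x"
      using False rv_pos[OF u] by (intro mult_mono rv_antimono[OF u]) (auto simp: C_def less_imp_le)
    finally show ?thesis .
  qed
  then show ?thesis by (intro that[of C]) (auto simp: C_def)
qed


subsection \<open>Light compounding\<close>

text \<open>The principle of a single big jump. The limits g and g' may be 0, so that lighter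
  factors of a convolution are treated by the same rule as the dominant one.\<close>

lemma tail_conv_ratio:
  assumes u: "rv u al"
    and p: "((\<lambda>x. tail p x / u x) \<longlongrightarrow> g) at_top"
    and r: "((\<lambda>x. tail r x / u x) \<longlongrightarrow> g') at_top"
  shows "((\<lambda>x. tail (conv p r) x / u x) \<longlongrightarrow> g + g') at_top"
proof (rule order_tendstoI)
  fix y assume y: "g + g' < y"
  have "((\<lambda>d. g * (1 - d) powr (- al) + g' * (1 - d) powr (- al)) \<longlongrightarrow>
      g * (1 - 0) powr (- al) + g' * (1 - 0) powr (- al)) (at_right 0)"
    by (intro tendsto_intros) auto
  then have "\<forall>\<^sub>F d in at_right 0. g * (1 - d) powr (- al) + g' * (1 - d) powr (- al) < y"
    by (rule order_tendstoD(2)) (use y in auto)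
  then obtain d where d: "g * (1 - d) powr (- al) + g' * (1 - d) powr (- al) < y" "0 < d" "d < 1" using at_right_0_witness by blast
  have "((\<lambda>x. tail p ((1 - d) * x) / u x + tail r ((1 - d) * x) / u x + tail p (d * x) / u x * tail r (d * x))
     \<longlongrightarrow> g * (1 - d) powr (- al) + g' * (1 - d) powr (- al) + g * d powr (- al) * 0) at_top"
    by (intro tendsto_add tendsto_mult tail_ratio_scale[OF u] p r tail_scaled_tendsto_0) (use d in auto)
  then have "\<forall>\<^sub>F x in at_top. tail p ((1 - d) * x) / u x + tail r ((1 - d) * x) / u x + tail p (d * x) / u x * tail r (d * x) < y"
    by (rule order_tendstoD(2)) (use d in auto)
  then show "\<forall>\<^sub>F x in at_top. tail (conv p r) x / u x < y"
  proof eventually_elim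
    case (elim x)
    have "tail (conv p r) x / u x \<le> (tail p ((1 - d) * x) + tail r ((1 - d) * x) + tail p (d * x) * tail r (d * x)) / u x"
      by (intro divide_right_mono tail_conv_upper) (simp add: less_imp_le rv_pos[OF u])
    then show ?case using elim by (simp add: add_divide_distrib)
  qed
next
  fix y assume y: "y < g + g'"
  have "((\<lambda>x. tail p x / u x + tail r x / u x - tail p x / u x * tail r x) \<longlongrightarrow> g + g' - g * 0) at_top"
    by (intro tendsto_intros p r tail_tendsto_0)
  then have "\<forall>\<^sub>F x in at_top. y < tail p x / u x + tail r x / u x - tail p x / u x * tail r x"
    by (rule order_tendstoD(1)) (use y in auto)
  then show "\<forall>\<^sub>F x in at_top. y < tail (conv p r) x / u x"
    using eventually_ge_at_top[of 0]
  proof eventually_elim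
    case (elim x)
    have "(tail p x + tail r x - tail p x * tail r x) / u x \<le> tail (conv p r) x / u x"
      using elim by (intro divide_right_mono tail_conv_lower) (simp_all add: less_imp_le rv_pos[OF u])
    then show ?case using elim by (simp add: add_divide_distrib diff_divide_distrib)
  qed
qed

lemma tail_isum_ratio:
  assumes u: "rv u al" and p: "((\<lambda>x. tail p x / u x) \<longlongrightarrow> g) at_top"
  shows "((\<lambda>x. tail (isum k p) x / u x) \<longlongrightarrow> real k * g) at_top"
proof (induction k)
  case 0
  have "\<forall>\<^sub>F x in at_top. tail (isum 0 p) x / u x = 0"
    using eventually_ge_at_top[of 0] by eventually_elim (simp add: tail_return_0)
  then show ?case by (simp add: tendsto_eventually)
next
  case (Suc k)
  show ?case using tail_conv_ratio[OF u p Suc] by (simp add: algebra_simps)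
qed

text \<open>Some summand exceeds x / k, and by \<open>rv_div_bound\<close> that costs only a power
  of k. This crude bound is integrable when the number of summands has all moments.\<close>

lemma tail_isum_bound:
  assumes u: "rv u al" and p: "((\<lambda>x. tail p x / u x) \<longlongrightarrow> g) at_top"
  obtains C j where "0 < C" "\<And>k x. 0 \<le> x \<Longrightarrow> tail (isum k p) x \<le> C * real k ^ j * u x"
proof -
  obtain C where C: "0 < C" "\<And>x. 0 \<le> x \<Longrightarrow> tail p x \<le> C * u x" using tail_ratio_bounded[OF u p] by blast
  obtain C' j where C': "0 < C'" "\<And>x k. 0 \<le> x \<Longrightarrow> 1 \<le> k \<Longrightarrow> u (x / real k) \<le> C' * real k ^ j * u x"
    using rv_div_bound[OF u] by blast
  have "tail (isum k p) x \<le> C * C' * real k ^ Suc j * u x" if x: "0 \<le> x" for k x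
  proof (cases k)
    case 0
    then show ?thesis using x by (simp add: tail_return_0)
  next
    case (Suc l)
    have "tail (isum k p) x = tail (isum k p) (real k * (x / real k))" using Suc by simp
    also have "\<dots> \<le> real k * tail p (x / real k)" using x by (intro tail_isum_union) auto
    also have "\<dots> \<le> real k * (C * (C' * real k ^ j * u x))"
      using Suc x C(1) by (intro mult_left_mono order_trans[OF C(2)] C') auto
    finally show ?thesis by (simp add: mult_ac)
  qed
  then show ?thesis using C C' by (intro that[of "C * C'" "Suc j"]) auto
qed

text \<open>Dominated convergence over the number of summands, with the polynomial bound of
  \<open>tail_isum_bound\<close> as majorant.\<close>

theorem tail_compound_light:
  assumes u: "rv u al" and p: "((\<lambda>x. tail p x / u x) \<longlongrightarrow> g) at_top"
    and moments: "\<And>j. integrable (measure_pmf K) (\<lambda>k. real k ^ j)"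
  shows "((\<lambda>x. tail (compound K p) x / u x) \<longlongrightarrow> expect K real * g) at_top"
proof -
  obtain C j where C: "0 < C" "\<And>k x. 0 \<le> x \<Longrightarrow> tail (isum k p) x \<le> C * real k ^ j * u x"
    using tail_isum_bound[OF u p] by blast
  have "((\<lambda>x. expect K (\<lambda>k. tail (isum k p) x / u x)) \<longlongrightarrow> expect K (\<lambda>k. real k * g)) at_top"
  proof (rule integral_dominated_convergence_at_top[where w = "\<lambda>k. C * real k ^ j"])
    show "integrable (measure_pmf K) (\<lambda>k. C * real k ^ j)" using moments by auto
    show "AE k in measure_pmf K. ((\<lambda>x. tail (isum k p) x / u x) \<longlongrightarrow> real k * g) at_top"
      by (rule AE_I2) (rule tail_isum_ratio[OF u p])
    show "\<forall>\<^sub>F x in at_top. AE k in measure_pmf K. norm (tail (isum k p) x / u x) \<le> C * real k ^ j"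
      using eventually_ge_at_top[of 0]
    proof eventually_elim
      case (elim x)
      show ?case
      proof (rule AE_I2)
        fix k
        show "norm (tail (isum k p) x / u x) \<le> C * real k ^ j"
          using C(2)[OF elim, of k] rv_pos[OF u, of x] by (simp add: field_simps)
      qed
    qed
  qed auto
  moreover have "tail (compound K p) x = expect K (\<lambda>k. tail (isum k p) x)" for x
    unfolding tail_def compound_def measure_bind_pmf ..
  ultimately show ?thesis by simp
qed


subsection \<open>Heavy-tailed number of summands\<close>

text \<open>An upper bound of Karamata type that uses doubling alone. Halving t multiplies the
  truncated power by \<open>1 / 2 ^ r\<close> up to the event that k exceeds t / 2, while the tail
  grows by a factor of at most D; the choice of r makes the recursion close.\<close>

lemma truncated_moment:
  assumes D: "1 \<le> D" "\<And>x. 0 \<le> x \<Longrightarrow> tail K x \<le> D * tail K (2 * x)" and r: "2 * D \<le> 2 ^ r" and t: "0 < t"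
  shows "expect K (\<lambda>k. min (real k / t) 1 ^ r) \<le> 2 * D * tail K t"
proof -
  have r0: "0 < r" using r D by (cases r) auto
  have i: "integrable (measure_pmf K) (\<lambda>k. min (real k / t) 1 ^ r)" if "0 < t" for t
    using that by (intro integrable_pmf_bdd[of _ 1]) (auto simp: power_le_one)
  \<comment> \<open>Induction over the dyadic scale of t. In the base case t < 1, every k of at
    least 1 exceeds t, and k = 0 contributes nothing because r is positive.\<close>
  have "0 < t \<Longrightarrow> t < 2 ^ n \<Longrightarrow> expect K (\<lambda>k. min (real k / t) 1 ^ r) \<le> 2 * D * tail K t" for n t
  proof (induction n arbitrary: t)
    case 0
    have "expect K (\<lambda>k. min (real k / t) 1 ^ r) \<le> expect K (\<lambda>k. if t < real k then 1 else 0)"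
    proof (rule integral_mono[OF i[OF 0(1)] integrable_if])
      fix k show "min (real k / t) 1 ^ r \<le> (if t < real k then 1 else 0)"
        using 0 r0 by (cases k) (auto simp: power_le_one power_0_left)
    qed
    also have "\<dots> = 1 * tail K t" by (simp add: tail_altdef)
    also have "\<dots> \<le> 2 * D * tail K t" using D by (intro mult_right_mono) auto
    finally show ?case .
  next
    case (Suc n)
    have "expect K (\<lambda>k. min (real k / t) 1 ^ r) \<le>
       expect K (\<lambda>k. (1 / 2 ^ r) * min (real k / (t / 2)) 1 ^ r + (if t / 2 < real k then 1 else 0))"
    proof (rule integral_mono)
      fix k show "min (real k / t) 1 ^ r \<le> (1 / 2 ^ r) * min (real k / (t / 2)) 1 ^ r + (if t / 2 < real k then 1 else 0)"
      proof (cases "t / 2 < real k")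
        case True
        have "min (real k / t) 1 ^ r \<le> 1" using Suc by (auto simp: power_le_one)
        moreover have "0 \<le> (1 / 2 ^ r) * min (real k / (t / 2)) 1 ^ r" using Suc by auto
        ultimately show ?thesis using True by auto
      next
        case False
        then have "min (real k / t) 1 = real k / t" "min (real k / (t / 2)) 1 = 2 * (real k / t)"
          using Suc by (auto simp: min_def field_simps)
        then show ?thesis using False by (simp only: power_mult_distrib) simp
      qed
    qed (use i[of t] i[of "t / 2"] Suc in auto)
    also have "\<dots> = (1 / 2 ^ r) * expect K (\<lambda>k. min (real k / (t / 2)) 1 ^ r) + tail K (t / 2)"
      using i[of "t / 2"] Suc by (simp add: tail_altdef)
    also have "\<dots> \<le> (1 / 2 ^ r) * (2 * D * tail K (t / 2)) + tail K (t / 2)"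
      using Suc by (intro add_right_mono mult_left_mono Suc.IH) auto
    also have "\<dots> = (2 * D / 2 ^ r + 1) * tail K (t / 2)" by (simp add: algebra_simps)
    also have "\<dots> \<le> 2 * tail K (t / 2)" using r by (intro mult_right_mono) (auto simp: field_simps)
    also have "\<dots> \<le> 2 * (D * tail K (2 * (t / 2)))" using Suc by (intro mult_left_mono D) auto
    finally show ?case by simp
  qed
  moreover obtain n where "t < 2 ^ n" using real_arch_pow[of 2 t] by auto
  ultimately show ?thesis using t by blast
qed

lemma truncated_mean_negligible:
  "((\<lambda>x. expect K (\<lambda>k. min (real k / x) 1)) \<longlongrightarrow> 0) at_top"
proof -
  have "((\<lambda>x. expect K (\<lambda>k. \<bar>min (real k / x) 1\<bar>)) \<longlongrightarrow> expect K (\<lambda>k. 0)) at_top"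
  proof (rule integral_dominated_convergence_at_top[where w = "\<lambda>_. 1"])
    show "AE k in measure_pmf K. ((\<lambda>x. \<bar>min (real k / x) 1\<bar>) \<longlongrightarrow> 0) at_top"
    proof (rule AE_I2)
      fix k :: nat
      have "((\<lambda>x. real k / x) \<longlongrightarrow> 0) at_top" by real_asymp
      from tendsto_rabs[OF tendsto_min[OF this tendsto_const[of 1]]]
      show "((\<lambda>x. \<bar>min (real k / x) 1\<bar>) \<longlongrightarrow> 0) at_top" by simp
    qed
    show "\<forall>\<^sub>F x in at_top. AE k in measure_pmf K. norm \<bar>min (real k / x) 1\<bar> \<le> 1"
      using eventually_gt_at_top[of 0] by eventually_elim auto
  qed auto
  then have "((\<lambda>x. expect K (\<lambda>k. \<bar>min (real k / x) 1\<bar>)) \<longlongrightarrow> 0) at_top" by simp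
  then show ?thesis
  proof (rule Lim_transform_eventually)
    show "\<forall>\<^sub>F x in at_top. expect K (\<lambda>k. \<bar>min (real k / x) 1\<bar>) = expect K (\<lambda>k. min (real k / x) 1)"
      using eventually_gt_at_top[of 0]
      by eventually_elim (intro Bochner_Integration.integral_cong, auto)
  qed
qed

lemma tail_compound: "tail (compound K p) x = expect K (\<lambda>k. tail (isum k p) x)"
  unfolding tail_def compound_def measure_bind_pmf ..

text \<open>
  The number of summands exceeds \<open>x / m\<close> roughly when the sum exceeds \<open>x\<close>; the summands have a
  lighter tail, so that a single large summand does not contribute.
\<close>

theorem tail_compound_heavy:
  assumes K: "rv (tail K) al"
    and m: "nnmean g = ennreal m" "0 < m" "m \<le> 1"
    and g: "\<And>c. 0 < c \<Longrightarrow> \<exists>C. \<forall>x>0. x * tail g (c * x) \<le> C * tail K x"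
  shows "((\<lambda>x. tail (compound K g) x / tail K x) \<longlongrightarrow> (1 / m) powr (- al)) at_top"
proof (rule rv_sandwich[OF K])
  show "0 < 1 / m" using m by simp
next
  fix d :: real assume d: "0 < d" "d < 1"
  obtain D2 where D2: "1 \<le> D2" "\<And>x. 0 \<le> x \<Longrightarrow> tail K x \<le> D2 * tail K (2 * x)"
    using rv_doubling[OF K] by blast
  \<comment> \<open>The order r outgrows the doubling constant: it makes
    \<open>truncated_moment\<close> available and gives \<open>D2 / 2 ^ r\<close> at most one
    half.\<close>
  obtain r where r: "2 * D2 < 2 ^ r" using real_arch_pow[of 2 "2 * D2"] by auto
  obtain D c where D: "0 \<le> D" "0 < c" "c \<le> 1"
    and poly: "\<And>p k s. nnmean p \<le> 1 \<Longrightarrow> 0 < s \<Longrightarrow> tail (isum k p) s \<le> D * (real k * tail p (c * s) + (real k / s) ^ r)"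
    using tail_isum_polynomial[of r] by blast
  obtain C3 where C3: "\<And>x. 0 < x \<Longrightarrow> x * tail g (c * x) \<le> C3 * tail K x" using g[OF D(2)] by blast
  have g1: "nnmean g \<le> 1" using m by simp
  \<comment> \<open>Origin of the cut-off \<open>ze = (1 / 2) ^ j\<close>: the counts below
    \<open>ze * x\<close> leave an error proportional to \<open>(D2 / 2 ^ r) ^ j\<close>, which is
    at most \<open>(1 / 2) ^ j\<close>.\<close>
  have "(\<lambda>j. D * (2 * D2) * (1 / 2) ^ j) \<longlonglongrightarrow> D * (2 * D2) * 0"
    by (intro tendsto_intros LIMSEQ_realpow_zero) auto
  then have "\<forall>\<^sub>F j in sequentially. D * (2 * D2) * (1 / 2) ^ j < d / 3"
    by (rule order_tendstoD(2)) (use d in auto)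
  then obtain j where j: "D * (2 * D2) * (1 / 2) ^ j < d / 3" by (auto simp: eventually_sequentially)
  define ze :: real where "ze = (1 / 2) ^ j"
  have ze: "0 < ze" "ze \<le> 1" by (auto simp: ze_def power_le_one)
  have dy: "tail K ((1 / 2) ^ i * x) \<le> D2 ^ i * tail K x" if "0 \<le> x" for x i
  proof (induction i)
    case (Suc i)
    have "tail K ((1 / 2) ^ Suc i * x) \<le> D2 * tail K (2 * ((1 / 2) ^ Suc i * x))" using that by (intro D2) auto
    also have "\<dots> \<le> D2 * (D2 ^ i * tail K x)" using Suc D2(1) by (intro mult_left_mono) auto
    finally show ?case by simp
  qed simp
  have zeK: "tail K (ze * x) \<le> D2 ^ j * tail K x" if "0 \<le> x" for x using dy[OF that, of j] by (simp add: ze_def)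
  \<comment> \<open>Counts above \<open>ze * x\<close> have probability at most
    \<open>D2 ^ j * tail K x\<close>, so an error \<open>ep\<close> on each of them adds up to
    \<open>d / 3 * tail K x\<close>.\<close>
  define ep where "ep = d / (3 * D2 ^ j)"
  have ep: "0 < ep" using d D2 by (simp add: ep_def)
  \<comment> \<open>For the largest count not above \<open>(1 - d) * (1 / m) * x\<close>, the level
    \<open>m / (1 - d)\<close> per summand is above the mean, yet the total level is at most x.
    Smaller counts follow by monotonicity in the number of summands.\<close>
  have "((\<lambda>x. tail (isum (nat \<lfloor>(1 - d) * (1 / m) * x\<rfloor>) g) (m / (1 - d) * real (nat \<lfloor>(1 - d) * (1 / m) * x\<rfloor>))) \<longlongrightarrow> 0) at_top"
  proof (rule filterlim_compose[OF lln_upper[OF m(1)]])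
    show "m < m / (1 - d)" using m d by (simp add: field_simps)
    show "LIM x at_top. nat \<lfloor>(1 - d) * (1 / m) * x\<rfloor> :> sequentially" using m d by real_asymp
  qed (use m in auto)
  then have ev1: "\<forall>\<^sub>F x in at_top. tail (isum (nat \<lfloor>(1 - d) * (1 / m) * x\<rfloor>) g) (m / (1 - d) * real (nat \<lfloor>(1 - d) * (1 / m) * x\<rfloor>)) < ep"
    by (rule order_tendstoD(2)) (rule ep)
  have "((\<lambda>x. D * (expect K (\<lambda>k. min (real k / x) 1) * C3)) \<longlongrightarrow> D * (0 * C3)) at_top"
    by (intro tendsto_intros truncated_mean_negligible)
  then have ev2: "\<forall>\<^sub>F x in at_top. D * (expect K (\<lambda>k. min (real k / x) 1) * C3) < d / 3"
    by (rule order_tendstoD(2)) (use d in auto)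
  show "\<forall>\<^sub>F x in at_top. tail (compound K g) x \<le> tail K ((1 - d) * (1 / m) * x) + d * tail K x"
    using ev1 ev2 eventually_gt_at_top[of 0]
  proof eventually_elim
    case (elim x)
    let ?T = "(1 - d) * (1 / m) * x"
    let ?M = "\<lambda>k. min (real k / x) 1" and ?N = "\<lambda>k. min (real k / (ze * x)) 1 ^ r"
    have iM: "integrable (measure_pmf K) ?M" using elim by (intro integrable_pmf_bdd[of _ 1]) auto
    have iN: "integrable (measure_pmf K) ?N" using elim ze by (intro integrable_pmf_bdd[of _ 1]) (auto simp: power_le_one)
    have small: "tail (isum k g) x \<le> ep" if "real k \<le> ?T" for k
    proof -
      have "0 \<le> ?T" using elim d m by simp
      then have "real (nat \<lfloor>?T\<rfloor>) \<le> ?T" by linarith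
      then have "m / (1 - d) * real (nat \<lfloor>?T\<rfloor>) \<le> m / (1 - d) * ?T" using m d by (intro mult_left_mono) auto
      also have "\<dots> = x" using m d by simp
      finally have *: "m / (1 - d) * real (nat \<lfloor>?T\<rfloor>) \<le> x" .
      have "k \<le> nat \<lfloor>?T\<rfloor>" using that by linarith
      then have "tail (isum k g) x \<le> tail (isum (nat \<lfloor>?T\<rfloor>) g) x" by (rule tail_isum_mono)
      also have "\<dots> \<le> tail (isum (nat \<lfloor>?T\<rfloor>) g) (m / (1 - d) * real (nat \<lfloor>?T\<rfloor>))" by (rule tail_antimono[OF *])
      finally show ?thesis using elim by linarith
    qed
    have "tail (compound K g) x \<le> expect K (\<lambda>k. (if ?T < real k then 1 else 0)
       + ep * (if ze * x < real k then 1 else 0) + D * (?M k * (x * tail g (c * x)) + ze ^ r * ?N k))"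
      unfolding tail_compound
    proof (rule integral_mono)
      fix k
      have nn: "0 \<le> D * (?M k * (x * tail g (c * x)) + ze ^ r * ?N k)"
        using D elim ze by (intro mult_nonneg_nonneg add_nonneg_nonneg) auto
      \<comment> \<open>Large counts form the main term, moderate ones are excluded by the law of
        large numbers, and small ones would need a large summand or a deviation, both covered by the
        polynomial bound.\<close>
      consider "?T < real k" | "real k \<le> ?T" "ze * x < real k" | "real k \<le> ze * x" by linarith
      then show "tail (isum k g) x \<le> (if ?T < real k then 1 else 0)
       + ep * (if ze * x < real k then 1 else 0) + D * (?M k * (x * tail g (c * x)) + ze ^ r * ?N k)"
      proof cases
        case 1
        have "tail (isum k g) x \<le> 1" "0 \<le> ep * (if ze * x < real k then 1 else 0)" using ep by auto
        moreover have "(if ?T < real k then 1 else 0) = (1::real)" using 1 by simp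
        ultimately show ?thesis using nn by linarith
      next
        case 2
        with small[OF 2(1)] nn show ?thesis by simp
      next
        case 3
        have "ze * x \<le> 1 * x" using ze elim by (intro mult_right_mono) auto
        with 3 have "real k \<le> x" by linarith
        then have "?M k = real k / x" "?N k = (real k / (ze * x)) ^ r"
          using 3 elim(3) ze by (auto simp: min_absorb1)
        then have "D * (?M k * (x * tail g (c * x)) + ze ^ r * ?N k) = D * (real k * tail g (c * x) + (real k / x) ^ r)"
          using ze elim by (simp add: power_divide power_mult_distrib)
        moreover have "tail (isum k g) x \<le> D * (real k * tail g (c * x) + (real k / x) ^ r)"
          using g1 elim by (intro poly) auto
        moreover have "0 \<le> (if ?T < real k then 1 else 0) + ep * (if ze * x < real k then 1 else 0)" using ep by simp
        ultimately show ?thesis by linarith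
      qed
    qed (use iM iN in auto)
    also have "\<dots> = tail K ?T + ep * tail K (ze * x) + D * (expect K ?M * (x * tail g (c * x))
        + ze ^ r * expect K ?N)"
      using iM iN by (simp add: tail_altdef)
    also have "\<dots> \<le> tail K ?T + d / 3 * tail K x + (d / 3 * tail K x + d / 3 * tail K x)"
    proof (intro add_mono order_refl)
      have "ep * tail K (ze * x) \<le> ep * (D2 ^ j * tail K x)" using ep elim by (intro mult_left_mono zeK) auto
      also have "\<dots> = d / 3 * tail K x" using D2(1) by (simp add: ep_def)
      finally show "ep * tail K (ze * x) \<le> d / 3 * tail K x" .
      have eM: "0 \<le> expect K ?M" using elim by (intro Bochner_Integration.integral_nonneg) auto
      have "D * (expect K ?M * (x * tail g (c * x))) \<le> D * (expect K ?M * (C3 * tail K x))"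
        using D eM elim by (intro mult_left_mono C3) auto
      also have "\<dots> = D * (expect K ?M * C3) * tail K x" by simp
      also have "\<dots> \<le> d / 3 * tail K x" using elim by (intro mult_right_mono) auto
      finally have 1: "D * (expect K ?M * (x * tail g (c * x))) \<le> d / 3 * tail K x" .
      have "expect K ?N \<le> 2 * D2 * tail K (ze * x)"
        using r ze elim by (intro truncated_moment D2) auto
      also have "\<dots> \<le> 2 * D2 * (D2 ^ j * tail K x)" using D2(1) elim by (intro mult_left_mono zeK) auto
      finally have "D * (ze ^ r * expect K ?N) \<le> D * (ze ^ r * (2 * D2 * (D2 ^ j * tail K x)))"
        using D ze by (intro mult_left_mono) auto
      also have "\<dots> = D * (2 * D2) * (ze ^ r * D2 ^ j) * tail K x" by simp
      also have "\<dots> \<le> D * (2 * D2) * (1 / 2) ^ j * tail K x"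
      proof -
        have "ze ^ r * D2 ^ j = (D2 / 2 ^ r) ^ j"
          by (simp add: ze_def power_divide power_mult[symmetric] mult.commute)
        also have "\<dots> \<le> (1 / 2) ^ j" using r D2(1) by (intro power_mono) (auto simp: field_simps)
        finally show ?thesis using D D2(1) by (intro mult_right_mono mult_left_mono) auto
      qed
      also have "\<dots> \<le> d / 3 * tail K x" using j by (intro mult_right_mono) auto
      finally have 2: "D * (ze ^ r * expect K ?N) \<le> d / 3 * tail K x" .
      show "D * (expect K ?M * (x * tail g (c * x)) + ze ^ r * expect K ?N)
          \<le> d / 3 * tail K x + d / 3 * tail K x"
        using 1 2 by (simp add: distrib_left)
    qed
    finally show ?case by simp
  qed
next
  fix d :: real assume d: "0 < d" "d < 1"
  \<comment> \<open>Adding 1 gives the least integer strictly above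
    \<open>(1 + d) * (1 / m) * x\<close>. That many summands reach x already at the level
    \<open>m / (1 + d)\<close> per summand, below the mean.\<close>
  have "((\<lambda>x. tail (isum (nat \<lfloor>(1 + d) * (1 / m) * x\<rfloor> + 1) g) (m / (1 + d) * real (nat \<lfloor>(1 + d) * (1 / m) * x\<rfloor> + 1))) \<longlongrightarrow> 1) at_top"
  proof (rule filterlim_compose[OF lln_lower[OF m(1)]])
    show "m / (1 + d) < m" "0 < m / (1 + d)" using m d by (auto simp: field_simps)
    show "LIM x at_top. nat \<lfloor>(1 + d) * (1 / m) * x\<rfloor> + 1 :> sequentially" using m d by real_asymp
  qed
  then have "\<forall>\<^sub>F x in at_top. 1 - d < tail (isum (nat \<lfloor>(1 + d) * (1 / m) * x\<rfloor> + 1) g) (m / (1 + d) * real (nat \<lfloor>(1 + d) * (1 / m) * x\<rfloor> + 1))"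
    by (rule order_tendstoD(1)) (use d in auto)
  then show "\<forall>\<^sub>F x in at_top. (1 - d) * tail K ((1 + d) * (1 / m) * x) \<le> tail (compound K g) x"
    using eventually_gt_at_top[of 0]
  proof eventually_elim
    case (elim x)
    let ?T = "(1 + d) * (1 / m) * x" and ?k = "nat \<lfloor>(1 + d) * (1 / m) * x\<rfloor> + 1"
    have floor: "y \<le> real (nat \<lfloor>y\<rfloor> + 1)" "y < real k \<Longrightarrow> nat \<lfloor>y\<rfloor> + 1 \<le> k" if "0 \<le> y" for y k
      using that by linarith+
    have T0: "0 \<le> ?T" using elim d m by simp
    have "?T \<le> real ?k" by (rule floor(1)[OF T0])
    then have "m / (1 + d) * ?T \<le> m / (1 + d) * real ?k" using m d by (intro mult_left_mono) auto
    moreover have "m / (1 + d) * ?T = x" using m d by simp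
    ultimately have *: "x \<le> m / (1 + d) * real ?k" by linarith
    have "expect K (\<lambda>k. (1 - d) * (if ?T < real k then 1 else 0)) \<le> tail (compound K g) x"
      unfolding tail_compound
    proof (rule integral_mono)
      fix k show "(1 - d) * (if ?T < real k then 1 else 0) \<le> tail (isum k g) x"
      proof (cases "?T < real k")
        case True
        then have "?k \<le> k" by (rule floor(2)[OF T0])
        then have "tail (isum ?k g) x \<le> tail (isum k g) x" by (rule tail_isum_mono)
        moreover have "tail (isum ?k g) (m / (1 + d) * real ?k) \<le> tail (isum ?k g) x" by (rule tail_antimono[OF *])
        ultimately show ?thesis using elim True by simp
      qed (use d in auto)
    qed auto
    then show ?case by (simp add: tail_altdef)
  qed
qed


subsection \<open>Deconvolution\<close>

text \<open>Adding an independent nonnegative variable only enlarges the tail; conversely, a sum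
  above \<open>(1 + d) * x\<close> needs the first part above x or the light part above
  \<open>d * x\<close>, which is exponentially unlikely.\<close>

lemma tail_deconv:
  assumes u: "rv u al" and lim: "((\<lambda>x. tail (conv p r) x / u x) \<longlongrightarrow> g) at_top"
    and r: "0 < s" "s < 1" "\<And>x. 0 \<le> x \<Longrightarrow> tail r x \<le> C * s powr x"
  shows "((\<lambda>x. tail p x / u x) \<longlongrightarrow> g) at_top"
proof (rule order_tendstoI)
  fix y assume "g < y"
  then have "\<forall>\<^sub>F x in at_top. tail (conv p r) x / u x < y" by (rule order_tendstoD(2)[OF lim])
  then show "\<forall>\<^sub>F x in at_top. tail p x / u x < y"
  proof eventually_elim
    case (elim x)
    have "tail p x / u x \<le> tail (conv p r) x / u x"
      using tail_conv_ge[of p x r] rv_pos[OF u, of x] by (intro divide_right_mono) (auto simp: conv_commute[of p])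
    then show ?case using elim by simp
  qed
next
  fix y assume y: "y < g"
  have "((\<lambda>d. g * (1 + d) powr (- al)) \<longlongrightarrow> g * (1 + 0) powr (- al)) (at_right 0)"
    by (intro tendsto_intros) auto
  then have "\<forall>\<^sub>F d in at_right 0. y < g * (1 + d) powr (- al)"
    by (rule order_tendstoD(1)) (use y in auto)
  then obtain d where d: "y < g * (1 + d) powr (- al)" "0 < d" "d < 1" using at_right_0_witness by blast
  have s: "0 < s powr d" "s powr d < 1" using r d powr_less_mono'[of s 0 d] by auto
  have "((\<lambda>x. tail (conv p r) ((1 + d) * x) / u x - C * ((s powr d) powr x / u x)) \<longlongrightarrow> g * (1 + d) powr (- al) - C * 0) at_top"
    by (intro tendsto_intros tail_ratio_scale[OF u lim] rv_exponential_negligible[OF u s]) (use d in auto)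
  then have "\<forall>\<^sub>F x in at_top. y < tail (conv p r) ((1 + d) * x) / u x - C * ((s powr d) powr x / u x)"
    by (rule order_tendstoD(1)) (use d in auto)
  then show "\<forall>\<^sub>F x in at_top. y < tail p x / u x"
    using eventually_ge_at_top[of 0]
  proof eventually_elim
    case (elim x)
    have "tail (conv p r) ((1 + d) * x) \<le> tail p x + tail r (d * x)"
      using tail_conv_union[of p r x "d * x"] by (simp add: algebra_simps)
    also have "tail r (d * x) \<le> C * s powr (d * x)" using elim d by (intro r) auto
    also have "s powr (d * x) = (s powr d) powr x" by (simp add: powr_powr)
    finally have "tail (conv p r) ((1 + d) * x) / u x \<le> (tail p x + C * (s powr d) powr x) / u x"
      using rv_pos[OF u, of x] by (intro divide_right_mono) auto
    then show ?case using elim by (simp add: add_divide_distrib)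
  qed
qed


subsection \<open>Contraction in total variation\<close>

text \<open>A bound uniform over all events: errors add up under convolution and compounding, and
  uniformity later prevents mass from escaping to infinity.\<close>

definition tv_le :: "real \<Rightarrow> 'a pmf \<Rightarrow> 'a pmf \<Rightarrow> bool" where
  "tv_le e p r \<longleftrightarrow> (\<forall>A. \<bar>prb p A - prb r A\<bar> \<le> e)"

lemma tv_leD: "tv_le e p r \<Longrightarrow> \<bar>prb p A - prb r A\<bar> \<le> e"
  by (simp add: tv_le_def)

lemma tv_le_1: "tv_le 1 p r"
  unfolding tv_le_def
proof
  fix A
  have "0 \<le> prb p A" "prb p A \<le> 1" "0 \<le> prb r A" "prb r A \<le> 1"
    by auto
  then show "\<bar>prb p A - prb r A\<bar> \<le> 1" by linarith
qed

lemma tv_le_trans: "tv_le e p r \<Longrightarrow> tv_le e' r r' \<Longrightarrow> tv_le (e + e') p r'"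
  unfolding tv_le_def
proof
  assume e: "\<forall>A. \<bar>prb p A - prb r A\<bar> \<le> e"
    "\<forall>A. \<bar>prb r A - prb r' A\<bar> \<le> e'"
  fix A
  from e(1)[rule_format, of A] e(2)[rule_format, of A]
  show "\<bar>prb p A - prb r' A\<bar> \<le> e + e'" by linarith
qed

lemma tv_le_sym: "tv_le e p r \<Longrightarrow> tv_le e r p"
  by (simp add: tv_le_def abs_minus_commute)

lemma tv_le_map: "tv_le e p r \<Longrightarrow> tv_le e (map_pmf f p) (map_pmf f r)"
  by (simp add: tv_le_def)

lemma tv_le_bind:
  assumes "\<And>x. tv_le (e x) (f x) (g x)" "integrable (measure_pmf p) e"
  shows "tv_le (expect p e) (bind_pmf p f) (bind_pmf p g)"
  unfolding tv_le_def
proof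
  fix A
  have i: "integrable (measure_pmf p) (\<lambda>x. prb (h x) A)" for h :: "'a \<Rightarrow> 'b pmf"
    by (intro integrable_pmf_bdd[of _ 1]) auto
  have "\<bar>prb (bind_pmf p f) A - prb (bind_pmf p g) A\<bar>
      = \<bar>expect p (\<lambda>x. prb (f x) A - prb (g x) A)\<bar>"
    unfolding measure_bind_pmf using i by simp
  also have "\<dots> \<le> expect p (\<lambda>x. \<bar>prb (f x) A - prb (g x) A\<bar>)"
    by (rule integral_abs_bound)
  also have "\<dots> \<le> expect p e"
    using assms i by (intro integral_mono) (auto simp: tv_le_def)
  finally show "\<bar>prb (bind_pmf p f) A - prb (bind_pmf p g) A\<bar> \<le> expect p e" .
qed

lemma tv_le_conv:
  assumes "tv_le e p p'" "tv_le e' r r'"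
  shows "tv_le (e + e') (conv p r) (conv p' r')"
proof -
  have *: "tv_le d (conv s t) (conv s t')" if "tv_le d t t'" for s t t' d
    using tv_le_bind[of "\<lambda>_. d" "\<lambda>m. map_pmf ((+) m) t" "\<lambda>m. map_pmf ((+) m) t'" s] that
    by (simp add: conv_def tv_le_map)
  from *[OF assms(1), of r] *[OF assms(2), of p'] show ?thesis
    by (simp add: conv_commute[of r] tv_le_trans)
qed

lemma tv_le_isum: "tv_le e p p' \<Longrightarrow> tv_le (real k * e) (isum k p) (isum k p')"
proof (induction k)
  case (Suc k)
  then show ?case using tv_le_conv[of e p p' "real k * e" "isum k p" "isum k p'"] by (simp add: algebra_simps)
qed (simp add: tv_le_def)

lemma tv_le_compound:
  assumes "tv_le e p p'" "integrable (measure_pmf K) real"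
  shows "tv_le (expect K real * e) (compound K p) (compound K p')"
  using tv_le_bind[of "\<lambda>k. real k * e" "\<lambda>k. isum k p" "\<lambda>k. isum k p'" K] assms
  by (simp add: compound_def tv_le_isum)

lemma tv_le_imp_eq:
  assumes "\<And>n. tv_le (e n) p r" "e \<longlonglongrightarrow> 0"
  shows "p = r"
proof (rule pmf_eqI)
  fix x
  have "\<bar>prb p {x} - prb r {x}\<bar> \<le> 0"
    by (rule LIMSEQ_le_const[OF assms(2)]) (use assms(1) in \<open>auto simp: tv_le_def\<close>)
  then show "pmf p x = pmf r x" by (simp add: measure_pmf_single)
qed

lemma geometric_cauchy_limit:
  fixes f :: "nat \<Rightarrow> real"
  assumes "\<And>m. \<bar>f m - f (Suc m)\<bar> \<le> r ^ m" "0 \<le> r" "r < 1"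
  obtains l where "\<And>m. \<bar>f m - l\<bar> \<le> r ^ m / (1 - r)"
proof -
  have s: "summable (\<lambda>i. f (Suc i + m) - f (i + m))" for m
  proof (rule summable_comparison_test')
    show "summable (\<lambda>i. r ^ m * r ^ i)" using assms by (intro summable_mult summable_geometric) auto
    show "norm (f (Suc i + m) - f (i + m)) \<le> r ^ m * r ^ i" for i
      using assms(1)[of "i + m"] by (simp add: abs_minus_commute power_add mult.commute)
  qed
  have "convergent f"
    using s[of 0] by (simp add: summable_iff_convergent sum_lessThan_telescope convergent_diff_const_right_iff)
  then obtain l where l: "f \<longlonglongrightarrow> l" by (auto simp: convergent_def)
  have "\<bar>f m - l\<bar> \<le> r ^ m / (1 - r)" for m
  proof -
    have "(\<lambda>i. f (i + m)) \<longlonglongrightarrow> l" using l by (rule LIMSEQ_ignore_initial_segment)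
    from telescope_sums[OF this] have "(\<lambda>i. f (Suc i + m) - f (i + m)) sums (l - f m)" by simp
    then have "\<bar>l - f m\<bar> = \<bar>\<Sum>i. f (Suc i + m) - f (i + m)\<bar>" by (simp add: sums_iff)
    also have "\<dots> = norm (\<Sum>i. f (Suc i + m) - f (i + m))" by simp
    also have "\<dots> \<le> (\<Sum>i. r ^ m * r ^ i)"
    proof (rule norm_suminf_le)
      show "norm (f (Suc i + m) - f (i + m)) \<le> r ^ m * r ^ i" for i
        using assms(1)[of "i + m"] by (simp add: abs_minus_commute power_add mult.commute)
      show "summable (\<lambda>i. r ^ m * r ^ i)" using assms by (intro summable_mult summable_geometric) auto
    qed
    also have "\<dots> = r ^ m / (1 - r)" using assms by (simp add: suminf_mult suminf_geometric)
    finally show ?thesis by (simp add: abs_minus_commute)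
  qed
  then show ?thesis using that by blast
qed

lemma prob_truncate: "(\<lambda>J. prb p (A \<inter> {..<J})) \<longlonglongrightarrow> prb p A" for A :: "nat set"
proof -
  have "(\<lambda>J. prb p (A \<inter> {..<J})) \<longlonglongrightarrow> prb p (\<Union>J. A \<inter> {..<J})"
    by (rule measure_pmf.finite_Lim_measure_incseq) (auto simp: incseq_def)
  moreover have "(\<Union>J. A \<inter> {..<J}) = A" by auto
  ultimately show ?thesis by simp
qed

text \<open>Completeness, for geometrically decreasing steps. The probabilities converge event by
  event, and the point masses of the limit define Q once they are known to sum to 1.\<close>

lemma tv_cauchy_limit:
  fixes P :: "nat \<Rightarrow> nat pmf"
  assumes tv: "\<And>m. tv_le (r ^ m) (P m) (P (Suc m))" and r: "0 \<le> r" "r < 1"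
  obtains Q where "\<And>m. tv_le (r ^ m / (1 - r)) (P m) Q"
proof -
  have "\<exists>l. \<forall>m. \<bar>prb (P m) A - l\<bar> \<le> r ^ m / (1 - r)" for A
  proof -
    have "\<bar>prb (P m) A - prb (P (Suc m)) A\<bar> \<le> r ^ m" for m
      by (rule tv_leD[OF tv])
    from geometric_cauchy_limit[of "\<lambda>m. prb (P m) A", OF this r] show ?thesis by blast
  qed
  then obtain l where l: "\<And>A m. \<bar>prb (P m) A - l A\<bar> \<le> r ^ m / (1 - r)" by metis
  have e0: "(\<lambda>m. r ^ m / (1 - r)) \<longlonglongrightarrow> 0"
    using tendsto_divide[OF LIMSEQ_realpow_zero[OF r] tendsto_const, of "1 - r"] r by simp
  have lim: "(\<lambda>m. prb (P m) A) \<longlonglongrightarrow> l A" for A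
  proof (rule LIMSEQ_I)
    fix e :: real assume "0 < e"
    then have "\<forall>\<^sub>F m in sequentially. r ^ m / (1 - r) < e" by (rule order_tendstoD(2)[OF e0])
    then show "\<exists>no. \<forall>n\<ge>no. norm (prb (P n) A - l A) < e"
      using l[of _ A] unfolding eventually_sequentially real_norm_def by (meson le_less_trans)
  qed
  have nonneg: "0 \<le> l A" for A by (rule LIMSEQ_le_const[OF lim]) auto
  have fin: "(\<Sum>n\<in>A. l {n}) = l A" if "finite A" for A
  proof (rule LIMSEQ_unique[OF _ lim])
    have "(\<lambda>m. \<Sum>n\<in>A. prb (P m) {n}) \<longlonglongrightarrow> (\<Sum>n\<in>A. l {n})" by (intro tendsto_sum lim)
    then show "(\<lambda>m. prb (P m) A) \<longlonglongrightarrow> (\<Sum>n\<in>A. l {n})"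
      using that by (simp add: measure_pmf_single measure_measure_pmf_finite)
  qed
  \<comment> \<open>No mass escapes: one law \<open>P m\<close> is close to the limit on all sets
    {0, ..., J - 1} at once and itself has almost full mass there for large J.\<close>
  have "(\<lambda>n. l {n}) sums 1"
    unfolding sums_def
  proof (rule LIMSEQ_I)
    fix e :: real assume e: "0 < e"
    then have "\<forall>\<^sub>F m in sequentially. r ^ m / (1 - r) < e / 2" by (intro order_tendstoD(2)[OF e0]) simp
    then obtain m where m: "r ^ m / (1 - r) < e / 2" by (auto simp: eventually_sequentially)
    have "(\<lambda>J. prb (P m) {..<J}) \<longlonglongrightarrow> 1" using prob_truncate[of "P m" UNIV] by simp
    then obtain J0 where J0: "\<And>J. J \<ge> J0 \<Longrightarrow> \<bar>prb (P m) {..<J} - 1\<bar> < e / 2"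
      using LIMSEQ_D[of _ 1 "e / 2"] e by (metis half_gt_zero real_norm_def)
    show "\<exists>no. \<forall>n\<ge>no. norm ((\<Sum>i<n. l {i}) - 1) < e"
    proof (intro exI allI impI)
      fix J assume "J \<ge> J0"
      have "\<bar>l {..<J} - 1\<bar> < e" using J0[OF \<open>J \<ge> J0\<close>] l[of m "{..<J}"] m by linarith
      then show "norm ((\<Sum>i<J. l {i}) - 1) < e" by (simp add: fin)
    qed
  qed
  then have "(\<Sum>n. ennreal (l {n})) = 1" using nonneg by (simp add: sums_iff suminf_ennreal2)
  then have nn: "(\<integral>\<^sup>+n. ennreal (l {n}) \<partial>count_space UNIV) = 1" by (simp add: nn_integral_count_space_nat)
  define Q where "Q = embed_pmf (\<lambda>n. l {n})"
  have Q: "pmf Q n = l {n}" for n unfolding Q_def by (rule pmf_embed_pmf[OF nonneg nn])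
  have Qfin: "prb Q A = l A" if "finite A" for A
    using that fin by (simp add: measure_measure_pmf_finite Q)
  \<comment> \<open>\<open>Q\<close> and \<open>l\<close> have been identified on finite sets only;
    an arbitrary event is reached by truncating it.\<close>
  have "tv_le (r ^ m / (1 - r)) (P m) Q" for m
    unfolding tv_le_def
  proof
    fix A
    have "(\<lambda>J. \<bar>prb (P m) (A \<inter> {..<J}) - prb Q (A \<inter> {..<J})\<bar>) \<longlonglongrightarrow>
       \<bar>prb (P m) A - prb Q A\<bar>"
      by (intro tendsto_intros prob_truncate)
    then show "\<bar>prb (P m) A - prb Q A\<bar> \<le> r ^ m / (1 - r)"
      by (rule LIMSEQ_le_const2) (use l in \<open>auto simp: Qfin\<close>)
  qed
  then show ?thesis using that by blast
qed


subsection \<open>The branching equation\<close>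

text \<open>The orbit contribution of one arrival during a busy period: with probability q it joins
  the queue and brings progeny of law p, otherwise it is itself one orbit customer.\<close>

definition with_orbit :: "real \<Rightarrow> nat pmf \<Rightarrow> nat pmf" where
  "with_orbit q p = bind_pmf (bernoulli_pmf q) (\<lambda>b. if b then p else return_pmf 1)"

lemma measure_with_orbit:
  "0 \<le> q \<Longrightarrow> q \<le> 1 \<Longrightarrow> prb (with_orbit q p) A = q * prb p A + (1 - q) * indicator A 1"
  by (simp add: with_orbit_def measure_bind_pmf)

lemma tail_with_orbit:
  "0 \<le> q \<Longrightarrow> q \<le> 1 \<Longrightarrow> tail (with_orbit q p) x = q * tail p x + (1 - q) * (if x < 1 then 1 else 0)"
  by (simp add: tail_def measure_with_orbit indicator_def)

lemma pgf_with_orbit: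
  "0 \<le> q \<Longrightarrow> q \<le> 1 \<Longrightarrow> 0 \<le> z \<Longrightarrow> z \<le> 1 \<Longrightarrow> pgf (with_orbit q p) z = q * pgf p z + (1 - q) * z"
  by (simp add: with_orbit_def pgf_bind)

lemma nnmean_with_orbit:
  assumes "0 \<le> q" "q \<le> 1"
  shows "nnmean (with_orbit q p) = ennreal q * nnmean p + ennreal (1 - q)"
  using assms by (simp add: nnmean_def with_orbit_def mult.commute)

lemma tv_le_with_orbit:
  "0 \<le> q \<Longrightarrow> q \<le> 1 \<Longrightarrow> tv_le e p p' \<Longrightarrow> tv_le (q * e) (with_orbit q p) (with_orbit q p')"
proof -
  assume q: "0 \<le> q" "q \<le> 1" and e: "tv_le e p p'"
  show ?thesis
    unfolding tv_le_def
  proof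
    fix A
    have "\<bar>prb (with_orbit q p) A - prb (with_orbit q p') A\<bar>
        = q * \<bar>prb p A - prb p' A\<bar>"
      using q by (simp add: measure_with_orbit right_diff_distrib[symmetric] abs_mult)
    also have "\<dots> \<le> q * e" using q tv_leD[OF e] by (intro mult_left_mono) auto
    finally show "\<bar>prb (with_orbit q p) A - prb (with_orbit q p') A\<bar> \<le> q * e" .
  qed
qed

locale branching =
  fixes K :: "nat pmf" and q rho a :: real
  assumes q: "0 < q" "q < 1" and rho: "0 < rho" "rho < 1" and mean_K: "nnmean K = ennreal rho"
    and rv_K: "rv (tail K) a"
begin

text \<open>
  \<open>gener m\<close> counts the customers sent to the orbit during a service and the services of its
  queue descendants of depth less than \<open>m\<close>.
\<close>

primrec gener :: "nat \<Rightarrow> nat pmf" where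
  "gener 0 = return_pmf 0"
| "gener (Suc m) = compound K (with_orbit q (gener m))"

text \<open>Provides, uniformly in the generation, the mean bound under which
  \<open>tail_isum_polynomial\<close> has constants independent of the law.\<close>

lemma nnmean_gener: "nnmean (gener m) \<le> 1"
proof (induction m)
  case (Suc m)
  have "nnmean (gener (Suc m)) = ennreal rho * (ennreal q * nnmean (gener m) + ennreal (1 - q))"
    using q by (simp add: nnmean_compound nnmean_with_orbit mean_K)
  also have "\<dots> \<le> 1 * (ennreal q * 1 + ennreal (1 - q))"
    using rho Suc by (intro mult_mono add_mono) (auto simp: ennreal_le_1)
  also have "\<dots> = ennreal (q + (1 - q))" using q by (subst ennreal_plus) auto
  finally show ?case by simp
qed (simp add: nnmean_def)

lemma nnmean_with_orbit_gener: "nnmean (with_orbit q (gener m)) \<le> 1"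
proof -
  have "nnmean (with_orbit q (gener m)) = ennreal q * nnmean (gener m) + ennreal (1 - q)"
    using q by (simp add: nnmean_with_orbit)
  also have "\<dots> \<le> ennreal q * 1 + ennreal (1 - q)" by (intro mult_mono add_mono nnmean_gener) auto
  also have "\<dots> = ennreal (q + (1 - q))" using q by (subst ennreal_plus) auto
  finally show ?thesis by simp
qed

lemma integrable_K: "integrable (measure_pmf K) real" and expectation_K: "expect K real = rho"
  using nnmean_eq_ennreal[OF mean_K] rho by auto

lemma rho_q: "0 < rho * q" "rho * q < 1"
proof -
  have "rho * q < 1 * 1" using rho q by (intro mult_strict_mono) auto
  then show "rho * q < 1" by simp
qed (use rho q in simp)

text \<open>The branching map contracts total variation by the factor \<open>rho * q\<close>: the
  mean number of summands times the probability that a summand involves the argument at all.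
  Convergence of the tails then carries uniform bounds over to the fixed point.\<close>

lemma limit_law:
  obtains N where "N = compound K (with_orbit q N)" "\<And>x. (\<lambda>m. tail (gener m) x) \<longlonglongrightarrow> tail N x"
proof -
  define r where "r = rho * q"
  have r: "0 \<le> r" "r < 1" using rho_q by (auto simp: r_def)
  have step: "tv_le (r * e) (compound K (with_orbit q p)) (compound K (with_orbit q p'))" if "tv_le e p p'" for e p p'
    using tv_le_compound[OF tv_le_with_orbit[OF _ _ that, of q] integrable_K] q by (simp add: expectation_K r_def mult.assoc)
  have tv: "tv_le (r ^ m) (gener m) (gener (Suc m))" for m
  proof (induction m)
    case 0
    show ?case by (simp add: tv_le_1)
  next
    case (Suc m)
    from step[OF this] show ?case by simp
  qed
  obtain N where N: "\<And>m. tv_le (r ^ m / (1 - r)) (gener m) N" using tv_cauchy_limit[OF tv r] by blast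
  have e0: "(\<lambda>m. r ^ m / (1 - r)) \<longlonglongrightarrow> 0"
    using tendsto_divide[OF LIMSEQ_realpow_zero[OF r] tendsto_const, of "1 - r"] r by simp
  have "N = compound K (with_orbit q N)"
  proof (rule tv_le_imp_eq)
    fix m
    show "tv_le (r ^ Suc m / (1 - r) + r * (r ^ m / (1 - r))) N (compound K (with_orbit q N))"
      by (rule tv_le_trans[OF tv_le_sym[OF N[of "Suc m"]]]) (use step[OF N[of m]] in simp)
    show "(\<lambda>m. r ^ Suc m / (1 - r) + r * (r ^ m / (1 - r))) \<longlonglongrightarrow> 0"
      using tendsto_add[OF LIMSEQ_Suc[OF e0] tendsto_mult[OF tendsto_const[of r] e0]] by simp
  qed
  moreover have "(\<lambda>m. tail (gener m) x) \<longlonglongrightarrow> tail N x" for x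
  proof (rule LIMSEQ_I)
    fix e :: real assume "0 < e"
    then have "\<forall>\<^sub>F m in sequentially. r ^ m / (1 - r) < e" by (rule order_tendstoD(2)[OF e0])
    then show "\<exists>no. \<forall>n\<ge>no. norm (tail (gener n) x - tail N x) < e"
      using tv_leD[OF N, of _ "{n. x < real n}"] unfolding eventually_sequentially real_norm_def tail_def
      by (meson le_less_trans)
  qed
  ultimately show ?thesis using that by blast
qed

text \<open>
  One large summand comparable to \<open>x\<close> costs the factor \<open>rho * q < 1\<close>, everything else is
  bounded by multiples of \<^term>\<open>tail K x\<close> that do not depend on the generation or carry an
  arbitrarily small factor.
\<close>

lemma tail_gener_bound:
  obtains C where "0 < C" "\<And>m x. 0 \<le> x \<Longrightarrow> tail (gener m) x \<le> C * tail K x"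
proof -
  have pos: "0 < tail K x" for x using rv_pos[OF rv_K] .
  \<comment> \<open>A summand above \<open>(1 - 2 * e) * x\<close> reproduces the induction
    hypothesis with about this factor; it stays below 1 for small e.\<close>
  have "((\<lambda>e. rho * q * (1 - 2 * e) powr (- a)) \<longlongrightarrow> rho * q * (1 - 2 * 0) powr (- a)) (at_right 0)"
    by (intro tendsto_intros) auto
  then have "\<forall>\<^sub>F e in at_right 0. rho * q * (1 - 2 * e) powr (- a) < 1"
    by (rule order_tendstoD(2)) (use rho_q in auto)
  moreover have "\<forall>\<^sub>F e in at_right 0. (0::real) < e \<and> e < 1 / 2"
    by (intro eventually_conj eventually_at_right_less eventually_at_rightI[of 0 "1/2"]) auto
  ultimately have "\<forall>\<^sub>F e in at_right (0::real). rho * q * (1 - 2 * e) powr (- a) < 1 \<and> 0 < e \<and> e < 1 / 2"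
    by eventually_elim auto
  then obtain e where e: "rho * q * (1 - 2 * e) powr (- a) < 1" "0 < e" "e < 1 / 2"
    using eventually_happens'[OF trivial_limit_at_right_real] by blast
  obtain s where s: "rho * q * (1 - 2 * e) powr (- a) < s" "s < 1" using dense[OF e(1)] by blast
  have "((\<lambda>x. rho * q * (tail K ((1 - 2 * e) * x) / tail K x)) \<longlongrightarrow> rho * q * (1 - 2 * e) powr (- a)) at_top"
    by (intro tendsto_intros rv_lim[OF rv_K]) (use e in auto)
  then have "\<forall>\<^sub>F x in at_top. rho * q * (tail K ((1 - 2 * e) * x) / tail K x) < s"
    by (rule order_tendstoD(2)) (rule s)
  then obtain X0 where X0: "\<And>x. x \<ge> X0 \<Longrightarrow> rho * q * (tail K ((1 - 2 * e) * x) / tail K x) < s"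
    by (auto simp: eventually_at_top_linorder)
  obtain D2 where D2: "1 \<le> D2" "\<And>x. 0 \<le> x \<Longrightarrow> tail K x \<le> D2 * tail K (2 * x)"
    using rv_doubling[OF rv_K] by blast
  obtain r where r: "2 * D2 < 2 ^ r" using real_arch_pow[of 2 "2 * D2"] by auto
  then have r': "2 * D2 \<le> 2 ^ Suc r" using D2(1) by (simp add: order_trans[of _ "2 * D2"])
  obtain D c where D: "0 \<le> D" "0 < c" "c \<le> 1"
    and poly: "\<And>p k s. nnmean p \<le> 1 \<Longrightarrow> 0 < s \<Longrightarrow> tail (isum k p) s \<le> D * (real k * tail p (c * s) + (real k / s) ^ r)"
    using tail_isum_polynomial[of r] by blast
  obtain C1 where C1: "0 < C1" "\<And>x. 0 \<le> x \<Longrightarrow> tail K (c * e * x) \<le> C1 * tail K x"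
    using rv_scale_bound[OF rv_K, of "c * e"] D e by (metis mult_pos_pos)
  \<comment> \<open>Splits the slack left by s in two: one share for the squared term, the other for
    the terms free of the constant C.\<close>
  define w where "w = (1 - s) / 2"
  have w: "0 < w" "s + w < 1" "s + w + w = 1" using s by (auto simp: w_def field_simps)
  \<comment> \<open>For counts up to \<open>de * x\<close> Markov's inequality gives a factor
    \<open>de / e\<close>; this choice brings the coefficient of the squared term below w.\<close>
  define de where "de = min 1 (w / ((D / e) * (rho * q) * C1 + 1))"
  have de: "0 < de" "de \<le> 1" "de / e * D * (rho * q) * C1 \<le> w"
  proof -
    have nn: "0 \<le> (D / e) * (rho * q) * C1" using D e rho q C1 by simp
    then show "0 < de" "de \<le> 1" using w by (auto simp: de_def)
    have "de * ((D / e) * (rho * q) * C1) \<le> w / ((D / e) * (rho * q) * C1 + 1) * ((D / e) * (rho * q) * C1)"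
      using nn by (intro mult_right_mono) (auto simp: de_def)
    also have "\<dots> \<le> w"
    proof -
      have "w / (y + 1) * y \<le> w" if "0 \<le> y" for y using that w by (simp add: field_simps)
      from this[OF nn] show ?thesis .
    qed
    finally show "de / e * D * (rho * q) * C1 \<le> w" by (simp add: mult_ac)
  qed
  obtain C2 where C2: "0 < C2" "\<And>x. 0 \<le> x \<Longrightarrow> tail K (de * x) \<le> C2 * tail K x"
    using rv_scale_bound[OF rv_K de(1)] by blast
  define C5 where "C5 = D * (1 / e) ^ Suc r * (2 * D2)"
  \<comment> \<open>Beyond X the ratio bound by s holds and the arguments \<open>c * e * x\<close>
    and \<open>(1 - 2 * e) * x\<close> are at least 1, where the atom at 1 of
    \<open>with_orbit\<close> no longer contributes to the tail.\<close>
  define X where "X = max (max 1 (1 / (1 - 2 * e))) (max X0 (1 / (c * e)))"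
  have X: "1 \<le> X" "X0 \<le> X" "1 \<le> c * e * X" "1 \<le> (1 - 2 * e) * X"
  proof -
    show "1 \<le> X" "X0 \<le> X" by (auto simp: X_def)
    have "1 = (1 - 2 * e) * (1 / (1 - 2 * e))" using e by simp
    also have "\<dots> \<le> (1 - 2 * e) * X" using e by (intro mult_left_mono) (auto simp: X_def)
    finally show "1 \<le> (1 - 2 * e) * X" .
    have "1 = c * e * (1 / (c * e))" using D e by simp
    also have "\<dots> \<le> c * e * X" using D e by (intro mult_left_mono) (auto simp: X_def)
    finally show "1 \<le> c * e * X" .
  qed
  \<comment> \<open>The first entry settles x < X at once, the second pays for the constant terms
    out of the share w.\<close>
  define C where "C = max (1 / tail K X) ((C2 + C5) / w)"
  have C: "0 < C" "C2 + C5 \<le> w * C"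
  proof -
    show "0 < C" using pos[of X] by (auto simp: C_def less_max_iff_disj)
    have "C2 + C5 = w * ((C2 + C5) / w)" using w by simp
    also have "\<dots> \<le> w * C" using w by (intro mult_left_mono) (auto simp: C_def)
    finally show "C2 + C5 \<le> w * C" .
  qed
  have "tail (gener m) x \<le> C * tail K x" if "0 \<le> x" for m x
    using that
  proof (induction m arbitrary: x)
    case 0
    then show ?case using C by (simp add: tail_return_0)
  next
    case (Suc m)
    show ?case
    proof (cases "x < X")
      case True
      have "tail (gener (Suc m)) x \<le> 1" by simp
      also have "1 = (1 / tail K X) * tail K X" using pos[of X] by simp
      also have "\<dots> \<le> C * tail K x" using True C by (intro mult_mono tail_antimono) (auto simp: C_def)
      finally show ?thesis .
    next
      case False
      then have x: "X \<le> x" "0 < x" using X by auto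
      let ?g = "with_orbit q (gener m)"
      have g: "tail ?g y \<le> q * (C * tail K y)" if "1 \<le> y" for y
        using that q Suc.IH[of y] by (simp add: tail_with_orbit)
      have cex: "1 \<le> c * e * x"
        by (rule order_trans[OF X(3)]) (use D e x in \<open>auto intro!: mult_left_mono\<close>)
      have e2x: "1 \<le> (1 - 2 * e) * x"
        by (rule order_trans[OF X(4)]) (use e x in \<open>auto intro!: mult_left_mono\<close>)
      let ?M = "\<lambda>k. min (real k / x) 1 ^ Suc r"
      have iM: "integrable (measure_pmf K) ?M" using x by (intro integrable_pmf_bdd[of _ 1]) (auto simp: power_le_one simp del: power_Suc)
      have bound: "tail (isum k ?g) x \<le> (if de * x < real k then 1 else 0) + real k * tail ?g ((1 - 2 * e) * x)
          + de / e * D * (real k * tail ?g (c * e * x)) + D * (1 / e) ^ Suc r * ?M k" for k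
      proof (cases "de * x < real k")
        case True
        have "0 \<le> real k * tail ?g ((1 - 2 * e) * x)
          + de / e * D * (real k * tail ?g (c * e * x)) + D * (1 / e) ^ Suc r * ?M k"
          using D de e x by (intro add_nonneg_nonneg mult_nonneg_nonneg) auto
        moreover have "(if de * x < real k then 1 else 0) = (1::real)" using True by simp
        ultimately show ?thesis using tail_le_1[of "isum k ?g" x] by linarith
      next
        case False
        then have k: "real k \<le> de * x" by simp
        have ex: "0 < e * x" using e x by simp
        \<comment> \<open>Markov's inequality for one factor yields the small coefficient, the
          polynomial bound for the other brings back single summands.\<close>
        have "(tail (isum k ?g) (e * x))\<^sup>2 \<le> (real k / (e * x)) * (D * (real k * tail ?g (c * (e * x)) + (real k / (e * x)) ^ r))"
          unfolding power2_eq_square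
          using nnmean_with_orbit_gener ex by (intro mult_mono tail_isum_markov poly) auto
        also have "\<dots> = (real k / (e * x)) * (D * (real k * tail ?g (c * e * x))) + D * (real k / (e * x)) ^ Suc r"
          by (simp add: algebra_simps)
        also have "\<dots> \<le> de / e * (D * (real k * tail ?g (c * e * x))) + D * (real k / (e * x)) ^ Suc r"
          using k D e x by (intro add_right_mono mult_right_mono) (auto simp: field_simps)
        also have "(real k / (e * x)) ^ Suc r = (1 / e) ^ Suc r * ?M k"
        proof -
          have "de * x \<le> 1 * x" using de x by (intro mult_right_mono) auto
          with k have "real k \<le> x" by linarith
          then have "min (real k / x) 1 = real k / x" using x by (simp add: min_absorb1)
          then show ?thesis by (simp add: power_divide power_mult_distrib)
        qed
        finally have 1: "(tail (isum k ?g) (e * x))\<^sup>2 \<le> de / e * D * (real k * tail ?g (c * e * x)) + D * (1 / e) ^ Suc r * ?M k"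
          by (simp only: mult.assoc)
        \<comment> \<open>The levels add up exactly: twice \<open>e * x\<close> plus
          \<open>(1 - 2 * e) * x\<close>. Keeping the single-summand level close to x preserves the
          factor below 1.\<close>
        have "tail (isum k ?g) x \<le> real k * tail ?g ((1 - 2 * e) * x) + (tail (isum k ?g) (e * x))\<^sup>2"
          using hoffmann_jorgensen[of "(1 - 2 * e) * x" "e * x" k ?g] e x by (simp add: algebra_simps)
        with 1 False show ?thesis by simp
      qed
      have "tail (gener (Suc m)) x \<le> expect K (\<lambda>k. (if de * x < real k then 1 else 0)
          + real k * tail ?g ((1 - 2 * e) * x)
          + de / e * D * (real k * tail ?g (c * e * x)) + D * (1 / e) ^ Suc r * ?M k)"
        unfolding gener.simps tail_compound
        by (intro integral_mono bound) (use iM integrable_K in auto)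
      also have "\<dots> = tail K (de * x) + rho * tail ?g ((1 - 2 * e) * x) + de / e * D * (rho * tail ?g (c * e * x))
          + D * (1 / e) ^ Suc r * expect K ?M"
        using iM integrable_K by (simp add: tail_altdef expectation_K del: power_Suc)
      also have "\<dots> \<le> C2 * tail K x + s * C * tail K x + w * C * tail K x + C5 * tail K x"
      proof (intro add_mono)
        show "tail K (de * x) \<le> C2 * tail K x" using x by (intro C2) auto
        show "rho * tail ?g ((1 - 2 * e) * x) \<le> s * C * tail K x"
        proof -
          have "rho * tail ?g ((1 - 2 * e) * x) \<le> rho * (q * (C * tail K ((1 - 2 * e) * x)))"
            using rho by (intro mult_left_mono g e2x) auto
          also have "\<dots> = C * (rho * q * tail K ((1 - 2 * e) * x))" by simp
          also have "\<dots> \<le> C * (s * tail K x)"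
            using X0[of x] x X C pos[of x] by (intro mult_left_mono) (auto simp: field_simps)
          finally show ?thesis by (simp only: mult_ac)
        qed
        show "de / e * D * (rho * tail ?g (c * e * x)) \<le> w * C * tail K x"
        proof -
          have "de / e * D * (rho * tail ?g (c * e * x)) \<le> de / e * D * (rho * (q * (C * (C1 * tail K x))))"
            using de e D rho q C x by (intro mult_left_mono order_trans[OF g[OF cex]] C1) auto
          also have "\<dots> = de / e * D * (rho * q) * C1 * (C * tail K x)" by simp
          also have "\<dots> \<le> w * (C * tail K x)" using de C by (intro mult_right_mono) auto
          finally show ?thesis by simp
        qed
        show "D * (1 / e) ^ Suc r * expect K ?M \<le> C5 * tail K x"
        proof -
          have "expect K ?M \<le> 2 * D2 * tail K x"
            using truncated_moment[OF D2 r' x(2)] .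
          then have "D * (1 / e) ^ Suc r * expect K ?M \<le> D * (1 / e) ^ Suc r * (2 * D2 * tail K x)"
            using D e by (intro mult_left_mono) auto
          then show ?thesis by (simp add: C5_def)
        qed
      qed
      also have "\<dots> = (C2 + C5 + (s + w) * C) * tail K x" by (simp add: algebra_simps)
      also have "\<dots> \<le> (w * C + (s + w) * C) * tail K x" using C by (intro mult_right_mono add_right_mono) auto
      also have "\<dots> = (s + w + w) * C * tail K x" by (simp add: algebra_simps)
      also have "\<dots> = C * tail K x" by (simp only: w(3) mult_1)
      finally show ?thesis .
    qed
  qed
  then show ?thesis using that C(1) by blast
qed

end


subsection \<open>The integrated tail\<close>

lemma nn_integral_pmf_nat: "(\<integral>\<^sup>+k. f k \<partial>measure_pmf p) = (\<Sum>k. ennreal (pmf p k) * f k)" for p :: "nat pmf"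
  by (simp add: nn_integral_measure_pmf nn_integral_count_space_nat)

lemma ennreal_tail: "ennreal (tail p x) = (\<integral>\<^sup>+n. (if x < real n then 1 else 0) \<partial>p)"
  unfolding tail_altdef
  by (subst nn_integral_eq_integral[symmetric]) (auto intro!: nn_integral_cong)

locale finite_mean =
  fixes K :: "nat pmf" and rho :: real
  assumes rho_pos: "0 < rho" and nnmean: "nnmean K = ennreal rho"
begin

definition equilibrium :: "nat pmf" where
  "equilibrium = embed_pmf (\<lambda>k. tail K (real k) / rho)"

text \<open>Tonelli's theorem for the sum over k and the expectation over n > k. Choosing g as 1, a
  power or an indicator gives the normalisation, the generating function and the tail of the
  equilibrium law.\<close>

lemma suminf_tail:
  "(\<Sum>k. ennreal (tail K (real k) / rho) * g k) = (\<integral>\<^sup>+n. (\<Sum>k<n. g k) \<partial>K) / ennreal rho"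
proof -
  have *: "ennreal (tail K (real k) / rho) * g k = (\<integral>\<^sup>+n. (if k < n then g k else 0) \<partial>K) / ennreal rho" for k
  proof -
    have "ennreal (tail K (real k) / rho) * g k = (ennreal (tail K (real k)) * g k) / ennreal rho"
      using rho_pos by (simp add: divide_ennreal[symmetric] ennreal_divide_times ennreal_times_divide mult.commute)
    also have "ennreal (tail K (real k)) * g k = (\<integral>\<^sup>+n. (if real k < real n then 1 else 0) * g k \<partial>K)"
      unfolding ennreal_tail by (simp add: nn_integral_multc)
    also have "\<dots> = (\<integral>\<^sup>+n. (if k < n then g k else 0) \<partial>K)"
      by (intro nn_integral_cong) auto
    finally show ?thesis .
  qed
  have "(\<Sum>k. ennreal (tail K (real k) / rho) * g k) = (\<Sum>k. \<integral>\<^sup>+n. (if k < n then g k else 0) / ennreal rho \<partial>K)"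
    unfolding * by (simp add: nn_integral_divide)
  also have "\<dots> = (\<integral>\<^sup>+n. (\<Sum>k. (if k < n then g k else 0) / ennreal rho) \<partial>K)"
    by (rule nn_integral_suminf[symmetric]) auto
  also have "\<dots> = (\<integral>\<^sup>+n. (\<Sum>k<n. g k) / ennreal rho \<partial>K)"
  proof (rule nn_integral_cong)
    fix n
    have "(\<Sum>k. (if k < n then g k else 0) / ennreal rho) = (\<Sum>k<n. (if k < n then g k else 0) / ennreal rho)"
      by (rule suminf_finite) auto
    also have "\<dots> = (\<Sum>k<n. g k) / ennreal rho"
      by (simp add: divide_ennreal_def sum_distrib_right)
    finally show "(\<Sum>k. (if k < n then g k else 0) / ennreal rho) = (\<Sum>k<n. g k) / ennreal rho" .
  qed
  finally show ?thesis by (simp add: nn_integral_divide)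
qed

lemma pmf_equilibrium: "pmf equilibrium k = tail K (real k) / rho"
  unfolding equilibrium_def
proof (rule pmf_embed_pmf)
  show "(\<integral>\<^sup>+k. ennreal (tail K (real k) / rho) \<partial>count_space UNIV) = 1"
    using suminf_tail[of "\<lambda>_. 1"] nnmean rho_pos
    by (simp add: nn_integral_count_space_nat nnmean_def ennreal_of_nat_eq_real_of_nat ennreal_divide_self)
qed (use rho_pos in auto)

lemma nn_integral_equilibrium:
  "(\<integral>\<^sup>+k. g k \<partial>equilibrium) = (\<integral>\<^sup>+n. (\<Sum>k<n. g k) \<partial>K) / ennreal rho"
  by (simp add: nn_integral_pmf_nat pmf_equilibrium suminf_tail)

lemma integrable_K: "integrable (measure_pmf K) real" and expectation_K: "expect K real = rho"
  using nnmean_eq_ennreal[OF nnmean] rho_pos by auto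

lemma pgf_equilibrium:
  assumes "0 \<le> z" "z < 1"
  shows "pgf equilibrium z = (1 - pgf K z) / (rho * (1 - z))"
proof -
  have i: "integrable (measure_pmf K) (\<lambda>n. (1 - z ^ n) / (1 - z))" using assms by (auto intro!: integrable_divide)
  have "ennreal (pgf equilibrium z) = (\<integral>\<^sup>+k. ennreal (z ^ k) \<partial>equilibrium)"
    unfolding pgf_def using assms by (intro nn_integral_eq_integral[symmetric]) auto
  also have "\<dots> = (\<integral>\<^sup>+n. ennreal ((1 - z ^ n) / (1 - z)) \<partial>K) / ennreal rho"
    unfolding nn_integral_equilibrium
  proof (intro arg_cong[where f = "\<lambda>x. x / ennreal rho"] nn_integral_cong)
    fix n
    have "(\<Sum>k<n. ennreal (z ^ k)) = ennreal (\<Sum>k<n. z ^ k)" using assms by (intro sum_ennreal) auto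
    also have "(\<Sum>k<n. z ^ k) = (1 - z ^ n) / (1 - z)" using assms by (simp add: one_diff_power_eq)
    finally show "(\<Sum>k<n. ennreal (z ^ k)) = ennreal ((1 - z ^ n) / (1 - z))" .
  qed
  also have "(\<integral>\<^sup>+n. ennreal ((1 - z ^ n) / (1 - z)) \<partial>K) = ennreal (expect K (\<lambda>n. (1 - z ^ n) / (1 - z)))"
    using assms by (intro nn_integral_eq_integral i) (auto simp: power_le_one)
  also have "expect K (\<lambda>n. (1 - z ^ n) / (1 - z)) = (1 - pgf K z) / (1 - z)"
    unfolding pgf_def using assms by simp
  also have "ennreal ((1 - pgf K z) / (1 - z)) / ennreal rho = ennreal ((1 - pgf K z) / (1 - z) / rho)"
    using assms rho_pos by (intro divide_ennreal) (auto simp: pgf_le_1)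
  finally have "pgf equilibrium z = (1 - pgf K z) / (1 - z) / rho"
    using assms rho_pos by (subst (asm) ennreal_inj) (auto simp: pgf_nonneg pgf_le_1)
  then show ?thesis by (simp add: mult.commute)
qed

text \<open>The integral of \<open>tail K\<close> over the half-line beyond y, written as an
  expectation so that the interval bounds required by \<open>karamata\<close> are pointwise
  inequalities.\<close>

definition U :: "real \<Rightarrow> real" where
  "U y = expect K (\<lambda>n. max (real n - y) 0)"

lemma U_integrable: "integrable (measure_pmf K) (\<lambda>n. max (real n - y) 0)"
  using integrable_K by (intro integrable_max) auto

lemma U_diff:
  assumes "0 \<le> x" "x \<le> y"
  shows "(y - x) * tail K y \<le> U x - U y" "U x - U y \<le> (y - x) * tail K x"
proof -
  have eq: "U x - U y = expect K (\<lambda>n. max (real n - x) 0 - max (real n - y) 0)"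
    unfolding U_def using U_integrable by simp
  have "expect K (\<lambda>n. (y - x) * (if y < real n then 1 else 0)) \<le> U x - U y"
    unfolding eq by (intro integral_mono) (use assms U_integrable in auto)
  then show "(y - x) * tail K y \<le> U x - U y" by (simp add: tail_altdef)
  have "U x - U y \<le> expect K (\<lambda>n. (y - x) * (if x < real n then 1 else 0))"
    unfolding eq by (intro integral_mono) (use assms U_integrable in auto)
  then show "U x - U y \<le> (y - x) * tail K x" by (simp add: tail_altdef)
qed

lemma U_tendsto_0: "(U \<longlongrightarrow> 0) at_top"
proof -
  have "((\<lambda>y. expect K (\<lambda>n. max (real n - y) 0)) \<longlongrightarrow> expect K (\<lambda>n. 0 :: real)) at_top"
  proof (rule integral_dominated_convergence_at_top[where w = real])
    show "AE n in measure_pmf K. ((\<lambda>y. max (real n - y) 0) \<longlongrightarrow> 0) at_top"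
    proof (rule AE_I2)
      fix n :: nat
      have "\<forall>\<^sub>F y in at_top. max (real n - y) 0 = 0" using eventually_ge_at_top[of "real n"] by eventually_elim auto
      then show "((\<lambda>y. max (real n - y) 0) \<longlongrightarrow> 0) at_top" by (rule tendsto_eventually)
    qed
    show "\<forall>\<^sub>F y in at_top. AE n in measure_pmf K. norm (max (real n - y) 0) \<le> real n"
      using eventually_ge_at_top[of 0] by eventually_elim auto
  qed (use integrable_K in auto)
  then show ?thesis by (simp add: U_def[abs_def])
qed

text \<open>The equilibrium law is discrete: the least integer above x is its floor plus 1, and
  summing \<open>tail K\<close> from an integer on gives \<open>U\<close> at that integer
  exactly.\<close>

lemma tail_equilibrium:
  assumes "0 \<le> x"
  shows "tail equilibrium x = U (real (nat \<lfloor>x\<rfloor>) + 1) / rho"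
proof -
  let ?N = "nat \<lfloor>x\<rfloor> + 1"
  have gt: "x < real k \<longleftrightarrow> ?N \<le> k" for k using assms by linarith
  have "ennreal (tail equilibrium x) = (\<integral>\<^sup>+n. (\<Sum>k<n. if x < real k then 1 else 0) \<partial>K) / ennreal rho"
    unfolding ennreal_tail nn_integral_equilibrium ..
  also have "(\<lambda>n. \<Sum>k<n. if x < real k then 1 else 0) = (\<lambda>n. ennreal (max (real n - real ?N) 0))"
  proof
    fix n
    have "(\<Sum>k<n. if x < real k then 1 else 0) = (\<Sum>k\<in>{?N..<n}. 1 :: ennreal)"
      unfolding gt by (rule sum.mono_neutral_cong_right) auto
    also have "\<dots> = ennreal (real (n - ?N))" by (simp add: ennreal_of_nat_eq_real_of_nat)
    also have "real (n - ?N) = max (real n - real ?N) 0" by (simp add: of_nat_diff max_def)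
    finally show "(\<Sum>k<n. if x < real k then 1 else 0) = ennreal (max (real n - real ?N) 0)" .
  qed
  also have "(\<integral>\<^sup>+n. ennreal (max (real n - real ?N) 0) \<partial>K) = ennreal (U (real ?N))"
    unfolding U_def by (rule nn_integral_eq_integral[OF U_integrable]) auto
  also have "\<dots> / ennreal rho = ennreal (U (real ?N) / rho)"
    using rho_pos by (intro divide_ennreal) (auto simp: U_def intro!: Bochner_Integration.integral_nonneg)
  finally show ?thesis
    using rho_pos by (subst (asm) ennreal_inj) (auto simp: U_def add.commute intro!: Bochner_Integration.integral_nonneg)
qed

text \<open>Karamata's theorem along the rounded argument, which is asymptotic to x and so is
  harmless by \<open>rv_arg_asymp\<close>.\<close>

lemma tail_equilibrium_asymp:
  assumes K: "rv (tail K) a" and a: "1 < a"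
  shows "((\<lambda>x. tail equilibrium x / (x * tail K x)) \<longlongrightarrow> 1 / ((a - 1) * rho)) at_top"
proof -
  define N where "N = (\<lambda>x::real. real (nat \<lfloor>x\<rfloor>) + 1)"
  have N: "filterlim N at_top at_top" "((\<lambda>x. N x / x) \<longlongrightarrow> 1) at_top"
    unfolding N_def by real_asymp+
  have 1: "((\<lambda>x. U (N x) / (N x * tail K (N x))) \<longlongrightarrow> 1 / (a - 1)) at_top"
    using filterlim_compose[OF karamata[OF K a U_diff U_tendsto_0] N(1)] by simp
  have 2: "((\<lambda>x. tail K (N x) / tail K x) \<longlongrightarrow> 1) at_top"
    using rv_arg_asymp[OF K _ N(2)] by simp
  have "((\<lambda>x. U (N x) / (N x * tail K (N x)) * (N x / x) * (tail K (N x) / tail K x) / rho) \<longlongrightarrow> 1 / (a - 1) * 1 * 1 / rho) at_top"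
    by (intro tendsto_divide tendsto_mult 1 2 N tendsto_const) (use rho_pos in auto)
  then have "((\<lambda>x. U (N x) / (N x * tail K (N x)) * (N x / x) * (tail K (N x) / tail K x) / rho) \<longlongrightarrow> 1 / ((a - 1) * rho)) at_top"
    by simp
  then show ?thesis
  proof (rule Lim_transform_eventually)
    show "\<forall>\<^sub>F x in at_top. U (N x) / (N x * tail K (N x)) * (N x / x) * (tail K (N x) / tail K x) / rho = tail equilibrium x / (x * tail K x)"
      using eventually_gt_at_top[of 0]
    proof eventually_elim
      case (elim x)
      have "N x \<noteq> 0" by (simp add: N_def)
      moreover have "tail equilibrium x = U (N x) / rho" unfolding N_def using elim by (intro tail_equilibrium) simp
      ultimately show ?case using elim rv_pos[OF K, of "N x"] by simp
    qed
  qed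
qed

lemma rv_equilibrium:
  assumes K: "rv (tail K) a" and a: "1 < a"
  shows "rv (tail equilibrium) (a - 1)"
  unfolding rv_def
proof (intro conjI allI impI)
  note lim = tail_equilibrium_asymp[OF K a]
  show "antimono (tail equilibrium)" by (intro antimonoI tail_antimono)
  have "\<forall>\<^sub>F x in at_top. 0 < tail equilibrium x / (x * tail K x)"
    by (rule order_tendstoD(1)[OF lim]) (use a rho_pos in simp)
  \<comment> \<open>Positivity far out extends to every x because a tail is decreasing.\<close>
  then have ev: "\<forall>\<^sub>F x in at_top. 0 < tail equilibrium x"
    using eventually_gt_at_top[of 0]
  proof eventually_elim
    case (elim x)
    then have "0 < x * tail K x" using rv_pos[OF K, of x] by simp
    then show ?case using elim(1) by (auto simp: zero_less_divide_iff)
  qed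
  show "0 < tail equilibrium x" for x
  proof -
    obtain y where "x \<le> y" "0 < tail equilibrium y"
      using eventually_happens[OF eventually_conj[OF ev eventually_ge_at_top[of x]]] by auto
    then show ?thesis using tail_antimono[of x y equilibrium] by linarith
  qed
  fix c :: real assume c: "0 < c"
  have "((\<lambda>x. tail equilibrium (c * x) / (c * x * tail K (c * x)) * (c * (tail K (c * x) / tail K x)) / (tail equilibrium x / (x * tail K x)))
     \<longlongrightarrow> 1 / ((a - 1) * rho) * (c * c powr (- a)) / (1 / ((a - 1) * rho))) at_top"
    by (intro tendsto_divide tendsto_mult lim filterlim_compose[OF lim filterlim_mult_at_top[OF c]] rv_lim[OF K c] tendsto_const)
      (use a rho_pos in auto)
  also have "1 / ((a - 1) * rho) * (c * c powr (- a)) / (1 / ((a - 1) * rho)) = c powr (- (a - 1))"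
    using a rho_pos c by (simp add: powr_diff powr_minus field_simps)
  finally show "((\<lambda>x. tail equilibrium (c * x) / tail equilibrium x) \<longlongrightarrow> c powr (- (a - 1))) at_top"
  proof (rule Lim_transform_eventually)
    show "\<forall>\<^sub>F x in at_top. tail equilibrium (c * x) / (c * x * tail K (c * x)) * (c * (tail K (c * x) / tail K x)) / (tail equilibrium x / (x * tail K x))
       = tail equilibrium (c * x) / tail equilibrium x"
      using eventually_gt_at_top[of 0]
    proof eventually_elim
      case (elim x)
      have "tail K x \<noteq> 0" "tail K (c * x) \<noteq> 0" using rv_pos[OF K, of x] rv_pos[OF K, of "c * x"] by auto
      then show ?case using elim c by simp
    qed
  qed
qed

end


subsection \<open>Mixed Poisson laws\<close>

text \<open>Strictness is the point: it makes the exponential rates of the Poisson deviations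
  smaller than 1.\<close>

lemma one_add_less_exp:
  fixes x :: real
  assumes "- 1 < x" "x \<noteq> 0" shows "1 + x < exp x"
proof -
  have "(1 + x / 2)\<^sup>2 = 1 + x + x\<^sup>2 / 4" by (simp add: power2_eq_square algebra_simps)
  then have "1 + x < (1 + x / 2)\<^sup>2" using assms by simp
  also have "\<dots> \<le> (exp (x / 2))\<^sup>2" using assms exp_ge_add_one_self[of "x / 2"] by (intro power_mono) auto
  also have "\<dots> = exp x" by (simp add: power2_eq_square exp_add[symmetric])
  finally show ?thesis .
qed

lemma poisson_power_moment:
  assumes "0 < y" "0 \<le> s"
  shows "(\<integral>\<^sup>+k. ennreal (s ^ k) \<partial>poisson_pmf y) = ennreal (exp (y * (s - 1)))"
proof -
  have "(\<lambda>k. (y * s) ^ k /\<^sub>R fact k) sums exp (y * s)" by (rule exp_converges)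
  then have "(\<lambda>k. (y * s) ^ k /\<^sub>R fact k * exp (- y)) sums (exp (y * s) * exp (- y))" by (rule sums_mult2)
  also have "(\<lambda>k. (y * s) ^ k /\<^sub>R fact k * exp (- y)) = (\<lambda>k. y ^ k / fact k * exp (- y) * s ^ k)"
    by (simp add: power_mult_distrib field_simps)
  also have "exp (y * s) * exp (- y) = exp (y * (s - 1))" by (simp add: exp_add[symmetric] algebra_simps)
  finally have *: "(\<lambda>k. y ^ k / fact k * exp (- y) * s ^ k) sums exp (y * (s - 1))" .
  have "(\<integral>\<^sup>+k. ennreal (s ^ k) \<partial>poisson_pmf y) = (\<Sum>k. ennreal (y ^ k / fact k * exp (- y) * s ^ k))"
    using assms by (simp add: nn_integral_pmf_nat ennreal_mult[symmetric])
  also have "\<dots> = ennreal (exp (y * (s - 1)))"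
    using * assms by (subst suminf_ennreal2) (auto simp: sums_iff)
  finally show ?thesis .
qed

lemma nnmean_poisson:
  assumes "0 < y" shows "nnmean (poisson_pmf y) = ennreal y"
proof -
  have "(\<lambda>k. y ^ k /\<^sub>R fact k) sums exp y" by (rule exp_converges)
  then have "(\<lambda>k. y * exp (- y) * (y ^ k /\<^sub>R fact k)) sums (y * exp (- y) * exp y)" by (rule sums_mult)
  moreover have "y * exp (- y) * exp y = y" by (simp add: exp_minus)
  moreover have "y * exp (- y) * (y ^ k /\<^sub>R fact k) = y ^ Suc k / fact (Suc k) * exp (- y) * real (Suc k)" for k
  proof -
    have "y ^ Suc k / fact (Suc k) * exp (- y) * real (Suc k) = y * exp (- y) * y ^ k * (real (Suc k) / fact (Suc k))"
      by (simp only: power_Suc times_divide_eq_right times_divide_eq_left mult_ac)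
    also have "real (Suc k) / fact (Suc k) = 1 / (fact k :: real)"
      by (simp add: fact_Suc del: of_nat_Suc)
    finally show ?thesis by (simp add: divide_inverse mult_ac)
  qed
  ultimately have "(\<lambda>k. y ^ Suc k / fact (Suc k) * exp (- y) * real (Suc k)) sums y" by simp
  then have *: "(\<lambda>k. y ^ k / fact k * exp (- y) * real k) sums y"
    using sums_Suc_iff[of "\<lambda>k. y ^ k / fact k * exp (- y) * real k" y] by simp
  have "nnmean (poisson_pmf y) = (\<Sum>k. ennreal (y ^ k / fact k * exp (- y) * real k))"
    unfolding nnmean_def using assms
    by (simp add: nn_integral_pmf_nat ennreal_mult[symmetric])
  also have "\<dots> = ennreal y"
    using * assms by (subst suminf_ennreal2) (auto simp: sums_iff)
  finally show ?thesis .
qed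

lemma poisson_tail_upper:
  assumes "0 < y" "1 \<le> s" shows "tail (poisson_pmf y) x \<le> exp (y * (s - 1)) * s powr (- x)"
proof -
  have "ennreal (tail (poisson_pmf y) x * s powr x) = (\<integral>\<^sup>+k. ennreal (s powr x) * (if x < real k then 1 else 0) \<partial>poisson_pmf y)"
    by (simp add: ennreal_mult'' ennreal_tail nn_integral_cmult mult.commute)
  also have "\<dots> \<le> (\<integral>\<^sup>+k. ennreal (s ^ k) \<partial>poisson_pmf y)"
    using assms by (intro nn_integral_mono) (auto simp: powr_realpow[symmetric] intro!: powr_mono)
  also have "\<dots> = ennreal (exp (y * (s - 1)))" using assms by (intro poisson_power_moment) auto
  finally show ?thesis using assms by (simp add: powr_minus field_simps)
qed

lemma poisson_tail_lower:
  assumes "0 < y" "0 < s" "s \<le> 1" shows "1 - tail (poisson_pmf y) x \<le> exp (y * (s - 1)) * s powr (- x)"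
proof -
  have "1 - tail (poisson_pmf y) x = expect (poisson_pmf y) (\<lambda>k. if x < real k then 0 else 1)"
  proof -
    have "1 - tail (poisson_pmf y) x = expect (poisson_pmf y) (\<lambda>k. 1 - (if x < real k then 1 else 0))"
      by (simp add: tail_altdef)
    also have "(\<lambda>k. 1 - (if x < real k then 1 else 0)) = (\<lambda>k. if x < real k then 0 else 1 :: real)" by auto
    finally show ?thesis .
  qed
  then have "ennreal (1 - tail (poisson_pmf y) x) = (\<integral>\<^sup>+k. ennreal (if x < real k then 0 else 1) \<partial>poisson_pmf y)"
    by (simp add: nn_integral_eq_integral)
  then have "ennreal ((1 - tail (poisson_pmf y) x) * s powr x) = (\<integral>\<^sup>+k. ennreal (s powr x) * ennreal (if x < real k then 0 else 1) \<partial>poisson_pmf y)"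
    by (simp add: ennreal_mult'' nn_integral_cmult mult.commute)
  also have "\<dots> \<le> (\<integral>\<^sup>+k. ennreal (s ^ k) \<partial>poisson_pmf y)"
    using assms by (intro nn_integral_mono) (auto simp: powr_realpow[symmetric] intro!: powr_mono')
  also have "\<dots> = ennreal (exp (y * (s - 1)))" using assms by (intro poisson_power_moment) auto
  finally show ?thesis using assms by (simp add: powr_minus field_simps)
qed

section \<open>The number of arrivals during a service time\<close>

locale service_law = serv: real_distribution B for B :: "real measure" +
  fixes lam :: real
  assumes lam: "0 < lam" and pos: "cdf B 0 = 0" and mean: "integrable B (\<lambda>x. x)"
begin

lemma AE_pos: "AE x in B. 0 < x"
proof (rule AE_I)
  show "{x \<in> space B. \<not> 0 < x} \<subseteq> {..0}" by auto
  show "emeasure B {..0} = 0" using pos by (simp add: cdf_def serv.emeasure_eq_measure)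
qed auto

text \<open>The number of arrivals during a service of length x. The value for x \<le> 0 is a
  default on a null set of \<open>B\<close>, since the Poisson law requires a positive rate.\<close>

definition kernel :: "real \<Rightarrow> nat pmf" where
  "kernel x = (if 0 < x then poisson_pmf (lam * x) else return_pmf 0)"

text \<open>The Poisson mixture is built from its point masses because the mixing law
  \<open>B\<close> is a measure on the reals and not a \<open>pmf\<close>.\<close>

definition arrivals :: "nat pmf" where
  "arrivals = embed_pmf (\<lambda>k. \<integral>x. pmf (kernel x) k \<partial>B)"

lemma measurable_kernel [measurable]: "(\<lambda>x. pmf (kernel x) k) \<in> borel_measurable borel"
proof -
  have "(\<lambda>x. pmf (kernel x) k) = (\<lambda>x. if 0 < x then (lam * x) ^ k / fact k * exp (- (lam * x)) else pmf (return_pmf 0) k)"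
    using lam by (auto simp: kernel_def)
  then show ?thesis by simp
qed

lemma integrable_kernel: "integrable B (\<lambda>x. pmf (kernel x) k)"
  by (rule serv.integrable_const_bound[where B = 1]) (auto simp: pmf_le_1)

lemma pmf_arrivals: "pmf arrivals k = (\<integral>x. pmf (kernel x) k \<partial>B)"
  and ennreal_pmf_arrivals: "ennreal (pmf arrivals k) = (\<integral>\<^sup>+x. ennreal (pmf (kernel x) k) \<partial>B)"
proof -
  have e: "ennreal (\<integral>x. pmf (kernel x) k \<partial>B) = (\<integral>\<^sup>+x. ennreal (pmf (kernel x) k) \<partial>B)" for k
    by (rule nn_integral_eq_integral[symmetric, OF integrable_kernel]) auto
  show *: "pmf arrivals k = (\<integral>x. pmf (kernel x) k \<partial>B)" for k
    unfolding arrivals_def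
  proof (rule pmf_embed_pmf)
    have "(\<integral>\<^sup>+k. ennreal (\<integral>x. pmf (kernel x) k \<partial>B) \<partial>count_space UNIV) = (\<Sum>k. \<integral>\<^sup>+x. ennreal (pmf (kernel x) k) \<partial>B)"
      unfolding e by (simp add: nn_integral_count_space_nat)
    also have "\<dots> = (\<integral>\<^sup>+x. (\<Sum>k. ennreal (pmf (kernel x) k)) \<partial>B)"
      by (rule nn_integral_suminf[symmetric]) auto
    also have "\<dots> = (\<integral>\<^sup>+x. 1 \<partial>B)"
      by (simp add: nn_integral_count_space_nat[symmetric] nn_integral_pmf measure_pmf.emeasure_space_1[simplified])
    finally show "(\<integral>\<^sup>+k. ennreal (\<integral>x. pmf (kernel x) k \<partial>B) \<partial>count_space UNIV) = 1"
      using serv.emeasure_space_1 by simp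
  qed (auto intro!: Bochner_Integration.integral_nonneg)
  show "ennreal (pmf arrivals k) = (\<integral>\<^sup>+x. ennreal (pmf (kernel x) k) \<partial>B)" unfolding * e ..
qed

lemma nn_integral_arrivals:
  "(\<integral>\<^sup>+k. g k \<partial>arrivals) = (\<integral>\<^sup>+x. (\<integral>\<^sup>+k. g k \<partial>kernel x) \<partial>B)"
proof -
  have "(\<integral>\<^sup>+k. g k \<partial>arrivals) = (\<Sum>k. \<integral>\<^sup>+x. ennreal (pmf (kernel x) k) * g k \<partial>B)"
    by (simp add: nn_integral_pmf_nat ennreal_pmf_arrivals nn_integral_multc)
  also have "\<dots> = (\<integral>\<^sup>+x. (\<Sum>k. ennreal (pmf (kernel x) k) * g k) \<partial>B)"
    by (rule nn_integral_suminf[symmetric]) auto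
  finally show ?thesis by (simp add: nn_integral_pmf_nat)
qed

lemma integrable_exp:
  assumes "0 \<le> s" shows "integrable B (\<lambda>x. exp (- s * x))"
proof (rule serv.integrable_const_bound[where B = 1])
  show "AE x in B. norm (exp (- s * x)) \<le> 1"
    using AE_pos by eventually_elim (use assms in auto)
qed auto

lemma LST_pos: assumes "0 \<le> s" shows "0 < LST B s"
proof -
  have "0 \<le> LST B s" unfolding LST_def by (intro Bochner_Integration.integral_nonneg) auto
  moreover have "LST B s \<noteq> 0"
    unfolding LST_def by (subst integral_nonneg_eq_0_iff_AE[OF integrable_exp[OF assms]]) auto
  ultimately show ?thesis by simp
qed

lemma pgf_arrivals:
  assumes z: "0 \<le> z" "z \<le> 1" shows "pgf arrivals z = LST B (lam * (1 - z))"
proof -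
  have i: "integrable B (\<lambda>x. exp (- (lam * (1 - z)) * x))"
    using z lam by (intro integrable_exp) auto
  have "ennreal (pgf arrivals z) = (\<integral>\<^sup>+k. ennreal (z ^ k) \<partial>arrivals)"
    unfolding pgf_def using z by (intro nn_integral_eq_integral[symmetric]) auto
  also have "\<dots> = (\<integral>\<^sup>+x. ennreal (exp (- (lam * (1 - z)) * x)) \<partial>B)"
    unfolding nn_integral_arrivals
  proof (rule nn_integral_cong_AE)
    show "AE x in B. (\<integral>\<^sup>+k. ennreal (z ^ k) \<partial>kernel x) = ennreal (exp (- (lam * (1 - z)) * x))"
      using AE_pos
    proof eventually_elim
      case (elim x)
      have "(\<integral>\<^sup>+k. ennreal (z ^ k) \<partial>poisson_pmf (lam * x)) = ennreal (exp (lam * x * (z - 1)))"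
        using elim lam z by (intro poisson_power_moment) auto
      then show ?case using elim by (simp add: kernel_def algebra_simps)
    qed
  qed
  also have "\<dots> = ennreal (LST B (lam * (1 - z)))"
    unfolding LST_def by (rule nn_integral_eq_integral[OF i]) auto
  finally show ?thesis
    using z by (subst (asm) ennreal_inj) (auto simp: pgf_nonneg LST_def intro!: Bochner_Integration.integral_nonneg)
qed

lemma pgf_arrivals_pos: "0 \<le> z \<Longrightarrow> z \<le> 1 \<Longrightarrow> 0 < pgf arrivals z"
  using lam by (simp add: pgf_arrivals LST_pos)

lemma mean1_pos: "0 < mean1 B"
proof -
  have "0 \<le> mean1 B" unfolding mean1_def using AE_pos by (intro integral_nonneg_AE) (auto elim: eventually_mono)
  moreover have "mean1 B \<noteq> 0"
  proof
    assume "mean1 B = 0"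
    then have "AE x in B. x = 0"
      unfolding mean1_def using AE_pos by (subst (asm) integral_nonneg_eq_0_iff_AE[OF mean]) (auto elim: eventually_mono)
    with AE_pos have "AE x in B. False" by eventually_elim auto
    then show False by simp
  qed
  ultimately show ?thesis by simp
qed

lemma nnmean_arrivals: "nnmean arrivals = ennreal (rho lam B)"
proof -
  have "nnmean arrivals = (\<integral>\<^sup>+x. nnmean (kernel x) \<partial>B)" unfolding nnmean_def by (rule nn_integral_arrivals)
  also have "\<dots> = (\<integral>\<^sup>+x. ennreal (lam * x) \<partial>B)"
  proof (rule nn_integral_cong_AE)
    show "AE x in B. nnmean (kernel x) = ennreal (lam * x)"
      using AE_pos by eventually_elim (use lam in \<open>simp add: kernel_def nnmean_poisson\<close>)
  qed
  also have "\<dots> = ennreal (\<integral>x. lam * x \<partial>B)"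
    by (rule nn_integral_eq_integral) (use mean AE_pos lam in \<open>auto elim!: eventually_mono\<close>)
  finally show ?thesis by (simp add: rho_def mean1_def)
qed

lemma tail_kernel_measurable [measurable]: "(\<lambda>t. tail (kernel t) x) \<in> borel_measurable borel"
proof -
  have "(\<lambda>t. ennreal (tail (kernel t) x)) = (\<lambda>t. \<Sum>k. ennreal (pmf (kernel t) k) * (if x < real k then 1 else 0))"
    by (simp add: ennreal_tail nn_integral_pmf_nat)
  also have "\<dots> \<in> borel_measurable borel" by measurable
  finally have "(\<lambda>t. enn2real (ennreal (tail (kernel t) x))) \<in> borel_measurable borel" by measurable
  then show ?thesis by simp
qed

lemma tail_kernel_integrable: "integrable B (\<lambda>t. tail (kernel t) x)"
  by (rule serv.integrable_const_bound[where B = 1]) auto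

lemma tail_arrivals: "tail arrivals x = (\<integral>t. tail (kernel t) x \<partial>B)"
proof -
  have "ennreal (tail arrivals x) = (\<integral>\<^sup>+t. ennreal (tail (kernel t) x) \<partial>B)"
    unfolding ennreal_tail by (rule nn_integral_arrivals)
  also have "\<dots> = ennreal (\<integral>t. tail (kernel t) x \<partial>B)"
    by (rule nn_integral_eq_integral[OF tail_kernel_integrable]) auto
  finally show ?thesis
    by (subst (asm) ennreal_inj) (auto intro!: Bochner_Integration.integral_nonneg)
qed

lemma integral_indicator_greaterThan: "(\<integral>t. (if c < t then d else 0) \<partial>B) = d * measure B {c<..}"
proof -
  have "(\<integral>t. (if c < t then d else 0) \<partial>B) = (\<integral>t. d * indicator {c<..} t \<partial>B)"
    by (intro Bochner_Integration.integral_cong) (auto simp: indicator_def)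
  then show ?thesis by simp
qed

text \<open>A Poisson variable with mean lam t concentrates at its mean, so more than x arrivals
  occur essentially when t exceeds x / lam; the deviations are exponentially small in x and lose
  against a regularly varying tail.\<close>

theorem tail_arrivals_asymp:
  assumes u: "rv (\<lambda>t. measure B {t<..}) a"
  shows "((\<lambda>x. tail arrivals x / measure B {x<..}) \<longlongrightarrow> lam powr a) at_top"
proof -
  have "((\<lambda>x. tail arrivals x / measure B {x<..}) \<longlongrightarrow> (1 / lam) powr (- a)) at_top"
  proof (rule rv_sandwich[OF u])
    show "0 < 1 / lam" using lam by simp
  next
    fix d :: real assume d: "0 < d" "d < 1"
    \<comment> \<open>The Chernoff rate for a Poisson mean of at most \<open>(1 - d) * x\<close> to
      exceed x, with the optimal parameter \<open>s = 1 / (1 - d)\<close>.\<close>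
    define r where "r = (1 - d) * exp d"
    have r: "0 < r" "r < 1"
    proof -
      show "0 < r" using d by (simp add: r_def)
      have "1 + (- d) < exp (- d)" using d by (intro one_add_less_exp) auto
      then show "r < 1" by (simp add: r_def exp_minus field_simps)
    qed
    have "\<forall>\<^sub>F x in at_top. r powr x / measure B {x<..} < d"
      by (rule order_tendstoD(2)[OF rv_exponential_negligible[OF u r]]) (rule d)
    then show "\<forall>\<^sub>F x in at_top. tail arrivals x \<le> measure B {(1 - d) * (1 / lam) * x<..} + d * measure B {x<..}"
      using eventually_gt_at_top[of 0]
    proof eventually_elim
      case (elim x)
      let ?c = "(1 - d) * (1 / lam) * x"
      have "tail arrivals x \<le> (\<integral>t. (if ?c < t then 1 else 0) + r powr x \<partial>B)"
        unfolding tail_arrivals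
      proof (rule integral_mono_AE[OF tail_kernel_integrable])
        show "integrable B (\<lambda>t. (if ?c < t then 1 else 0) + r powr x)"
          by (rule serv.integrable_const_bound[where B = "1 + r powr x"]) auto
        show "AE t in B. tail (kernel t) x \<le> (if ?c < t then 1 else 0) + r powr x"
          using AE_pos
        proof eventually_elim
          fix t :: real assume t: "0 < t"
          show "tail (kernel t) x \<le> (if ?c < t then 1 else 0) + r powr x"
          proof (cases "?c < t")
            case True
            then show ?thesis by (simp add: add_increasing2)
          next
            case False
            then have lt: "lam * t \<le> (1 - d) * x" using lam by (simp add: field_simps)
            have "tail (kernel t) x \<le> exp (lam * t * (1 / (1 - d) - 1)) * (1 / (1 - d)) powr (- x)"
              using t lam d by (simp add: kernel_def) (rule poisson_tail_upper; simp add: field_simps)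
            also have "\<dots> \<le> exp ((1 - d) * x * (1 / (1 - d) - 1)) * (1 / (1 - d)) powr (- x)"
            proof -
              have "0 \<le> 1 / (1 - d) - 1" using d by (simp add: field_simps)
              from mult_right_mono[OF lt this] show ?thesis by (intro mult_right_mono) (simp_all only: exp_le_cancel_iff powr_ge_zero)
            qed
            also have "(1 - d) * x * (1 / (1 - d) - 1) = d * x" using d by (simp add: field_simps)
            also have "(1 / (1 - d)) powr (- x) = (1 - d) powr x" using d by (simp add: powr_minus powr_divide)
            also have "exp (d * x) * (1 - d) powr x = r powr x"
              using d by (simp add: r_def powr_mult exp_powr_real mult.commute)
            finally show ?thesis using False by simp
          qed
        qed
      qed
      also have "\<dots> = measure B {?c<..} + r powr x"
        using serv.prob_space by (subst Bochner_Integration.integral_add)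
          (auto simp: integral_indicator_greaterThan intro!: serv.integrable_const_bound[where B = 1])
      also have "r powr x \<le> d * measure B {x<..}" using elim rv_pos[OF u, of x] by (simp add: field_simps)
      finally show ?case by simp
    qed
  next
    fix d :: real assume d: "0 < d" "d < 1"
    \<comment> \<open>The rate of the opposite deviation, with \<open>s = 1 / (1 + d)\<close>. Here
      \<open>r powr x\<close> only has to fall below d, as it multiplies a probability already
      present.\<close>
    define r where "r = (1 + d) * exp (- d)"
    have r: "0 < r" "r < 1"
    proof -
      show "0 < r" using d by (simp add: r_def)
      have "1 + d < exp d" using d by (intro one_add_less_exp) auto
      then show "r < 1" by (simp add: r_def exp_minus field_simps)
    qed
    have "((\<lambda>x. r powr x) \<longlongrightarrow> 0) at_top" using r by real_asymp
    then have "\<forall>\<^sub>F x in at_top. r powr x < d" by (rule order_tendstoD(2)) (rule d)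
    then show "\<forall>\<^sub>F x in at_top. (1 - d) * measure B {(1 + d) * (1 / lam) * x<..} \<le> tail arrivals x"
      using eventually_gt_at_top[of 0]
    proof eventually_elim
      case (elim x)
      let ?c = "(1 + d) * (1 / lam) * x"
      have "(1 - d) * measure B {?c<..} = (\<integral>t. (if ?c < t then 1 - d else 0) \<partial>B)"
        by (simp add: integral_indicator_greaterThan)
      also have "\<dots> \<le> tail arrivals x"
        unfolding tail_arrivals
      proof (rule integral_mono_AE[OF _ tail_kernel_integrable])
        show "integrable B (\<lambda>t. if ?c < t then 1 - d else 0)"
          by (rule serv.integrable_const_bound[where B = 1]) (use d in auto)
        show "AE t in B. (if ?c < t then 1 - d else 0) \<le> tail (kernel t) x"
          using AE_pos
        proof eventually_elim
          fix t :: real assume t: "0 < t"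
          show "(if ?c < t then 1 - d else 0) \<le> tail (kernel t) x"
          proof (cases "?c < t")
            case True
            then have lt: "(1 + d) * x \<le> lam * t" using lam by (simp add: field_simps)
            have "1 - tail (kernel t) x \<le> exp (lam * t * (1 / (1 + d) - 1)) * (1 / (1 + d)) powr (- x)"
              using t lam d by (simp add: kernel_def) (rule poisson_tail_lower; simp add: field_simps)
            also have "\<dots> \<le> exp ((1 + d) * x * (1 / (1 + d) - 1)) * (1 / (1 + d)) powr (- x)"
            proof -
              have "1 / (1 + d) - 1 \<le> 0" using d by (simp add: field_simps)
              from mult_right_mono_neg[OF lt this] show ?thesis by (intro mult_right_mono) (simp_all only: exp_le_cancel_iff powr_ge_zero)
            qed
            also have "(1 + d) * x * (1 / (1 + d) - 1) = - d * x" using d by (simp add: field_simps)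
            also have "(1 / (1 + d)) powr (- x) = (1 + d) powr x" using d by (simp add: powr_minus powr_divide)
            also have "exp (- d * x) * (1 + d) powr x = r powr x"
              using d by (simp add: r_def powr_mult exp_powr_real mult.commute)
            finally show ?thesis using True elim by simp
          qed simp
        qed
      qed
      finally show ?case .
    qed
  qed
  then show ?thesis using lam by (simp add: powr_minus powr_divide)
qed

lemma rv_arrivals:
  assumes u: "rv (\<lambda>t. measure B {t<..}) a"
  shows "rv (tail arrivals) a"
proof (rule rv_asymp[OF u _ _ tail_arrivals_asymp[OF u]])
  show "antimono (tail arrivals)" by (intro antimonoI tail_antimono)
  show "0 < lam powr a" using lam by simp
  then have ev: "\<forall>\<^sub>F x in at_top. 0 < tail arrivals x / measure B {x<..}"
    by (rule order_tendstoD(1)[OF tail_arrivals_asymp[OF u]])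
  fix x :: real
  obtain y where y: "x \<le> y" "0 < tail arrivals y / measure B {y<..}"
    using eventually_happens[OF eventually_conj[OF ev eventually_ge_at_top[of x]]] by auto
  then have "0 < tail arrivals y" using rv_pos[OF u, of y] by (simp add: zero_less_divide_iff)
  then show "0 < tail arrivals x" using tail_antimono[OF y(1), of arrivals] by linarith
qed

end

text \<open>The asymptotic equivalence gives positivity only far out; monotonicity extends it to all
  arguments, as \<open>rv\<close> demands.\<close>

lemma rv_of_slowly_varying:
  assumes f: "antimono f" "\<And>x. 0 \<le> f x" and L: "slowly_varying L"
    and eq: "f \<sim>[at_top] (\<lambda>t. t powr (- a) * L t)"
  shows "rv f a"
  unfolding rv_def
proof (intro conjI allI impI)
  have Lpos: "0 < L t" if "0 < t" for t using L that by (auto simp: slowly_varying_def)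
  have "((\<lambda>t. f t / (t powr (- a) * L t)) \<longlongrightarrow> 1) at_top"
    by (rule asymp_equivD_strong[OF eq]) (use eventually_gt_at_top[of 0] in \<open>eventually_elim, use Lpos in force\<close>)
  note lim = this
  have "\<forall>\<^sub>F t in at_top. 0 < f t / (t powr (- a) * L t)" by (rule order_tendstoD(1)[OF lim]) simp
  then have ev: "\<forall>\<^sub>F t in at_top. 0 < f t"
    by eventually_elim (use f(2) in \<open>auto simp: less_le\<close>)
  show pos: "0 < f x" for x
  proof -
    obtain y where "x \<le> y" "0 < f y"
      using eventually_happens[OF eventually_conj[OF ev eventually_ge_at_top[of x]]] by auto
    then show ?thesis using antimonoD[OF f(1), of x y] by linarith
  qed
  fix c :: real assume c: "0 < c"
  have "((\<lambda>t. f (c * t) / ((c * t) powr (- a) * L (c * t)) * (c powr (- a) * (L (c * t) / L t)) / (f t / (t powr (- a) * L t)))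
     \<longlongrightarrow> 1 * (c powr (- a) * 1) / 1) at_top"
    using L c by (intro tendsto_divide tendsto_mult lim filterlim_compose[OF lim filterlim_mult_at_top[OF c]] tendsto_const)
      (auto simp: slowly_varying_def)
  then have "((\<lambda>t. f (c * t) / ((c * t) powr (- a) * L (c * t)) * (c powr (- a) * (L (c * t) / L t)) / (f t / (t powr (- a) * L t)))
     \<longlongrightarrow> c powr (- a)) at_top" by simp
  then show "((\<lambda>x. f (c * x) / f x) \<longlongrightarrow> c powr (- a)) at_top"
  proof (rule Lim_transform_eventually)
    show "\<forall>\<^sub>F t in at_top. f (c * t) / ((c * t) powr (- a) * L (c * t)) * (c powr (- a) * (L (c * t) / L t)) / (f t / (t powr (- a) * L t))
       = f (c * t) / f t"
      using eventually_gt_at_top[of 0]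
    proof eventually_elim
      case (elim t)
      have "L t \<noteq> 0" "L (c * t) \<noteq> 0" using Lpos[of t] Lpos[of "c * t"] elim c by auto
      then show ?case using elim c by (simp add: powr_mult)
    qed
  qed
qed (rule f)


subsection \<open>Auxiliary laws\<close>

lemma pmf_sums_1: "pmf p sums (1 :: real)" for p :: "nat pmf"
  using pgf_sums[of 1 p] by simp

text \<open>Comparing coefficients and adding them up forces c = 1. Thus products of generating
  functions may be compared without tracking their normalising constants.\<close>

lemma pgf_eq_scaledI:
  assumes "\<And>z. 0 \<le> z \<Longrightarrow> z < 1 \<Longrightarrow> pgf p z = c * pgf r z"
  shows "p = r"
proof -
  have *: "pmf p n = c * pmf r n" for n
  proof -
    have "pmf p n - c * pmf r n = 0"
    proof (rule powser_eq_0_right)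
      fix z :: real assume z: "0 \<le> z" "z < 1"
      have "(\<lambda>n. pmf p n * z ^ n - c * (pmf r n * z ^ n)) sums (pgf p z - c * pgf r z)"
        by (intro sums_diff sums_mult pgf_sums) (use z in auto)
      then show "(\<lambda>n. (pmf p n - c * pmf r n) * z ^ n) sums 0" using assms[OF z] by (simp add: algebra_simps)
    qed
    then show ?thesis by simp
  qed
  have "pmf p sums (c * 1)" unfolding * by (intro sums_mult pmf_sums_1)
  then have "c = 1" using sums_unique2[OF pmf_sums_1[of p]] by simp
  then show ?thesis using * by (intro pmf_eqI) simp
qed

lemma integrable_power_moments:
  assumes "(\<integral>\<^sup>+k. ennreal (s ^ k) \<partial>measure_pmf K) < \<infinity>" "1 < s"
  shows "integrable (measure_pmf K) (\<lambda>k. real k ^ j)"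
proof -
  have "(\<lambda>k::nat. real k ^ j / s ^ k) \<longlonglongrightarrow> 0" using assms(2) by real_asymp
  then have "Bseq (\<lambda>k::nat. real k ^ j / s ^ k)" by (intro convergent_imp_Bseq) (auto simp: convergent_def)
  then obtain C where C: "\<And>k. norm (real k ^ j / s ^ k) \<le> C" by (auto simp: Bseq_def)
  have "integrable (measure_pmf K) (\<lambda>k. s ^ k)"
    using assms by (intro integrableI_nonneg) auto
  then have "integrable (measure_pmf K) (\<lambda>k. C * s ^ k)" by simp
  then show ?thesis
  proof (rule Bochner_Integration.integrable_bound)
    show "AE k in measure_pmf K. norm (real k ^ j) \<le> norm (C * s ^ k)"
    proof (rule AE_I2)
      fix k
      have "real k ^ j \<le> C * s ^ k" using C[of k] assms(2) by (simp add: field_simps)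
      then show "norm (real k ^ j) \<le> norm (C * s ^ k)" by (intro order_trans[OF _ abs_ge_self[of "C * s ^ k"], folded real_norm_def]) simp
    qed
  qed simp
qed

text \<open>Starting at 1, so that the generating function is
  \<open>(1 - r) * x / (1 - r * x)\<close> and the random sum captures the part of M_c without its
  atom at 0.\<close>

definition positive_geometric :: "real \<Rightarrow> nat pmf" where
  "positive_geometric r = map_pmf Suc (geometric_pmf (1 - r))"

lemma positive_geometric:
  assumes r: "0 < r" "r < 1"
  shows "expect (positive_geometric r) real = 1 / (1 - r)"
    and "integrable (measure_pmf (positive_geometric r)) (\<lambda>k. real k ^ j)"
    and "0 \<le> x \<Longrightarrow> x \<le> 1 \<Longrightarrow> pgf (positive_geometric r) x = (1 - r) * x / (1 - r * x)"
proof -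
  have p: "1 - r \<in> {0<..1}" using r by auto
  have "expect (positive_geometric r) real = expect (geometric_pmf (1 - r)) (\<lambda>k. real k + 1)"
    by (simp add: positive_geometric_def add.commute)
  also have "\<dots> = (1 - (1 - r)) / (1 - r) + 1"
    using expectation_geometric_pmf[OF p] integrable_real_geometric_pmf[OF p] by simp
  also have "\<dots> = 1 / (1 - r)" using r by (simp add: field_simps)
  finally show "expect (positive_geometric r) real = 1 / (1 - r)" .
  \<comment> \<open>The midpoint between 1 and \<open>1 / r\<close>, a point beyond 1 where the
    power moment is still finite.\<close>
  define s where "s = (1 / r + 1) / 2"
  have "r * s = (1 + r) / 2" using r by (simp add: s_def field_simps)
  then have s: "1 < s" "0 < r * s" "r * s < 1" using r by (auto simp: s_def)
  have "(\<lambda>k. (1 - r) * s * (r * s) ^ k) sums ((1 - r) * s * (1 / (1 - r * s)))"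
    using s by (intro sums_mult geometric_sums) auto
  then have sm: "summable (\<lambda>k. (1 - r) * s * (r * s) ^ k)" by (auto simp: sums_iff)
  have "(\<integral>\<^sup>+k. ennreal (s ^ k) \<partial>positive_geometric r) = (\<Sum>k. ennreal ((1 - r) * s * (r * s) ^ k))"
  proof -
    have "ennreal (pmf (geometric_pmf (1 - r)) k) * ennreal (s ^ Suc k) = ennreal ((1 - r) * s * (r * s) ^ k)" for k
    proof -
      have "ennreal (pmf (geometric_pmf (1 - r)) k) * ennreal (s ^ Suc k) = ennreal (pmf (geometric_pmf (1 - r)) k * s ^ Suc k)"
        using s by (subst ennreal_mult) (auto intro: less_imp_le)
      also have "pmf (geometric_pmf (1 - r)) k * s ^ Suc k = (1 - r) * s * (r * s) ^ k"
        using p by (simp add: power_mult_distrib)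
      finally show ?thesis .
    qed
    then show ?thesis
      unfolding positive_geometric_def nn_integral_map_pmf
      by (simp only: nn_integral_pmf_nat)
  qed
  also have "\<dots> = ennreal (\<Sum>k. (1 - r) * s * (r * s) ^ k)"
    using sm s r by (intro suminf_ennreal2) auto
  finally show "integrable (measure_pmf (positive_geometric r)) (\<lambda>k. real k ^ j)"
    using s by (intro integrable_power_moments[where s = s]) auto
  assume x: "0 \<le> x" "x \<le> 1"
  have "r * x \<le> r * 1" using r x by (intro mult_left_mono) auto
  then have rx: "0 \<le> r * x" "r * x < 1" using r x by (simp, linarith)
  have "(\<lambda>k. x * (1 - r) * (r * x) ^ k) sums (x * (1 - r) * (1 / (1 - r * x)))"
    using rx by (intro sums_mult geometric_sums) auto
  moreover have "(\<lambda>k. pmf (geometric_pmf (1 - r)) k * x ^ Suc k) = (\<lambda>k. x * (1 - r) * (r * x) ^ k)"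
    using p by (auto simp: power_mult_distrib)
  moreover have "(\<lambda>k. pmf (geometric_pmf (1 - r)) k * x ^ Suc k) sums expect (geometric_pmf (1 - r)) (\<lambda>k. x ^ Suc k)"
    using x by (intro expectation_sums[of _ 1]) (auto simp: power_le_one simp del: power_Suc)
  ultimately have "expect (geometric_pmf (1 - r)) (\<lambda>k. x ^ Suc k) = x * (1 - r) * (1 / (1 - r * x))"
    by (simp only: sums_unique2)
  then show "pgf (positive_geometric r) x = (1 - r) * x / (1 - r * x)"
    by (simp add: pgf_def positive_geometric_def mult_ac)
qed

lemma pgf_poisson:
  assumes "0 < y" "0 \<le> z" "z \<le> 1" shows "pgf (poisson_pmf y) z = exp (- y * (1 - z))"
proof -
  have "ennreal (pgf (poisson_pmf y) z) = (\<integral>\<^sup>+k. ennreal (z ^ k) \<partial>poisson_pmf y)"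
    unfolding pgf_def using assms by (intro nn_integral_eq_integral[symmetric]) auto
  also have "\<dots> = ennreal (exp (y * (z - 1)))" using assms by (intro poisson_power_moment) auto
  finally show ?thesis using assms by (subst (asm) ennreal_inj) (auto simp: pgf_nonneg algebra_simps)
qed

lemma integrable_poisson_power: "0 < y \<Longrightarrow> integrable (measure_pmf (poisson_pmf y)) (\<lambda>k. real k ^ j)"
  by (rule integrable_power_moments[where s = 2]) (simp_all add: poisson_power_moment)

text \<open>Exponential tilting. Its generating function \<open>pgf K (p * z) / pgf K p\<close>
  turns the arguments \<open>(1 - q) * z\<close>, which arise at z1 = 0, into those of genuine laws
  with exponentially small tails.\<close>

definition tilt :: "real \<Rightarrow> nat pmf \<Rightarrow> nat pmf" where
  "tilt p K = embed_pmf (\<lambda>k. pmf K k * p ^ k / pgf K p)"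

lemma pmf_tilt:
  assumes p: "0 < p" "p \<le> 1" shows "pmf (tilt p K) k = pmf K k * p ^ k / pgf K p"
  unfolding tilt_def
proof (rule pmf_embed_pmf)
  have pos: "0 < pgf K p" using p by (rule pgf_pos)
  show nn: "0 \<le> pmf K k * p ^ k / pgf K p" for k using p pos by auto
  have "(\<lambda>k. pmf K k * p ^ k / pgf K p) sums (pgf K p / pgf K p)" using p by (intro sums_divide pgf_sums) auto
  then have "(\<Sum>k. ennreal (pmf K k * p ^ k / pgf K p)) = 1"
    using nn pos by (subst suminf_ennreal2) (auto simp: sums_iff)
  then show "(\<integral>\<^sup>+k. ennreal (pmf K k * p ^ k / pgf K p) \<partial>count_space UNIV) = 1"
    by (simp add: nn_integral_count_space_nat)
qed

lemma pgf_tilt: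
  assumes p: "0 < p" "p \<le> 1" and z: "0 \<le> z" "z \<le> 1"
  shows "pgf (tilt p K) z = pgf K (p * z) / pgf K p"
proof (rule sums_unique2)
  show "(\<lambda>k. pmf (tilt p K) k * z ^ k) sums pgf (tilt p K) z" using z by (rule pgf_sums)
  have "(\<lambda>k. pmf K k * (p * z) ^ k / pgf K p) sums (pgf K (p * z) / pgf K p)"
    using p z by (intro sums_divide pgf_sums) (auto simp: mult_le_one)
  then show "(\<lambda>k. pmf (tilt p K) k * z ^ k) sums (pgf K (p * z) / pgf K p)"
    by (simp add: pmf_tilt[OF p] power_mult_distrib mult_ac)
qed

lemma tail_tilt:
  assumes p: "0 < p" "p \<le> 1"
  shows "tail (tilt p K) x \<le> 1 / pgf K p * p powr x"
proof -
  have pos: "0 < pgf K p" using p by (rule pgf_pos)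
  have 1: "(\<lambda>k. pmf (tilt p K) k * (if x < real k then 1 else 0)) sums tail (tilt p K) x"
    unfolding tail_altdef by (rule expectation_sums[of _ 1]) auto
  have 2: "(\<lambda>k. pmf K k * (1 / pgf K p * p powr x)) sums (1 * (1 / pgf K p * p powr x))"
    by (intro sums_mult2 pmf_sums_1)
  have "tail (tilt p K) x \<le> 1 * (1 / pgf K p * p powr x)"
  proof (rule sums_le[OF _ 1 2])
    fix k
    show "pmf (tilt p K) k * (if x < real k then 1 else 0) \<le> pmf K k * (1 / pgf K p * p powr x)"
    proof (cases "x < real k")
      case True
      then have "p ^ k \<le> p powr x" using p by (simp add: powr_realpow[symmetric] powr_mono')
      then have "pmf K k / pgf K p * p ^ k \<le> pmf K k / pgf K p * p powr x" using pos by (intro mult_left_mono) auto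
      then show ?thesis using True by (simp add: pmf_tilt[OF p])
    qed (use pos p in auto)
  qed
  then show ?thesis by simp
qed

text \<open>
  The jump law of the compound Poisson law with generating function
  \<^term>\<open>R_0 lam mu q B\<close>: a jump \<open>J + 1\<close> is accepted with probability \<open>1 / (J + 1)\<close>, which
  integrates the generating function.
\<close>

definition accept :: "nat pmf \<Rightarrow> nat pmf" where
  "accept S = bind_pmf S (\<lambda>J. map_pmf (\<lambda>b. if b then Suc J else 0) (bernoulli_pmf (1 / real (Suc J))))"

lemma pgf_accept:
  assumes "0 \<le> z" "z \<le> 1"
  shows "1 - pgf (accept S) z = expect S (\<lambda>J. (1 - z ^ Suc J) / real (Suc J))"
proof -
  have b: "\<bar>(1 - z ^ Suc J) / real (Suc J)\<bar> \<le> 1" for J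
  proof -
    have "0 \<le> z ^ Suc J" "z ^ Suc J \<le> 1" using assms by (auto intro!: power_le_one simp del: power_Suc)
    then show ?thesis by (simp add: field_simps del: power_Suc)
  qed
  have "pgf (accept S) z = expect S (\<lambda>J. pgf (map_pmf (\<lambda>b. if b then Suc J else 0) (bernoulli_pmf (1 / real (Suc J)))) z)"
    unfolding accept_def using assms by (rule pgf_bind)
  also have "\<dots> = expect S (\<lambda>J. 1 - (1 - z ^ Suc J) / real (Suc J))"
  proof (intro Bochner_Integration.integral_cong refl)
    fix J
    have "pgf (map_pmf (\<lambda>b. if b then Suc J else 0) (bernoulli_pmf (1 / real (Suc J)))) z
        = 1 / real (Suc J) * z ^ Suc J + (1 - 1 / real (Suc J)) * 1"
      by (simp add: pgf_def del: power_Suc of_nat_Suc)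
    then show "pgf (map_pmf (\<lambda>b. if b then Suc J else 0) (bernoulli_pmf (1 / real (Suc J)))) z = 1 - (1 - z ^ Suc J) / real (Suc J)"
      by (simp add: diff_divide_distrib del: power_Suc of_nat_Suc)
  qed
  also have "\<dots> = 1 - expect S (\<lambda>J. (1 - z ^ Suc J) / real (Suc J))"
    using integrable_pmf_bdd[OF b, of S] by simp
  finally show ?thesis by simp
qed

text \<open>A jump above x is accepted with probability below 1 / x, and for x \<ge> 2 the condition
  \<open>J + 1 > x\<close> implies \<open>J > x / 2\<close>. The gained factor 1 / x is what makes
  the compound Poisson part negligible.\<close>

lemma tail_accept:
  assumes x: "2 \<le> x" shows "tail (accept S) x \<le> tail S (1 / 2 * x) / x"
proof -
  have "tail (accept S) x = expect S (\<lambda>J. if x < real (Suc J) then 1 / real (Suc J) else 0)"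
    unfolding accept_def tail_def measure_bind_pmf
  proof (intro Bochner_Integration.integral_cong refl)
    fix J
    have "(\<lambda>b. if b then Suc J else 0) -` {n. x < real n} = (if x < real (Suc J) then {True} else {})"
      using x by auto
    then show "prb (map_pmf (\<lambda>b. if b then Suc J else 0) (bernoulli_pmf (1 / real (Suc J)))) {n. x < real n}
       = (if x < real (Suc J) then 1 / real (Suc J) else 0)"
      by (simp add: measure_pmf_single)
  qed
  also have "\<dots> \<le> expect S (\<lambda>J. (if 1 / 2 * x < real J then 1 else 0) / x)"
  proof (rule integral_mono)
    show "integrable (measure_pmf S) (\<lambda>J. if x < real (Suc J) then 1 / real (Suc J) else 0)"
      by (rule integrable_pmf_bdd[of _ 1]) auto
    show "(if x < real (Suc J) then 1 / real (Suc J) else 0) \<le> (if 1 / 2 * x < real J then 1 else 0) / x" for J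
      using x by (auto simp: field_simps)
  qed auto
  also have "\<dots> = tail S (1 / 2 * x) / x" by (simp add: tail_altdef)
  finally show ?thesis .
qed

text \<open>Termwise integration of the power series, uniformly convergent with the point masses as
  majorant; each power integrates to the acceptance term of \<open>pgf_accept\<close>.\<close>

lemma pgf_has_integral:
  assumes z: "0 \<le> z" "z \<le> 1"
  shows "(pgf S has_integral (1 - pgf (accept S) z)) {z..1}"
proof -
  have u: "uniform_limit {z..1} (\<lambda>n u. \<Sum>i<n. pmf S i * u ^ i) (\<lambda>u. \<Sum>i. pmf S i * u ^ i) sequentially"
  proof (rule Weierstrass_m_test)
    show "summable (pmf S)" using pmf_sums_1[of S] by (auto simp: sums_iff)
    show "norm (pmf S n * u ^ n) \<le> pmf S n" if "u \<in> {z..1}" for n u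
      using that z by (auto simp: abs_mult power_le_one intro!: mult_left_le)
  qed
  obtain I J where I: "\<And>n. ((\<lambda>u. \<Sum>i<n. pmf S i * u ^ i) has_integral I n) {z..1}"
    "((\<lambda>u. \<Sum>i. pmf S i * u ^ i) has_integral J) {z..1}" "I \<longlonglongrightarrow> J"
    by (rule uniform_limit_integral[OF u]) (auto intro!: continuous_intros)
  have pw: "((\<lambda>u. u ^ i) has_integral ((1 - z ^ Suc i) / real (Suc i))) {z..1}" for i
  proof -
    have "((\<lambda>u. u ^ i) has_integral (1 ^ Suc i / real (Suc i) - z ^ Suc i / real (Suc i))) {z..1}"
      using z by (intro fundamental_theorem_of_calculus)
        (auto intro!: derivative_eq_intros simp: has_real_derivative_iff_has_vector_derivative[symmetric] simp del: power_Suc of_nat_Suc)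
    then show ?thesis by (simp add: diff_divide_distrib)
  qed
  have "I n = (\<Sum>i<n. pmf S i * ((1 - z ^ Suc i) / real (Suc i)))" for n
    by (rule has_integral_unique[OF I(1)]) (intro has_integral_sum has_integral_mult_right pw; simp)
  moreover have "(\<lambda>i. pmf S i * ((1 - z ^ Suc i) / real (Suc i))) sums (1 - pgf (accept S) z)"
    unfolding pgf_accept[OF z]
  proof (rule expectation_sums)
    fix J
    have "0 \<le> z ^ Suc J" "z ^ Suc J \<le> 1" using z by (auto intro!: power_le_one simp del: power_Suc)
    then show "\<bar>(1 - z ^ Suc J) / real (Suc J)\<bar> \<le> 1" by (simp add: field_simps del: power_Suc)
  qed
  ultimately have "I \<longlonglongrightarrow> 1 - pgf (accept S) z"
    unfolding sums_def by presburger
  then have "J = 1 - pgf (accept S) z" by (rule LIMSEQ_unique[OF I(3)])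
  moreover have "((\<lambda>u. pgf S u) has_integral J) {z..1}"
  proof (rule has_integral_eq[OF _ I(2)])
    fix u assume "u \<in> {z..1}"
    then show "(\<Sum>i. pmf S i * u ^ i) = pgf S u" using pgf_sums[of u S] z by (auto simp: sums_iff)
  qed
  ultimately show ?thesis by simp
qed

text \<open>Converts the tail bound for \<open>N\<close> into finiteness of its mean.\<close>

lemma nnmean_suminf_tail: "nnmean p = (\<Sum>k. ennreal (tail p (real k)))"
proof -
  have "(\<Sum>k. ennreal (tail p (real k))) = (\<integral>\<^sup>+n. (\<Sum>k. if real k < real n then 1 else 0) \<partial>p)"
    unfolding ennreal_tail by (rule nn_integral_suminf[symmetric]) auto
  also have "\<dots> = nnmean p"
    unfolding nnmean_def
  proof (rule nn_integral_cong)
    fix n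
    have "(\<Sum>k. if real k < real n then 1 else 0 :: ennreal) = (\<Sum>k<n. if real k < real n then 1 else 0)"
      by (rule suminf_finite) auto
    also have "\<dots> = ennreal (real n)" by (simp add: ennreal_of_nat_eq_real_of_nat)
    finally show "(\<Sum>k. if real k < real n then 1 else 0 :: ennreal) = ennreal (real n)" .
  qed
  finally show ?thesis ..
qed

lemma lipschitz_pgf:
  assumes m: "nnmean p = ennreal m" "0 \<le> m" and z: "0 \<le> z" "z \<le> 1" "0 \<le> w" "w \<le> 1"
  shows "\<bar>pgf p z - pgf p w\<bar> \<le> m * \<bar>z - w\<bar>"
proof -
  note E = nnmean_eq_ennreal[OF m]
  have "\<bar>pgf p z - pgf p w\<bar> = \<bar>expect p (\<lambda>n. z ^ n - w ^ n)\<bar>"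
    unfolding pgf_def using z by simp
  also have "\<dots> \<le> expect p (\<lambda>n. \<bar>z ^ n - w ^ n\<bar>)" by (rule integral_abs_bound)
  also have "\<dots> \<le> expect p (\<lambda>n. real n * \<bar>z - w\<bar>)"
    using E z norm_power_diff[of z w] by (intro integral_mono) auto
  also have "\<dots> = m * \<bar>z - w\<bar>" using E by simp
  finally show ?thesis .
qed


lemma tail_negligible:
  assumes u: "rv u al" and f: "((\<lambda>x. f x / u x) \<longlongrightarrow> 0) at_top" and le: "\<And>x. 2 \<le> x \<Longrightarrow> tail p x \<le> f x"
  shows "((\<lambda>x. tail p x / u x) \<longlongrightarrow> 0) at_top"
proof (rule tendsto_sandwich[OF _ _ tendsto_const f])
  show "\<forall>\<^sub>F x in at_top. 0 \<le> tail p x / u x"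
    by (intro always_eventually allI divide_nonneg_pos rv_pos[OF u]) simp
  show "\<forall>\<^sub>F x in at_top. tail p x / u x \<le> f x / u x"
    using eventually_ge_at_top[of 2]
    by eventually_elim (intro divide_right_mono le less_imp_le[OF rv_pos[OF u]])
qed

lemma inverse_at_top: "((\<lambda>x. 1 / x :: real) \<longlongrightarrow> 0) at_top"
  by real_asymp


subsection \<open>The retrial queue\<close>

locale retrial_parameters = service_law B lam for B lam +
  fixes mu q a :: real
  assumes mu: "0 < mu" and q: "0 < q" "q < 1" and stable: "rho lam B < 1"
    and a: "1 < a" and rv_B: "rv (\<lambda>t. measure B {t<..}) a"
begin

abbreviation "\<rho> \<equiv> rho lam B"

lemma rho_pos: "0 < \<rho>"
  using lam mean1_pos by (simp add: rho_def)

sublocale K: finite_mean arrivals \<rho>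
  by unfold_locales (use rho_pos nnmean_arrivals in auto)

sublocale br: branching arrivals q \<rho> a
  by unfold_locales (use q rho_pos stable nnmean_arrivals rv_arrivals[OF rv_B] in auto)

text \<open>The law with generating function \<open>h\<close>. The convergence of the tails is part
  of the choice, so that the bound for the generations applies to it.\<close>

definition N :: "nat pmf" where
  "N = (SOME N. N = compound arrivals (with_orbit q N) \<and> (\<forall>x. (\<lambda>m. tail (br.gener m) x) \<longlonglongrightarrow> tail N x))"

definition g :: "nat pmf" where "g = with_orbit q N"

lemma N: "N = compound arrivals g" "(\<lambda>m. tail (br.gener m) x) \<longlonglongrightarrow> tail N x"
proof -
  have "\<exists>N. N = compound arrivals (with_orbit q N) \<and> (\<forall>x. (\<lambda>m. tail (br.gener m) x) \<longlonglongrightarrow> tail N x)"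
    using br.limit_law[of "\<exists>N. N = compound arrivals (with_orbit q N) \<and> (\<forall>x. (\<lambda>m. tail (br.gener m) x) \<longlonglongrightarrow> tail N x)"] by blast
  from someI_ex[OF this] show "N = compound arrivals g" "(\<lambda>m. tail (br.gener m) x) \<longlonglongrightarrow> tail N x"
    unfolding g_def N_def[symmetric] by auto
qed

lemma tail_N_bound:
  obtains C where "0 < C" "\<And>x. 0 \<le> x \<Longrightarrow> tail N x \<le> C * tail arrivals x"
proof -
  obtain C where C: "0 < C" "\<And>m x. 0 \<le> x \<Longrightarrow> tail (br.gener m) x \<le> C * tail arrivals x"
    using br.tail_gener_bound by blast
  have "tail N x \<le> C * tail arrivals x" if "0 \<le> x" for x
    by (rule LIMSEQ_le_const2[OF N(2)]) (use C that in auto)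
  then show ?thesis using C that by blast
qed

text \<open>The mean g'(1), solution of m = q rho m + (1 - q).\<close>

definition m :: real where "m = (1 - q) / (1 - q * \<rho>)"

lemma q_rho: "0 < q * \<rho>" "q * \<rho> < 1" "q * \<rho> \<le> q" "q * \<rho> < \<rho>"
  using br.rho_q q rho_pos stable by (auto simp: mult.commute intro!: mult_left_le)

lemma m: "0 < m" "m \<le> 1"
  using q q_rho by (auto simp: m_def field_simps)

text \<open>The linear equation for the mean is also satisfied by infinity; the tail bound for
  \<open>N\<close> rules that out before the equation is solved.\<close>

lemma nnmean_g: "nnmean g = ennreal m"
proof -
  obtain C where C: "0 < C" "\<And>x. 0 \<le> x \<Longrightarrow> tail N x \<le> C * tail arrivals x" using tail_N_bound by blast
  have "nnmean N \<le> (\<Sum>k. ennreal (C * tail arrivals (real k)))"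
    unfolding nnmean_suminf_tail using C by (intro suminf_le) (auto intro!: ennreal_leI)
  also have "\<dots> = ennreal C * nnmean arrivals"
    unfolding nnmean_suminf_tail using C by (simp add: ennreal_mult')
  finally have "nnmean N < \<infinity>" using nnmean_arrivals by (simp add: ennreal_mult_less_top le_less_trans)
  then obtain t where t: "nnmean N = ennreal t" "0 \<le> t" by (cases "nnmean N") auto
  have 1: "nnmean g = ennreal (q * t + (1 - q))"
    using q t by (simp add: g_def nnmean_with_orbit ennreal_mult[symmetric])
  have "ennreal t = ennreal (\<rho> * (q * t + (1 - q)))"
    using N(1) nnmean_compound[of arrivals g] t 1 nnmean_arrivals rho_pos q by (simp add: ennreal_mult)
  then have "t = \<rho> * (q * t + (1 - q))"
    using t q rho_pos by (subst (asm) ennreal_inj) auto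
  then have "\<rho> * (q * t + (1 - q)) = t" by simp
  moreover have "(q * t + (1 - q)) * (1 - q * \<rho>) = q * t + (1 - q) - q * (\<rho> * (q * t + (1 - q)))"
    by (simp add: algebra_simps)
  ultimately have "(q * t + (1 - q)) * (1 - q * \<rho>) = 1 - q" by simp
  then have "q * t + (1 - q) = m" using q_rho by (simp add: m_def field_simps)
  then show ?thesis using 1 by simp
qed

lemma pgf_g: "0 \<le> z \<Longrightarrow> z \<le> 1 \<Longrightarrow> pgf g z = q * pgf N z + (1 - q) * z"
  using q by (simp add: g_def pgf_with_orbit)

lemma pgf_arrivals':
  assumes "0 \<le> y" "y \<le> 1" "0 \<le> z" "z \<le> 1"
  shows "LST B (lam - lam1 lam q * y - lam2 lam q * z) = pgf arrivals (q * y + (1 - q) * z)"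
proof -
  have "0 \<le> q * y + (1 - q) * z" "q * y + (1 - q) * z \<le> 1"
    using assms q convex_bound_le[of y 1 z q "1 - q"] by auto
  then show ?thesis by (simp add: pgf_arrivals lam1_def lam2_def algebra_simps)
qed

text \<open>Uniqueness behind the description operator: the defining map is Lipschitz in y with
  constant \<open>q * \<rho>\<close>, which is below 1.\<close>

lemma h_fun_eq:
  assumes z: "0 \<le> z" "z \<le> 1" shows "h_fun lam q B z = pgf N z"
  unfolding h_fun_def
proof (rule the_equality)
  have h: "0 \<le> pgf N z" "pgf N z \<le> 1" using z by (auto simp: pgf_nonneg pgf_le_1)
  have fixed: "pgf N z = pgf arrivals (q * pgf N z + (1 - q) * z)"
    using z N(1) pgf_compound[of z arrivals g] by (simp add: pgf_g)
  show "0 \<le> pgf N z \<and> pgf N z \<le> 1 \<and> pgf N z = LST B (lam - lam1 lam q * pgf N z - lam2 lam q * z)"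
    using h fixed z by (simp add: pgf_arrivals')
  fix y assume y: "0 \<le> y \<and> y \<le> 1 \<and> y = LST B (lam - lam1 lam q * y - lam2 lam q * z)"
  have b: "0 \<le> q * y + (1 - q) * z" "q * y + (1 - q) * z \<le> 1" if "0 \<le> y" "y \<le> 1" for y
    using that z q convex_bound_le[of y 1 z q "1 - q"] by auto
  have "\<bar>y - pgf N z\<bar> = \<bar>pgf arrivals (q * y + (1 - q) * z) - pgf arrivals (q * pgf N z + (1 - q) * z)\<bar>"
    using y fixed z pgf_arrivals'[of y z] by simp
  also have "\<dots> \<le> \<rho> * \<bar>(q * y + (1 - q) * z) - (q * pgf N z + (1 - q) * z)\<bar>"
    using y h rho_pos by (intro lipschitz_pgf nnmean_arrivals b) auto
  also have "\<dots> = q * \<rho> * \<bar>y - pgf N z\<bar>"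
  proof -
    have "(q * y + (1 - q) * z) - (q * pgf N z + (1 - q) * z) = q * (y - pgf N z)" by (simp add: algebra_simps)
    then show ?thesis using q by (simp add: abs_mult)
  qed
  finally have "(1 - q * \<rho>) * \<bar>y - pgf N z\<bar> \<le> 0" by (simp add: algebra_simps)
  then show "y = pgf N z" using q_rho by (auto simp: mult_le_0_iff)
qed

section \<open>The laws behind the factors of the Choi-Park formula\<close>

definition E :: "nat pmf" where "E = compound K.equilibrium g"

text \<open>By the equilibrium formula at g(z), 1 - h is rho E (1 - g), and 1 - g is q (1 - h) + (1
  - q) (1 - z). This is linear in 1 - h, so h can be eliminated in favour of E; the last two bounds
  make the divisions legitimate.\<close>

lemma pgf_E:
  assumes z: "0 \<le> z" "z < 1"
  shows "(1 - pgf N z) * (1 - q * \<rho> * pgf E z) = \<rho> * (1 - q) * pgf E z * (1 - z)"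
    and "pgf N z - z = (1 - z) * (1 - \<rho> * pgf E z) / (1 - q * \<rho> * pgf E z)"
    and "0 < 1 - \<rho> * pgf E z" "0 < 1 - q * \<rho> * pgf E z"
proof -
  have h: "0 \<le> pgf N z" "pgf N z \<le> 1" using z by (auto simp: pgf_nonneg pgf_le_1)
  have "q * pgf N z + (1 - q) * z < q * 1 + (1 - q) * 1"
    using h z q by (intro add_le_less_mono mult_left_mono mult_strict_left_mono) auto
  then have g1: "0 \<le> pgf g z" "pgf g z < 1" using z by (simp add: pgf_nonneg, simp add: pgf_g)
  have x: "0 \<le> pgf E z" "pgf E z \<le> 1" using z by (auto simp: pgf_nonneg pgf_le_1)
  have fixed: "pgf N z = pgf arrivals (pgf g z)"
    using z N(1) pgf_compound[of z arrivals g] by simp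
  have "pgf E z = (1 - pgf N z) / (\<rho> * (1 - pgf g z))"
    using z g1 by (simp add: E_def pgf_compound K.pgf_equilibrium fixed)
  then have "\<rho> * pgf E z * (1 - pgf g z) = 1 - pgf N z" using g1 rho_pos by simp
  moreover have "1 - pgf g z = q * (1 - pgf N z) + (1 - q) * (1 - z)" using z by (simp add: pgf_g algebra_simps)
  ultimately have eq: "\<rho> * pgf E z * (q * (1 - pgf N z) + (1 - q) * (1 - z)) = 1 - pgf N z" by simp
  then show 1: "(1 - pgf N z) * (1 - q * \<rho> * pgf E z) = \<rho> * (1 - q) * pgf E z * (1 - z)"
    by (simp add: algebra_simps)
  have "\<rho> * pgf E z \<le> \<rho> * 1" "q * \<rho> * pgf E z \<le> q * \<rho> * 1"
    using x rho_pos q_rho by (auto intro!: mult_left_mono)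
  then show pos: "0 < 1 - \<rho> * pgf E z" "0 < 1 - q * \<rho> * pgf E z" using stable q_rho by linarith+
  have "(pgf N z - z) * (1 - q * \<rho> * pgf E z) = (1 - z) * (1 - q * \<rho> * pgf E z) - (1 - pgf N z) * (1 - q * \<rho> * pgf E z)"
    by (simp add: algebra_simps)
  also have "\<dots> = (1 - z) * (1 - \<rho> * pgf E z)" unfolding 1 by (simp add: algebra_simps)
  finally show "pgf N z - z = (1 - z) * (1 - \<rho> * pgf E z) / (1 - q * \<rho> * pgf E z)" using pos by (simp add: field_simps)
qed

definition S :: "nat pmf" where "S = compound (positive_geometric \<rho>) E"

lemma pgf_S: "0 \<le> z \<Longrightarrow> z \<le> 1 \<Longrightarrow> pgf S z = (1 - \<rho>) * pgf E z / (1 - \<rho> * pgf E z)"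
  using rho_pos stable by (simp add: S_def pgf_compound positive_geometric pgf_nonneg pgf_le_1)

text \<open>The weight of the atom is the value of M_c at E = 0; what remains is the geometric sum
  \<open>S\<close>.\<close>

definition MC :: "nat pmf" where
  "MC = bind_pmf (bernoulli_pmf ((1 - \<rho>) / (1 - q * \<rho>))) (\<lambda>b. if b then return_pmf 0 else S)"

lemma MC_prob: "0 < (1 - \<rho>) / (1 - q * \<rho>)" "(1 - \<rho>) / (1 - q * \<rho>) < 1"
  using stable q_rho by (auto simp: field_simps)

lemma rho1_eq: "rho1 lam q B = q * \<rho>"
  by (simp add: rho1_def lam1_def rho_def)

lemma pgf_MC:
  assumes z: "0 \<le> z" "z < 1" shows "pgf MC z = M_c lam q B z"
proof -
  note P = pgf_E[OF z]
  let ?x = "pgf E z" and ?p = "(1 - \<rho>) / (1 - q * \<rho>)"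
  have "pgf MC z = ?p * 1 + (1 - ?p) * pgf S z"
    unfolding MC_def using z MC_prob by (subst pgf_bind) auto
  also have "\<dots> = ?p * (1 - q * \<rho> * ?x) / (1 - \<rho> * ?x)"
  proof -
    have ne: "1 - \<rho> * ?x \<noteq> 0" "1 - q * \<rho> \<noteq> 0" using P q_rho by auto
    have "(?p * 1 + (1 - ?p) * pgf S z) * (1 - \<rho> * ?x) * (1 - q * \<rho>) = (1 - \<rho>) * (1 - q * \<rho> * ?x)"
    proof -
      have s: "pgf S z * (1 - \<rho> * ?x) = (1 - \<rho>) * ?x" using z ne by (simp add: pgf_S)
      have p: "?p * (1 - q * \<rho>) = 1 - \<rho>" using ne by simp
      have "(?p * 1 + (1 - ?p) * pgf S z) * (1 - \<rho> * ?x) * (1 - q * \<rho>)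
          = (?p * (1 - q * \<rho>)) * (1 - \<rho> * ?x) + ((1 - q * \<rho>) - ?p * (1 - q * \<rho>)) * (pgf S z * (1 - \<rho> * ?x))"
        by (simp only: algebra_simps)
      also have "\<dots> = (1 - \<rho>) * (1 - q * \<rho> * ?x)" unfolding s p by (simp add: algebra_simps)
      finally show ?thesis .
    qed
    then have "(?p * 1 + (1 - ?p) * pgf S z) * ((1 - \<rho> * ?x) * (1 - q * \<rho>)) = (1 - \<rho>) * (1 - q * \<rho> * ?x)"
      by (simp only: mult.assoc)
    then have "?p * 1 + (1 - ?p) * pgf S z = (1 - \<rho>) * (1 - q * \<rho> * ?x) / ((1 - \<rho> * ?x) * (1 - q * \<rho>))"
      using ne by (intro eq_divide_imp) auto
    then show ?thesis by (simp add: mult.commute)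
  qed
  also have "\<dots> = M_c lam q B z"
    using P z q_rho by (simp add: M_c_def h_fun_eq rho1_eq)
  finally show ?thesis .
qed

text \<open>The quotient (1 - h) / (h - u) equals rho_2 / (1 - rho) times the generating function of
  \<open>S\<close>; the exponent of R_0 supplies lam / mu.\<close>

definition intensity :: real where "intensity = lam / mu * (\<rho> * (1 - q) / (1 - \<rho>))"

lemma intensity: "0 < intensity"
  using lam mu rho_pos q stable by (simp add: intensity_def)

definition RZ :: "nat pmf" where "RZ = compound (poisson_pmf intensity) (accept S)"

lemma pgf_RZ:
  assumes z: "0 \<le> z" "z < 1" shows "pgf RZ z = R_0 lam mu q B z"
proof -
  let ?c = "\<rho> * (1 - q) / (1 - \<rho>)"
  have "((\<lambda>u. ?c * pgf S u) has_integral (?c * (1 - pgf (accept S) z))) {z..1}"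
    using z by (intro has_integral_mult_right pgf_has_integral) auto
  then have "((\<lambda>u. (1 - h_fun lam q B u) / (h_fun lam q B u - u)) has_integral (?c * (1 - pgf (accept S) z))) {z..1}"
  \<comment> \<open>At u = 1 numerator and denominator of the integrand both vanish; a single point
    does not affect the integral.\<close>
  proof (rule has_integral_spike_finite[where S = "{1}", rotated 2])
    fix u assume "u \<in> {z..1} - {1}"
    then have u: "0 \<le> u" "u < 1" using z by auto
    note P = pgf_E[OF u]
    have "(1 - pgf N u) / (pgf N u - u) = \<rho> * (1 - q) * pgf E u / (1 - \<rho> * pgf E u)"
    proof -
      have "(1 - pgf N u) / (pgf N u - u) = ((1 - pgf N u) * (1 - q * \<rho> * pgf E u)) / ((1 - u) * (1 - \<rho> * pgf E u))"
        unfolding P(2) using P(3,4) by simp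
      also have "\<dots> = \<rho> * (1 - q) * pgf E u / (1 - \<rho> * pgf E u)"
        unfolding P(1) using u by simp
      finally show ?thesis .
    qed
    also have "\<dots> = ?c * pgf S u" using u stable by (simp add: pgf_S)
    finally show "(1 - h_fun lam q B u) / (h_fun lam q B u - u) = ?c * pgf S u" using u by (simp add: h_fun_eq)
  qed simp
  then have "integral {z..1} (\<lambda>u. (1 - h_fun lam q B u) / (h_fun lam q B u - u)) = ?c * (1 - pgf (accept S) z)"
    by (rule integral_unique)
  then have "R_0 lam mu q B z = exp (- intensity * (1 - pgf (accept S) z))"
    by (simp add: R_0_def intensity_def)
  also have "\<dots> = pgf RZ z"
    using z intensity by (simp add: RZ_def pgf_compound pgf_poisson pgf_nonneg pgf_le_1)
  finally show ?thesis ..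
qed


subsection \<open>Tails of the factors\<close>

text \<open>The common scale, of index a - 1, against which the tails of all factors are
  measured.\<close>

abbreviation "u \<equiv> tail K.equilibrium"

lemma rv_u: "rv u (a - 1)"
  by (rule K.rv_equilibrium[OF rv_arrivals[OF rv_B] a])

lemma tail_arrivals_negligible: "((\<lambda>x. tail arrivals x / u x) \<longlongrightarrow> 0) at_top"
proof -
  have "((\<lambda>x. 1 / x / (u x / (x * tail arrivals x))) \<longlongrightarrow> 0 / (1 / ((a - 1) * \<rho>))) at_top"
    by (intro tendsto_divide K.tail_equilibrium_asymp[OF rv_arrivals[OF rv_B] a] inverse_at_top) (use a rho_pos in simp)
  then have "((\<lambda>x. 1 / x / (u x / (x * tail arrivals x))) \<longlongrightarrow> 0) at_top" by simp
  then show ?thesis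
  proof (rule Lim_transform_eventually)
    show "\<forall>\<^sub>F x in at_top. 1 / x / (u x / (x * tail arrivals x)) = tail arrivals x / u x"
      using eventually_gt_at_top[of 0] by eventually_elim simp
  qed
qed

lemma arrivals_le_u: obtains C where "0 < C" "\<And>x. 0 < x \<Longrightarrow> x * tail arrivals x \<le> C * u x"
proof -
  note lim = K.tail_equilibrium_asymp[OF rv_arrivals[OF rv_B] a]
  define l where "l = 1 / ((a - 1) * \<rho>)"
  have l: "0 < l" using a rho_pos by (simp add: l_def)
  have "\<forall>\<^sub>F x in at_top. l / 2 < u x / (x * tail arrivals x)"
    by (rule order_tendstoD(1)[OF lim[folded l_def]]) (use l in simp)
  then obtain X0 where X0: "\<And>x. x \<ge> X0 \<Longrightarrow> l / 2 < u x / (x * tail arrivals x)" by (auto simp: eventually_at_top_linorder)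
  define X where "X = max X0 1"
  have pos: "0 < u x" "0 < tail arrivals x" for x using rv_pos[OF rv_u] rv_pos[OF rv_arrivals[OF rv_B]] by auto
  have "x * tail arrivals x \<le> max (2 / l) (X / u X) * u x" if x: "0 < x" for x
  proof (cases "x \<ge> X")
    case True
    have "0 < x * tail arrivals x" using x pos by simp
    then have "x * tail arrivals x \<le> 2 / l * u x" using X0[of x] True l by (simp add: X_def field_simps)
    also have "\<dots> \<le> max (2 / l) (X / u X) * u x" using pos by (intro mult_right_mono) (auto simp: less_imp_le)
    finally show ?thesis .
  next
    case False
    have "x * tail arrivals x \<le> X * 1" using False x by (intro mult_mono) auto
    also have "\<dots> = X / u X * u X" using pos[of X] by simp
    also have "\<dots> \<le> max (2 / l) (X / u X) * u x"
      using False pos by (intro mult_mono tail_antimono) (auto simp: X_def intro!: le_max_iff_disj[THEN iffD2] divide_nonneg_pos)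
    finally show ?thesis .
  qed
  then show ?thesis using l by (intro that[of "max (2 / l) (X / u X)"]) (auto simp: less_max_iff_disj)
qed

text \<open>The summands g inherit the tail order of the arrivals from \<open>N\<close>, lighter
  than \<open>u\<close> by a factor of order 1 / x as \<open>tail_compound_heavy\<close>
  requires.\<close>

lemma tail_E: "((\<lambda>x. tail E x / u x) \<longlongrightarrow> (1 / m) powr (- (a - 1))) at_top"
  unfolding E_def
proof (rule tail_compound_heavy[OF rv_u nnmean_g m])
  fix c :: real assume c: "0 < c"
  note rvK = rv_arrivals[OF rv_B]
  obtain C where C: "0 < C" "\<And>x. 0 \<le> x \<Longrightarrow> tail N x \<le> C * tail arrivals x" using tail_N_bound by blast
  obtain C2 where C2: "0 < C2" "\<And>x. 0 \<le> x \<Longrightarrow> tail arrivals (c * x) \<le> C2 * tail arrivals x"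
    using rv_scale_bound[OF rvK c] by blast
  obtain C3 where C3: "0 < C3" "\<And>x. 0 < x \<Longrightarrow> x * tail arrivals x \<le> C3 * u x" using arrivals_le_u by blast
  \<comment> \<open>The added term covers the atom of g at 1, visible only for y < 1, where
    \<open>tail arrivals y\<close> is at least \<open>tail arrivals 1\<close>.\<close>
  define C1 where "C1 = C + 1 / tail arrivals 1"
  have p1: "0 < tail arrivals 1" by (rule rv_pos[OF rvK])
  have g: "tail g y \<le> C1 * tail arrivals y" if "0 \<le> y" for y
  proof -
    have "tail g y = q * tail N y + (1 - q) * (if y < 1 then 1 else 0)" using q by (simp add: g_def tail_with_orbit)
    also have "\<dots> \<le> 1 * tail N y + 1 * (if y < 1 then 1 else 0)" using q by (intro add_mono mult_right_mono) auto
    also have "\<dots> \<le> C * tail arrivals y + 1 / tail arrivals 1 * tail arrivals y"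
    proof (intro add_mono)
      show "1 * (if y < 1 then 1 else 0) \<le> 1 / tail arrivals 1 * tail arrivals y"
        using tail_antimono[of y 1 arrivals] p1 by (auto simp: field_simps)
    qed (use C that in auto)
    finally show ?thesis by (simp add: C1_def algebra_simps)
  qed
  have C1: "0 < C1" using C p1 by (simp add: C1_def add_pos_pos)
  show "\<exists>C. \<forall>x>0. x * tail g (c * x) \<le> C * u x"
  proof (intro exI allI impI)
    fix x :: real assume x: "0 < x"
    have "x * tail g (c * x) \<le> x * (C1 * (C2 * tail arrivals x))"
      using x c C1 by (intro mult_left_mono order_trans[OF g] C2) auto
    also have "\<dots> = C1 * C2 * (x * tail arrivals x)" by simp
    also have "\<dots> \<le> C1 * C2 * (C3 * u x)" using C1 C2 x by (intro mult_left_mono C3) auto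
    finally show "x * tail g (c * x) \<le> C1 * C2 * C3 * u x" by (simp only: mult.assoc)
  qed
qed

lemma tail_N: "((\<lambda>x. tail N x / u x) \<longlongrightarrow> 0) at_top"
proof -
  obtain C where C: "0 < C" "\<And>x. 0 \<le> x \<Longrightarrow> tail N x \<le> C * tail arrivals x" using tail_N_bound by blast
  have "((\<lambda>x. C * tail arrivals x / u x) \<longlongrightarrow> 0) at_top"
    using tendsto_mult[OF tendsto_const[of C] tail_arrivals_negligible] by simp
  from tail_negligible[OF rv_u this] C(2) show ?thesis by simp
qed

lemma tail_S: "((\<lambda>x. tail S x / u x) \<longlongrightarrow> 1 / (1 - \<rho>) * (1 / m) powr (- (a - 1))) at_top"
  using tail_compound_light[OF rv_u tail_E positive_geometric(2)[OF rho_pos stable]]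
  by (simp only: S_def positive_geometric(1)[OF rho_pos stable])

lemma tail_MC:
  "((\<lambda>x. tail MC x / u x) \<longlongrightarrow> \<rho> * (1 - q) / ((1 - \<rho>) * (1 - q * \<rho>)) * (1 / m) powr (- (a - 1))) at_top"
proof -
  let ?p = "(1 - \<rho>) / (1 - q * \<rho>)"
  have eq: "tail MC x = (1 - ?p) * tail S x" if "0 \<le> x" for x
  proof -
    have "tail MC x = ?p * tail (return_pmf 0) x + (1 - ?p) * tail S x"
      unfolding MC_def tail_def measure_bind_pmf using MC_prob by simp
    then show ?thesis using that by (simp add: tail_return_0)
  qed
  have "1 - ?p = \<rho> * (1 - q) / (1 - q * \<rho>)" using q_rho by (simp add: field_simps)
  then have "(1 - ?p) * (1 / (1 - \<rho>)) = \<rho> * (1 - q) / ((1 - \<rho>) * (1 - q * \<rho>))"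
    by (simp only: times_divide_times_eq mult_1_right mult.commute)
  then have "((\<lambda>x. (1 - ?p) * (tail S x / u x)) \<longlongrightarrow> \<rho> * (1 - q) / ((1 - \<rho>) * (1 - q * \<rho>)) * (1 / m) powr (- (a - 1))) at_top"
    using tendsto_mult[OF tendsto_const[of "1 - ?p"] tail_S] by (simp only: mult.assoc[symmetric])
  then show ?thesis
  proof (rule Lim_transform_eventually)
    show "\<forall>\<^sub>F x in at_top. (1 - ?p) * (tail S x / u x) = tail MC x / u x"
      using eventually_ge_at_top[of 0] by eventually_elim (simp add: eq)
  qed
qed

lemma tail_RZ: "((\<lambda>x. tail RZ x / u x) \<longlongrightarrow> 0) at_top"
proof -
  let ?l = "1 / (1 - \<rho>) * (1 / m) powr (- (a - 1)) * (1 / 2) powr (- (a - 1))"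
  have "((\<lambda>x. tail S (1 / 2 * x) / u x * (1 / x)) \<longlongrightarrow> ?l * 0) at_top"
    by (intro tendsto_mult tail_ratio_scale[OF rv_u tail_S] inverse_at_top) simp
  then have "((\<lambda>x. tail S (1 / 2 * x) / x / u x) \<longlongrightarrow> 0) at_top" by (simp add: mult.commute)
  from tail_negligible[OF rv_u this] tail_accept[of _ S]
  have "((\<lambda>x. tail (accept S) x / u x) \<longlongrightarrow> 0) at_top" by blast
  from tail_compound_light[OF rv_u this integrable_poisson_power[OF intensity]] show ?thesis
    by (simp add: RZ_def)
qed

lemma pgf_N_pos: assumes z: "0 \<le> z" "z \<le> 1" shows "0 < pgf N z"
proof -
  have "pgf N z = pgf arrivals (pgf g z)" using z N(1) pgf_compound[of z arrivals g] by simp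
  then show ?thesis using z by (simp add: pgf_arrivals_pos pgf_nonneg pgf_le_1)
qed

text \<open>At z1 = 0 the factor M_a is the equilibrium generating function at
  \<open>(1 - q) * z\<close>, while M_b keeps the arrival generating function in its
  denominator.\<close>

lemma choi_park_factors:
  assumes z: "0 \<le> z" "z < 1"
  shows "M_a lam q B 0 z * M_b lam q B 0 z * M_c lam q B z * R_0 lam mu q B z =
    pgf K.equilibrium ((1 - q) * z) * ((1 - q * \<rho>) * (pgf N z / pgf arrivals ((1 - q) * z))) * pgf MC z * pgf RZ z"
proof -
  have pz: "0 \<le> (1 - q) * z" "(1 - q) * z < 1" using q z mult_strict_mono[of "1 - q" 1 z 1] by auto
  have L: "LST B (lam - lam1 lam q * 0 - lam2 lam q * z) = pgf arrivals ((1 - q) * z)"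
    using pgf_arrivals'[of 0 z] z by simp
  have Ma: "M_a lam q B 0 z = pgf K.equilibrium ((1 - q) * z)"
    unfolding M_a_def L using pz by (simp add: K.pgf_equilibrium)
  have Mb: "M_b lam q B 0 z = (1 - q * \<rho>) * (pgf N z / pgf arrivals ((1 - q) * z))"
    unfolding M_b_def L using z by (simp add: h_fun_eq rho1_eq)
  show ?thesis unfolding Ma Mb pgf_MC[OF z] pgf_RZ[OF z] ..
qed

text \<open>Ensures that a busy server with an empty queue has positive probability, so that
  conditioning on it is meaningful.\<close>

lemma choi_park_pos:
  assumes z: "0 < z" "z < 1"
  shows "0 < M_a lam q B 0 z * M_b lam q B 0 z * M_c lam q B z * R_0 lam mu q B z"
proof -
  have pz: "0 < (1 - q) * z" "(1 - q) * z \<le> 1" using q z mult_strict_mono[of "1 - q" 1 z 1] by auto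
  have z': "0 \<le> z" "z \<le> 1" using z by auto
  show ?thesis
    unfolding choi_park_factors[OF z'(1) z(2)]
    using pgf_pos[OF pz, of K.equilibrium] pgf_pos[OF pz, of arrivals] pgf_pos[OF z(1) z'(2), of MC]
      pgf_pos[OF z(1) z'(2), of RZ] pgf_N_pos[OF z'] q_rho by simp
qed

text \<open>Multiplying by the denominator of M_b gives an identity between two convolutions of
  laws; on the right only \<open>MC\<close> has a tail of order \<open>u\<close>. The free constant
  c takes up the normalisation by the conditioning event.\<close>

theorem tail_orbit:
  assumes R: "\<And>z. 0 \<le> z \<Longrightarrow> z < 1 \<Longrightarrow>
    c * pgf R z = M_a lam q B 0 z * M_b lam q B 0 z * M_c lam q B z * R_0 lam mu q B z"
  shows "((\<lambda>x. tail R x / u x) \<longlongrightarrow> \<rho> * (1 - q) / ((1 - \<rho>) * (1 - q * \<rho>)) * (1 / m) powr (- (a - 1))) at_top"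
proof -
  let ?p = "1 - q"
  let ?F = "conv (tilt ?p K.equilibrium) (conv N (conv MC RZ))"
  have p: "0 < ?p" "?p < 1" "?p \<le> 1" using q by auto
  have pos: "0 < pgf arrivals ?p" "0 < pgf K.equilibrium ?p" using p by (auto intro!: pgf_pos)
  have eq: "c * (pgf (conv R (tilt ?p arrivals)) z) =
      (pgf K.equilibrium ?p * (1 - q * \<rho>) / pgf arrivals ?p) * pgf ?F z" if z: "0 \<le> z" "z < 1" for z
  proof -
    have pz: "0 \<le> ?p * z" "?p * z < 1" "?p * z \<le> 1" using p z mult_strict_mono[of ?p 1 z 1] by auto
    have "c * pgf (conv R (tilt ?p arrivals)) z = c * pgf R z * (pgf arrivals (?p * z) / pgf arrivals ?p)"
      using z p by (simp add: pgf_conv pgf_tilt)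
    also have "\<dots> = pgf K.equilibrium (?p * z) * ((1 - q * \<rho>) * pgf N z) * pgf MC z * pgf RZ z / pgf arrivals ?p"
      unfolding R[OF z] choi_park_factors[OF z] using pgf_arrivals_pos[OF pz(1,3)] by simp
    also have "\<dots> = (pgf K.equilibrium ?p * (1 - q * \<rho>) / pgf arrivals ?p) * pgf ?F z"
    proof -
      have F: "pgf ?F z = pgf K.equilibrium (?p * z) / pgf K.equilibrium ?p * (pgf N z * (pgf MC z * pgf RZ z))"
        using z p by (simp add: pgf_conv pgf_tilt)
      show ?thesis unfolding F using pos by (simp add: mult_ac)
    qed
    finally show ?thesis .
  qed
  define d where "d = pgf K.equilibrium ?p * (1 - q * \<rho>) / pgf arrivals ?p"
  have d: "d \<noteq> 0" using pos q_rho by (simp add: d_def)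
  have "?F = conv R (tilt ?p arrivals)"
  proof (rule pgf_eq_scaledI)
    fix z :: real assume z: "0 \<le> z" "z < 1"
    have "pgf ?F z * d = c * pgf (conv R (tilt ?p arrivals)) z"
      unfolding eq[OF z] d_def[symmetric] by (rule mult.commute)
    then have "pgf ?F z = c * pgf (conv R (tilt ?p arrivals)) z / d" using d by (intro eq_divide_imp)
    then show "pgf ?F z = c / d * pgf (conv R (tilt ?p arrivals)) z" by simp
  qed
  then have conv: "conv R (tilt ?p arrivals) = ?F" ..
  have tilt0: "((\<lambda>x. tail (tilt ?p K.equilibrium) x / u x) \<longlongrightarrow> 0) at_top"
  proof -
    let ?C = "1 / pgf K.equilibrium ?p"
    have "((\<lambda>x. ?C * ?p powr x / u x) \<longlongrightarrow> 0) at_top"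
      using tendsto_mult[OF tendsto_const[of ?C] rv_exponential_negligible[OF rv_u p(1,2)]] by simp
    from tail_negligible[OF rv_u this] tail_tilt[OF p(1,3)] show ?thesis by blast
  qed
  let ?G = "\<rho> * (1 - q) / ((1 - \<rho>) * (1 - q * \<rho>)) * (1 / m) powr (- (a - 1))"
  have "((\<lambda>x. tail (conv R (tilt ?p arrivals)) x / u x) \<longlongrightarrow> 0 + (0 + (?G + 0))) at_top"
    unfolding conv by (intro tail_conv_ratio[OF rv_u] tilt0 tail_N tail_MC tail_RZ)
  then show ?thesis
    by (intro tail_deconv[OF rv_u _ p(1,2) tail_tilt[OF p(1,3)]]) simp
qed

lemma u_asymp:
  "((\<lambda>x. u x / (x * measure B {x<..})) \<longlongrightarrow> lam powr a / ((a - 1) * \<rho>)) at_top"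
proof -
  note rvK = rv_arrivals[OF rv_B]
  have "((\<lambda>x. u x / (x * tail arrivals x) * (tail arrivals x / measure B {x<..})) \<longlongrightarrow> 1 / ((a - 1) * \<rho>) * lam powr a) at_top"
    by (intro tendsto_mult K.tail_equilibrium_asymp[OF rvK a] tail_arrivals_asymp[OF rv_B])
  moreover have "u x / (x * tail arrivals x) * (tail arrivals x / measure B {x<..}) = u x / (x * measure B {x<..})" for x
    using rv_pos[OF rvK, of x] by simp
  ultimately show ?thesis by simp
qed

end


section \<open>Conditioning on an empty queue and the final constant\<close>

lemma expectation_cond_pmf:
  fixes f :: "'a \<Rightarrow> real"
  assumes ne: "set_pmf p \<inter> s \<noteq> {}" and f: "\<And>x. 0 \<le> f x" "\<And>x. f x \<le> 1"
  shows "expect (cond_pmf p s) f =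
    expect p (\<lambda>x. f x * indicator s x) / prb p s"
proof -
  have i: "integrable (measure_pmf p') g" if "\<And>x. 0 \<le> g x" "\<And>x. g x \<le> 1" for g :: "'a \<Rightarrow> real" and p'
    using that by (intro integrable_pmf_bdd[of _ 1]) auto
  have g: "0 \<le> f x * indicator s x" "f x * indicator s x \<le> 1" for x
    using f[of x] by (auto simp: indicator_def)
  have pos: "0 < prb p s" using ne by (auto intro: measure_pmf_posI)
  have "ennreal (expect (cond_pmf p s) f) = (\<integral>\<^sup>+x. ennreal (f x) \<partial>cond_pmf p s)"
    by (rule nn_integral_eq_integral[symmetric, OF i[OF f]]) (use f in auto)
  also have "\<dots> = (\<integral>\<^sup>+x. ennreal (f x) * indicator s x \<partial>p) / emeasure p s"
    unfolding cond_pmf.rep_eq[OF ne] by (rule nn_integral_uniform_measure) auto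
  also have "(\<integral>\<^sup>+x. ennreal (f x) * indicator s x \<partial>p) = (\<integral>\<^sup>+x. ennreal (f x * indicator s x) \<partial>p)"
    by (intro nn_integral_cong) (auto simp: indicator_def)
  also have "\<dots> = ennreal (expect p (\<lambda>x. f x * indicator s x))"
    by (rule nn_integral_eq_integral[OF i[OF g]]) (use g in auto)
  also have "\<dots> / emeasure p s = ennreal (expect p (\<lambda>x. f x * indicator s x) / prb p s)"
    unfolding measure_pmf.emeasure_eq_measure
    using pos g by (intro divide_ennreal) (auto intro!: Bochner_Integration.integral_nonneg)
  finally show ?thesis
    using pos f g by (subst (asm) ennreal_inj) (auto intro!: Bochner_Integration.integral_nonneg divide_nonneg_pos)
qed

theorem mainTheorem4:
  fixes M :: "'w measure" and B :: "real measure"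
    and lam mu q a :: real
    and V :: "input \<Rightarrow> 'w \<Rightarrow> real" and st :: "nat \<Rightarrow> 'w \<Rightarrow> real"
    and \<pi> :: "(nat \<times> nat \<times> nat) pmf"
    and L :: "real \<Rightarrow> real"
  assumes "bernoulli_retrial_queue M B lam mu q V st"
    and "rho lam B < 1"
    and "steady_state M V st \<pi>"
    and "choi_park lam mu q B \<pi>"
    and "a > 1"
    and "slowly_varying L"
    and "(\<lambda>t. measure B {t<..}) \<sim>[at_top] (\<lambda>t. t powr (- a) * L t)"
  shows "(\<lambda>n. \<P>((i, k, j) in measure_pmf \<pi>. j > n \<bar> i = 1 \<and> k = 0)) \<sim>[at_top]
         (\<lambda>n. lam2 lam q powr a / ((1 - rho lam B) * (a - 1) * (1 - rho1 lam q B) powr a)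
                * real n powr (- a + 1) * L (real n))"
proof -
  interpret Q: bernoulli_retrial_queue M B lam mu q V st by fact
  have rv_B: "rv (\<lambda>t. measure B {t<..}) a"
  proof (rule rv_of_slowly_varying[OF _ _ assms(6,7)])
    show "antimono (\<lambda>t. measure B {t<..})"
      by (intro antimonoI Q.serv.finite_measure_mono) auto
  qed simp
  interpret R: retrial_parameters B lam mu q a
    by unfold_locales (use Q.lam_pos Q.mu_pos Q.q_pos Q.q_less_1 Q.service_pos Q.service_mean assms(2,5) rv_B in auto)
  let ?rho = "rho lam B"
  define s1 :: "(nat \<times> nat \<times> nat) set" where "s1 = {(i, k, j). i = 1}"
  define s0 :: "(nat \<times> nat \<times> nat) set" where "s0 = {(i, k, j). i = 1 \<and> k = 0}"
  define F where "F = (\<lambda>z. M_a lam q B 0 z * M_b lam q B 0 z * M_c lam q B z * R_0 lam mu q B z)"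
  have P1: "prb \<pi> s1 = ?rho"
    using assms(4) by (simp add: choi_park_def s1_def case_prod_unfold)
  have ne1: "set_pmf \<pi> \<inter> s1 \<noteq> {}"
  proof
    assume "set_pmf \<pi> \<inter> s1 = {}"
    then have "prb \<pi> s1 = 0" by (simp add: measure_pmf_zero_iff)
    then show False using P1 R.rho_pos by simp
  qed
  define G :: "real \<Rightarrow> real" where "G = (\<lambda>z. expect \<pi> (\<lambda>(i, k, j). z ^ j * indicator s0 (i, k, j)))"
  have G: "G z / ?rho = F z" if z: "0 \<le> z" "z < 1" for z
  proof -
    \<comment> \<open>Since h(z) is positive even at z = 0, the point z1 = 0 is never the removable
      singularity excluded in \<open>choi_park\<close>.\<close>
    have "0 \<noteq> h_fun lam q B z" using R.pgf_N_pos[of z] z by (simp add: R.h_fun_eq)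
    then have "F z = expect (cond_pmf \<pi> s1) (\<lambda>(i, k, j). 0 ^ k * z ^ j)"
      using assms(4) z unfolding choi_park_def F_def s1_def by simp
    also have "\<dots> = expect \<pi> (\<lambda>x. (case x of (i, k, j) \<Rightarrow> 0 ^ k * z ^ j) * indicator s1 x) / prb \<pi> s1"
      using z by (intro expectation_cond_pmf[OF ne1]) (auto simp: power_le_one power_0_left)
    \<comment> \<open>As \<open>0 ^ k\<close> is 1 for k = 0 and 0 otherwise, z1 = 0 keeps exactly
      the states with an empty queue.\<close>
    also have "(\<lambda>x. (case x of (i, k, j) \<Rightarrow> 0 ^ k * z ^ j) * indicator s1 x) = (\<lambda>(i, k, j). z ^ j * indicator s0 (i, k, j))"
      by (auto simp: s0_def s1_def indicator_def power_0_left)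
    finally show ?thesis by (simp add: G_def P1)
  qed
  have ne0: "set_pmf \<pi> \<inter> s0 \<noteq> {}"
  proof
    assume e: "set_pmf \<pi> \<inter> s0 = {}"
    \<comment> \<open>Any interior point would do: a null event would make the whole generating
      function vanish, against its positivity inside the interval.\<close>
    have "G (1 / 2) = expect \<pi> (\<lambda>_. 0)"
      unfolding G_def by (rule integral_cong_AE) (use e in \<open>auto simp: AE_measure_pmf_iff indicator_def\<close>)
    then have "F (1 / 2) = 0" using G[of "1 / 2"] by simp
    moreover have "0 < F (1 / 2)" unfolding F_def by (rule R.choi_park_pos) auto
    ultimately show False by simp
  qed
  define c where "c = prb \<pi> s0"
  have c: "0 < c" unfolding c_def using ne0 by (auto intro: measure_pmf_posI)
  define X where "X = map_pmf (\<lambda>(i, k, j). j) (cond_pmf \<pi> s0)"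
  have X: "c / ?rho * pgf X z = F z" if z: "0 \<le> z" "z < 1" for z
  proof -
    have "pgf X z = expect (cond_pmf \<pi> s0) (\<lambda>(i, k, j). z ^ j)"
      by (simp add: pgf_def X_def case_prod_unfold)
    also have "\<dots> = expect \<pi> (\<lambda>x. (case x of (i, k, j) \<Rightarrow> z ^ j) * indicator s0 x) / c"
      unfolding c_def using z by (intro expectation_cond_pmf[OF ne0]) (auto simp: power_le_one)
    also have "\<dots> = G z / c" by (simp add: G_def case_prod_unfold)
    finally show ?thesis using c G[OF z] by simp
  qed
  have cond: "\<P>((i, k, j) in measure_pmf \<pi>. j > n \<bar> i = 1 \<and> k = 0) = tail X (real n)" for n
  proof -
    have "tail X (real n) = prb (cond_pmf \<pi> s0) {x. n < snd (snd x)}"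
      by (simp add: tail_def X_def case_prod_unfold vimage_def)
    also have "\<dots> = expect (cond_pmf \<pi> s0) (indicator {x. n < snd (snd x)})" by simp
    also have "\<dots> = expect \<pi> (\<lambda>x. indicator {x. n < snd (snd x)} x * indicator s0 x) / c"
      unfolding c_def by (rule expectation_cond_pmf[OF ne0]) (auto simp: indicator_def)
    also have "(\<lambda>x. indicator {x. n < snd (snd x)} x * indicator s0 x :: real) = indicator {(i, k, j). j > n \<and> i = 1 \<and> k = 0}"
      by (auto simp: indicator_def s0_def)
    also have "expect \<pi> (indicator {(i, k, j). j > n \<and> i = 1 \<and> k = 0}) = prb \<pi> {(i, k, j). j > n \<and> i = 1 \<and> k = 0}"
      by simp
    finally show ?thesis by (simp add: cond_prob_def c_def s0_def case_prod_unfold)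
  qed
  let ?w = "\<lambda>x. x powr (- a + 1) * L x"
  let ?C = "lam2 lam q powr a / ((1 - ?rho) * (a - 1) * (1 - rho1 lam q B) powr a)"
  have Lpos: "0 < L t" if "0 < t" for t using assms(6) that by (auto simp: slowly_varying_def)
  have lB: "((\<lambda>t. measure B {t<..} / (t powr (- a) * L t)) \<longlongrightarrow> 1) at_top"
    by (rule asymp_equivD_strong[OF assms(7)]) (use eventually_gt_at_top[of 0] in \<open>eventually_elim, use Lpos in force\<close>)
  have "((\<lambda>x. tail X x / tail R.K.equilibrium x * (tail R.K.equilibrium x / (x * measure B {x<..})) *
      (measure B {x<..} / (x powr (- a) * L x))) \<longlongrightarrow>
      ?rho * (1 - q) / ((1 - ?rho) * (1 - q * ?rho)) * (1 / R.m) powr (- (a - 1)) * (lam powr a / ((a - 1) * ?rho)) * 1) at_top"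
    by (intro tendsto_mult R.tail_orbit[of "c / ?rho"] R.u_asymp lB) (use X in \<open>auto simp: F_def\<close>)
  also have "?rho * (1 - q) / ((1 - ?rho) * (1 - q * ?rho)) * (1 / R.m) powr (- (a - 1)) * (lam powr a / ((a - 1) * ?rho)) * 1 = ?C"
  proof -
    have q: "0 < 1 - q" "0 < 1 - q * ?rho" "0 < ?rho" "0 < 1 - ?rho" "0 < lam" "0 < a - 1"
      using Q.q_less_1 R.q_rho R.rho_pos assms(2,5) Q.lam_pos by auto
    have "(1 / R.m) powr (- (a - 1)) = R.m powr (a - 1)"
    proof -
      have "(1 / x) powr (- b) = x powr b" if "0 < x" for x b :: real
        using that by (simp add: powr_minus powr_divide)
      from this[OF R.m(1)] show ?thesis .
    qed
    also have "\<dots> = R.m powr a / R.m" using R.m by (simp add: powr_diff)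
    also have "\<dots> = (1 - q) powr a / (1 - q * ?rho) powr a / ((1 - q) / (1 - q * ?rho))"
      using q by (simp add: R.m_def powr_divide)
    finally have 1: "(1 / R.m) powr (- (a - 1)) = (1 - q) powr a / (1 - q * ?rho) powr a / ((1 - q) / (1 - q * ?rho))" .
    have 2: "lam2 lam q powr a = lam powr a * (1 - q) powr a" using q by (simp add: lam2_def powr_mult)
    have 3: "(1 - q * ?rho) powr a \<noteq> 0" using q by simp
    \<comment> \<open>The mean rho cancels between M_c and the equilibrium law, and the spare factor
      of m^(a - 1) = m^a / m cancels the remaining (1 - q) / (1 - q rho).\<close>
    have alg: "r * p / (s * t) * (P / T / (p / t)) * (l / (b * r)) * 1 = l * P / (s * b * T)"
      if "r \<noteq> 0" "p \<noteq> 0" "s \<noteq> 0" "t \<noteq> 0" "T \<noteq> 0" "b \<noteq> 0" for r p s t P T l b :: real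
      using that by (simp add: divide_simps)
    show ?thesis unfolding 1 2 R.rho1_eq by (rule alg) (use q 3 in auto)
  qed
  finally have "((\<lambda>x. tail X x / ?w x) \<longlongrightarrow> ?C) at_top"
  proof (rule Lim_transform_eventually)
    show "\<forall>\<^sub>F x in at_top. tail X x / tail R.K.equilibrium x * (tail R.K.equilibrium x / (x * measure B {x<..})) *
      (measure B {x<..} / (x powr (- a) * L x)) = tail X x / ?w x"
      using eventually_gt_at_top[of 0]
    proof eventually_elim
      case (elim x)
      have ne: "tail R.K.equilibrium x \<noteq> 0" "measure B {x<..} \<noteq> 0"
        using rv_pos[OF R.rv_u, of x] rv_pos[OF rv_B, of x] by auto
      have "x powr (- a + 1) = x * x powr (- a)" using elim by (simp only: powr_add powr_one mult.commute)
      then show ?case using ne elim by simp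
    qed
  qed
  \<comment> \<open>The limit over real arguments is restricted to integers only here.\<close>
  then have "((\<lambda>n. tail X (real n) / ?w (real n)) \<longlongrightarrow> ?C) at_top"
    by (rule filterlim_compose[OF _ filterlim_real_sequentially])
  then have "(\<lambda>n. tail X (real n)) \<sim>[at_top] (\<lambda>n. ?C * ?w (real n))"
  proof (rule asymp_equivI'_const)
    show "?C \<noteq> 0" using Q.q_less_1 R.q_rho assms(2,5) Q.lam_pos by (simp add: lam2_def R.rho1_eq)
  qed
  then show ?thesis unfolding cond by (simp only: mult.assoc)
qed

end
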